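(* Let $\alpha\ge0$, $t\in\mathbb R$, $s=t^2$, and $$p_k^{(\alpha)}(s)=\frac{\Gamma(k+\alpha+1)}{\Gamma(\alpha+1)\Gamma(k+1)}\,\frac{s^k}{(1+s)^{k+\alpha+1}},\qquad k\in\mathbb N_0,$$ with the convention $p_0^{(\alpha)}(0)=1$ and $p_k^{(\alpha)}(0)=0$ for $k\ge1$. Then $$K_\alpha(t;0,k)^2=p_k^{(\alpha)}(s)\quad(k\in\mathbb N_0),\qquad \left\|e^{-itH_\alpha}\right\|_{\ell^1\to\ell^\infty}^2\ge\max_{k\ge0}p_k^{(\alpha)}(s).$$ If $\alpha>0$, a mode (a maximizer $k$ of $k\mapsto p_k^{(\alpha)}(s)$) is $k=\lfloor\alpha s\rfloor$; when $\alpha s$ is a positive integer, the two adjacent values $k=\alpha s-1$ and $k=\alpha s$ tie. Consequently, for $\alpha>0$, $$\lim_{|t|\to\infty}|t|\max_{k\ge0}K_\alpha(t;0,k)=A_\alpha,\qquad A_\alpha=\left(\frac{\alpha^\alpha e^{-\alpha}}{\Gamma(\alpha+1)}\right)^{1/2}.$$ For $\alpha=0$, the same limit holds with $A_0=1$.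
   Context: For $\alpha>-1$, the discrete Laguerre operator $H_\alpha$ is the self-adjoint Jacobi operator on $\ell^2(\mathbb N_0)$ (with its maximal domain) associated with $$(H_\alpha u)_n=\sqrt{n(n+\alpha)}\,u_{n-1}+(2n+1+\alpha)u_n+\sqrt{(n+1)(n+1+\alpha)}\,u_{n+1},\quad u_{-1}=0.$$ $K_\alpha(t;n,m)=|e^{-itH_\alpha}(n,m)|=|\langle\delta_n,e^{-itH_\alpha}\delta_m\rangle|$, and $\|e^{-itH_\alpha}\|_{\ell^1\to\ell^\infty}=\sup_{n,m\in\mathbb N_0}K_\alpha(t;n,m)$ is the operator norm from $\ell^1(\mathbb N_0)$ to $\ell^\infty(\mathbb N_0)$. *)

theory Defs
  imports "HOL-Analysis.Analysis"
begin

definition ell1 :: "(nat \<Rightarrow> complex) set" where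
  "ell1 = {u. summable (\<lambda>n. cmod (u n))}"

definition ell1_norm :: "(nat \<Rightarrow> complex) \<Rightarrow> real" where
  "ell1_norm u = (\<Sum>n. cmod (u n))"

definition linf_norm :: "(nat \<Rightarrow> complex) \<Rightarrow> real" where
  "linf_norm u = (SUP n. cmod (u n))"

definition ell2 :: "(nat \<Rightarrow> complex) set" where
  "ell2 = {u. summable (\<lambda>n. (cmod (u n))\<^sup>2)}"

definition ell2_inner :: "(nat \<Rightarrow> complex) \<Rightarrow> (nat \<Rightarrow> complex) \<Rightarrow> complex" where
  "ell2_inner u v = (\<Sum>n. cnj (u n) * v n)"

definition ell2_norm :: "(nat \<Rightarrow> complex) \<Rightarrow> real" where
  "ell2_norm u = sqrt (\<Sum>n. (cmod (u n))\<^sup>2)"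

definition delta :: "nat \<Rightarrow> nat \<Rightarrow> complex" where
  "delta m n = (if n = m then 1 else 0)"

definition ell1_linf_opnorm :: "((nat \<Rightarrow> complex) \<Rightarrow> (nat \<Rightarrow> complex)) \<Rightarrow> real" where
  "ell1_linf_opnorm U = (SUP u\<in>{u \<in> ell1. ell1_norm u \<le> 1}. linf_norm (U u))"

definition ell2_projection :: "((nat \<Rightarrow> complex) \<Rightarrow> (nat \<Rightarrow> complex)) \<Rightarrow> bool" where
  "ell2_projection P \<longleftrightarrow>
     (\<forall>u\<in>ell2. P u \<in> ell2 \<and> P (P u) = P u) \<and>
     (\<forall>u\<in>ell2. \<forall>v\<in>ell2. \<forall>a b. P (\<lambda>n. a * u n + b * v n) = (\<lambda>n. a * P u n + b * P v n)) \<and>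
     (\<forall>u\<in>ell2. \<forall>v\<in>ell2. ell2_inner v (P u) = ell2_inner (P v) u)"

definition projection_valued_measure ::
    "(real set \<Rightarrow> (nat \<Rightarrow> complex) \<Rightarrow> (nat \<Rightarrow> complex)) \<Rightarrow> bool" where
  "projection_valued_measure E \<longleftrightarrow>
     (\<forall>B\<in>sets borel. ell2_projection (E B)) \<and>
     (\<forall>u\<in>ell2. E {} u = (\<lambda>n. 0) \<and> E UNIV u = u) \<and>
     (\<forall>A\<in>sets borel. \<forall>B\<in>sets borel. \<forall>u\<in>ell2. E (A \<inter> B) u = E A (E B u)) \<and>
     (\<forall>B. range B \<subseteq> sets borel \<longrightarrow> disjoint_family B \<longrightarrow>
        (\<forall>u\<in>ell2. (\<lambda>N. ell2_norm (\<lambda>n. E (\<Union>i. B i) u n - (\<Sum>i<N. E (B i) u n)))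
                     \<longlonglongrightarrow> 0))"

text \<open>The finite positive measure \<open>B \<mapsto> \<langle>u, E(B) u\<rangle>\<close>.\<close>

definition scalar_spectral_measure ::
    "(real set \<Rightarrow> (nat \<Rightarrow> complex) \<Rightarrow> (nat \<Rightarrow> complex)) \<Rightarrow> (nat \<Rightarrow> complex) \<Rightarrow> real measure" where
  "scalar_spectral_measure E u =
     measure_of UNIV (sets borel) (\<lambda>B. ennreal (Re (ell2_inner u (E B u))))"

text \<open>The integral of \<open>f\<close> against the complex measure \<open>B \<mapsto> \<langle>v, E(B) u\<rangle>\<close>, expressed through the
  positive measures by polarization; the inner product is antilinear in its first argument.\<close>

definition spectral_form ::
    "(real set \<Rightarrow> (nat \<Rightarrow> complex) \<Rightarrow> (nat \<Rightarrow> complex)) \<Rightarrow> (real \<Rightarrow> complex) \<Rightarrow>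
     (nat \<Rightarrow> complex) \<Rightarrow> (nat \<Rightarrow> complex) \<Rightarrow> complex" where
  "spectral_form E f v u =
     (\<Sum>k<4. (- \<i>) ^ k * (LINT x|scalar_spectral_measure E (\<lambda>n. v n + \<i> ^ k * u n). f x)) / 4"

text \<open>\<open>T\<close> with domain \<open>D\<close> equals \<open>\<integral> x dE(x)\<close>.\<close>

definition spectral_resolution ::
    "(nat \<Rightarrow> complex) set \<Rightarrow> ((nat \<Rightarrow> complex) \<Rightarrow> (nat \<Rightarrow> complex)) \<Rightarrow>
     (real set \<Rightarrow> (nat \<Rightarrow> complex) \<Rightarrow> (nat \<Rightarrow> complex)) \<Rightarrow> bool" where
  "spectral_resolution D T E \<longleftrightarrow>
     projection_valued_measure E \<and>
     D = {u \<in> ell2. (\<integral>\<^sup>+x. ennreal (x\<^sup>2) \<partial>scalar_spectral_measure E u) < \<infinity>} \<and>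
     (\<forall>u\<in>D. T u \<in> ell2) \<and>
     (\<forall>u\<in>D. \<forall>v\<in>D. ell2_inner v (T u) = spectral_form E (\<lambda>x. complex_of_real x) v u)"

text \<open>Borel functional calculus for bounded \<open>f\<close>. For a self-adjoint operator the spectral
  resolution exists and is unique on Borel sets and square-summable sequences, so the result
  does not depend on the choice.\<close>

definition functional_calculus ::
    "(nat \<Rightarrow> complex) set \<Rightarrow> ((nat \<Rightarrow> complex) \<Rightarrow> (nat \<Rightarrow> complex)) \<Rightarrow> (real \<Rightarrow> complex) \<Rightarrow>
     (nat \<Rightarrow> complex) \<Rightarrow> (nat \<Rightarrow> complex)" where
  "functional_calculus D T f u =
     (\<lambda>n. spectral_form (SOME E. spectral_resolution D T E) f (delta n) u)"

definition laguerre_op :: "real \<Rightarrow> (nat \<Rightarrow> complex) \<Rightarrow> (nat \<Rightarrow> complex)" where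
  "laguerre_op \<alpha> u = (\<lambda>n.
     complex_of_real (sqrt (real n * (real n + \<alpha>))) * (if n = 0 then 0 else u (n - 1)) +
     complex_of_real (2 * real n + 1 + \<alpha>) * u n +
     complex_of_real (sqrt ((real n + 1) * (real n + 1 + \<alpha>))) * u (n + 1))"

definition laguerre_dom :: "real \<Rightarrow> (nat \<Rightarrow> complex) set" where
  "laguerre_dom \<alpha> = {u \<in> ell2. laguerre_op \<alpha> u \<in> ell2}"

definition laguerre_evolution :: "real \<Rightarrow> real \<Rightarrow> (nat \<Rightarrow> complex) \<Rightarrow> (nat \<Rightarrow> complex)" where
  "laguerre_evolution \<alpha> t =
     functional_calculus (laguerre_dom \<alpha>) (laguerre_op \<alpha>)
       (\<lambda>x. exp (- \<i> * complex_of_real t * complex_of_real x))"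

definition laguerre_kernel :: "real \<Rightarrow> real \<Rightarrow> nat \<Rightarrow> nat \<Rightarrow> real" where
  "laguerre_kernel \<alpha> t n m = cmod (ell2_inner (delta n) (laguerre_evolution \<alpha> t (delta m)))"

text \<open>Since \<open>0 ^ 0 = 1\<close>, the value at \<open>s = 0\<close> is \<open>1\<close> for \<open>k = 0\<close> and \<open>0\<close> for \<open>k \<ge> 1\<close>.\<close>

definition laguerre_p :: "real \<Rightarrow> nat \<Rightarrow> real \<Rightarrow> real" where
  "laguerre_p \<alpha> k s =
     Gamma (real k + \<alpha> + 1) / (Gamma (\<alpha> + 1) * Gamma (real k + 1)) *
     (s ^ k / (1 + s) powr (real k + \<alpha> + 1))"

definition is_mode :: "(nat \<Rightarrow> real) \<Rightarrow> nat \<Rightarrow> bool" where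
  "is_mode f k \<longleftrightarrow> (\<forall>j. f j \<le> f k)"

end

theory Submission
  imports Defs "HOL-Real_Asymp.Real_Asymp"
begin

text \<open>
  The evolution is the functional calculus of an arbitrarily chosen spectral resolution, so one has to
  show that a resolution exists and that every resolution gives the same kernel.

  For any resolution, \<open>t \<mapsto> (\<langle>\<delta>\<^sub>0, exp (-i t H) \<delta>\<^sub>k\<rangle>)\<^sub>k\<close> is a solution of the evolution equation
  of the Jacobi matrix that is bounded in the space of square-summable sequences. Since the off-diagonal
  entries satisfy Carleman's condition \<open>\<Sum> 1 / a\<^sub>n = \<infinity>\<close>, such a solution is determined by its initial
  value, hence equals \<open>c\<^sub>k (- i t / (1 + i t))\<^sup>k (1 + i t)\<^bsup>-\<alpha>-1\<^esup>\<close> with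
  \<open>c\<^sub>k\<^sup>2 = (\<alpha> + 1)\<^sub>k / k!\<close>; its squared modulus is \<open>p\<^sub>k(t\<^sup>2)\<close>.

  For existence, let \<open>P\<^sub>n\<close> be the orthonormal polynomials of the Gamma weight defined by the three-term
  recurrence. Their Laplace transforms are given by the same formula with \<open>i t\<close> replaced by a real
  \<open>c\<close>; evaluation at \<open>c = 0\<close> gives orthonormality, and Parseval's equality for \<open>exp (- c x)\<close>
  together with the Weierstrass theorem in the variable \<open>exp (- x)\<close> gives completeness. Therefore the
  matrices \<open>(\<integral>\<^sub>B P\<^sub>n P\<^sub>m)\<close> form a projection-valued measure, and Carleman's condition identifies the
  maximal domain of \<open>H\<close> with the domain of multiplication by \<open>x\<close>.

  The modes follow from the ratio \<open>p\<^sub>k\<^sub>+\<^sub>1 / p\<^sub>k\<close>, and the limit from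
  \<open>(\<alpha> + 1)\<^sub>k / k! \<sim> k\<^sup>\<alpha> / \<Gamma>(\<alpha> + 1)\<close>.
\<close>

section \<open>Square-summable sequences\<close>

text \<open>\<open>spectral_form\<close> adds four integrals against different measures, so neither
  its sesquilinearity nor its multiplicativity is visible from the definition. One device supplies
  both: each side of such an identity is a functional of the integrand that respects dominated
  pointwise limits, and such functionals agree as soon as they agree on indicators, where the axioms
  of \<open>projection_valued_measure\<close> decide. The chosen resolution is never shown to be
  unique. Only the entries between \<open>delta 0\<close> and \<open>delta k\<close> of the
  evolution are computed, from the axioms alone; the lower bound for the operator norm needs no
  other entry. Existence is delicate because the domain in \<open>spectral_resolution\<close> has to
  be the maximal one: a priori, a vector with \<open>laguerre_op \<alpha> u\<close> in
  \<open>ell2\<close> could have infinite second moment. Symmetry of the operator on the maximal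
  domain excludes this. Carleman's condition thus enters twice, in independent forms: in Green's
  formula for fixed vectors, and in the energy flux of a time-dependent solution.\<close>

lemma le_of_power2_le_mult:
  fixes x c :: real
  assumes "x\<^sup>2 \<le> c * x" "0 \<le> x" "0 \<le> c"
  shows "x \<le> c"
  using assms by (cases "x = 0") (auto simp: power2_eq_square)

definition nsq :: "(nat \<Rightarrow> complex) \<Rightarrow> real" where
  "nsq u = (\<Sum>n. (cmod (u n))\<^sup>2)"

definition trunc :: "nat \<Rightarrow> (nat \<Rightarrow> complex) \<Rightarrow> nat \<Rightarrow> complex" where
  "trunc N u n = (if n < N then u n else 0)"

lemma ell2D: "u \<in> ell2 \<Longrightarrow> summable (\<lambda>n. (cmod (u n))\<^sup>2)"
  by (simp add: ell2_def)

lemma nsq_nonneg: "u \<in> ell2 \<Longrightarrow> 0 \<le> nsq u"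
  unfolding nsq_def by (intro suminf_nonneg) (auto dest: ell2D)

lemma ell2_norm_eq_sqrt_nsq: "ell2_norm u = sqrt (nsq u)"
  by (simp add: ell2_norm_def nsq_def)

lemma nsq_eq_norm_power2: "u \<in> ell2 \<Longrightarrow> nsq u = (ell2_norm u)\<^sup>2"
  by (simp add: ell2_norm_eq_sqrt_nsq nsq_nonneg)

lemma ell2_norm_nonneg: "u \<in> ell2 \<Longrightarrow> 0 \<le> ell2_norm u"
  by (simp add: ell2_norm_eq_sqrt_nsq nsq_nonneg)

lemma sum_le_nsq: "u \<in> ell2 \<Longrightarrow> (\<Sum>n<N. (cmod (u n))\<^sup>2) \<le> nsq u"
  unfolding nsq_def by (intro sum_le_suminf) (auto dest: ell2D)

lemma ell2I_bounded:
  assumes "\<And>N. (\<Sum>n<N. (cmod (u n))\<^sup>2) \<le> C"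
  shows "u \<in> ell2" "nsq u \<le> C"
proof -
  have "summable (\<lambda>n. (cmod (u n))\<^sup>2)"
    by (rule summableI_nonneg_bounded[of _ C]) (auto simp: assms)
  thus "u \<in> ell2" by (simp add: ell2_def)
  show "nsq u \<le> C" unfolding nsq_def
    by (rule suminf_le_const) (use \<open>summable _\<close> assms in auto)
qed

lemma cmod_add_power2_le: "(cmod (x + y))\<^sup>2 \<le> 2 * (cmod x)\<^sup>2 + 2 * (cmod y)\<^sup>2"
proof -
  have "(cmod (x + y))\<^sup>2 \<le> (cmod x + cmod y)\<^sup>2"
    by (intro power_mono norm_triangle_ineq) auto
  also have "\<dots> \<le> 2 * (cmod x)\<^sup>2 + 2 * (cmod y)\<^sup>2"
    using sum_squares_bound[of "cmod x" "cmod y"] by (simp add: power2_sum)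
  finally show ?thesis .
qed

lemma ell2_add:
  assumes "u \<in> ell2" "v \<in> ell2"
  shows "(\<lambda>n. u n + v n) \<in> ell2" "nsq (\<lambda>n. u n + v n) \<le> 2 * nsq u + 2 * nsq v"
proof -
  have "(\<Sum>n<N. (cmod (u n + v n))\<^sup>2) \<le> 2 * nsq u + 2 * nsq v" for N
  proof -
    have "(\<Sum>n<N. (cmod (u n + v n))\<^sup>2) \<le> (\<Sum>n<N. 2 * (cmod (u n))\<^sup>2 + 2 * (cmod (v n))\<^sup>2)"
      by (intro sum_mono cmod_add_power2_le)
    also have "\<dots> = 2 * (\<Sum>n<N. (cmod (u n))\<^sup>2) + 2 * (\<Sum>n<N. (cmod (v n))\<^sup>2)"
      by (simp add: sum.distrib sum_distrib_left)
    also have "\<dots> \<le> 2 * nsq u + 2 * nsq v"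
      using sum_le_nsq[OF assms(1)] sum_le_nsq[OF assms(2)] by (intro add_mono mult_left_mono) auto
    finally show ?thesis .
  qed
  from ell2I_bounded[OF this] show "(\<lambda>n. u n + v n) \<in> ell2"
    "nsq (\<lambda>n. u n + v n) \<le> 2 * nsq u + 2 * nsq v" by auto
qed

lemma nsq_scale: "u \<in> ell2 \<Longrightarrow> nsq (\<lambda>n. a * u n) = (cmod a)\<^sup>2 * nsq u"
  unfolding nsq_def norm_mult power_mult_distrib
  by (rule suminf_mult) (auto dest: ell2D)

lemma ell2_scale: "u \<in> ell2 \<Longrightarrow> (\<lambda>n. a * u n) \<in> ell2"
  unfolding ell2_def by (auto simp: norm_mult power_mult_distrib intro: summable_mult)

lemma ell2_lincomb: "u \<in> ell2 \<Longrightarrow> v \<in> ell2 \<Longrightarrow> (\<lambda>n. a * u n + b * v n) \<in> ell2"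
  by (intro ell2_add ell2_scale)

lemma ell2_diff: "u \<in> ell2 \<Longrightarrow> v \<in> ell2 \<Longrightarrow> (\<lambda>n. u n - v n) \<in> ell2"
  using ell2_lincomb[of u v 1 "-1"] by simp

lemma ell2_zero [simp]: "(\<lambda>n. 0) \<in> ell2"
  by (simp add: ell2_def)

lemma ell2_sum: "(\<And>i. i \<in> I \<Longrightarrow> u i \<in> ell2) \<Longrightarrow> (\<lambda>n. \<Sum>i\<in>I. u i n) \<in> ell2"
  by (induction I rule: infinite_finite_induct) (auto intro!: ell2_add)

lemma nsq_eq_0D: "u \<in> ell2 \<Longrightarrow> nsq u = 0 \<Longrightarrow> u = (\<lambda>n. 0)"
  by (rule ext, drule ell2D) (auto simp: nsq_def suminf_eq_zero_iff)

lemma finite_support_ell2: "(\<And>n. n \<ge> N \<Longrightarrow> u n = 0) \<Longrightarrow> u \<in> ell2"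
  unfolding ell2_def mem_Collect_eq
  by (rule summable_finite[of "{..<N}"]) (auto simp: not_less)

lemma nsq_finite_support: "(\<And>n. n \<ge> N \<Longrightarrow> u n = 0) \<Longrightarrow> nsq u = (\<Sum>n<N. (cmod (u n))\<^sup>2)"
  unfolding nsq_def by (intro suminf_finite) auto

lemma trunc_ell2: "trunc N u \<in> ell2"
  by (rule finite_support_ell2[of N]) (simp add: trunc_def)

lemma nsq_trunc: "nsq (trunc N u) = (\<Sum>n<N. (cmod (u n))\<^sup>2)"
  by (subst nsq_finite_support[of N]) (auto simp: trunc_def)

lemma delta_ell2: "delta m \<in> ell2"
  by (rule finite_support_ell2[of "Suc m"]) (simp add: delta_def)

lemma nsq_delta: "nsq (delta m) = 1"
  by (subst nsq_finite_support[of "Suc m"]) (auto simp: delta_def if_distrib cong: if_cong)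

lemma L2_set_le_ell2_norm: "u \<in> ell2 \<Longrightarrow> L2_set (\<lambda>n. cmod (u n)) {..<N} \<le> ell2_norm u"
  unfolding L2_set_def ell2_norm_eq_sqrt_nsq by (intro real_sqrt_le_mono sum_le_nsq)

lemma summable_ell2_product:
  assumes "u \<in> ell2" "v \<in> ell2"
  shows "summable (\<lambda>n. cmod (u n) * cmod (v n))"
    and "(\<Sum>n. cmod (u n) * cmod (v n)) \<le> ell2_norm u * ell2_norm v"
proof -
  have *: "(\<Sum>n<N. cmod (u n) * cmod (v n)) \<le> ell2_norm u * ell2_norm v" for N
  proof -
    have "(\<Sum>n<N. cmod (u n) * cmod (v n)) \<le> L2_set (\<lambda>n. cmod (u n)) {..<N} * L2_set (\<lambda>n. cmod (v n)) {..<N}"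
      using L2_set_mult_ineq[of "\<lambda>n. cmod (u n)" "\<lambda>n. cmod (v n)" "{..<N}"] by simp
    also have "\<dots> \<le> ell2_norm u * ell2_norm v"
      using assms by (intro mult_mono L2_set_le_ell2_norm ell2_norm_nonneg) (auto simp: L2_set_def sum_nonneg)
    finally show ?thesis .
  qed
  show s: "summable (\<lambda>n. cmod (u n) * cmod (v n))"
    by (rule summableI_nonneg_bounded[of _ "ell2_norm u * ell2_norm v"]) (auto simp: *)
  show "(\<Sum>n. cmod (u n) * cmod (v n)) \<le> ell2_norm u * ell2_norm v"
    by (rule suminf_le_const[OF s *])
qed

lemma summable_inner: "u \<in> ell2 \<Longrightarrow> v \<in> ell2 \<Longrightarrow> summable (\<lambda>n. cnj (u n) * v n)"
  by (rule summable_norm_cancel) (simp add: norm_mult summable_ell2_product)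

lemma inner_sums: "u \<in> ell2 \<Longrightarrow> v \<in> ell2 \<Longrightarrow> (\<lambda>n. cnj (u n) * v n) sums ell2_inner u v"
  unfolding ell2_inner_def by (rule summable_sums[OF summable_inner])

lemma inner_Cauchy_Schwarz:
  assumes "u \<in> ell2" "v \<in> ell2"
  shows "cmod (ell2_inner u v) \<le> ell2_norm u * ell2_norm v"
proof -
  have "cmod (ell2_inner u v) \<le> (\<Sum>n. cmod (cnj (u n) * v n))"
    unfolding ell2_inner_def
    by (rule summable_norm) (simp add: norm_mult summable_ell2_product assms)
  also have "\<dots> \<le> ell2_norm u * ell2_norm v"
    using summable_ell2_product[OF assms] by (simp add: norm_mult)
  finally show ?thesis .
qed

lemma inner_lincomb_right:
  assumes "w \<in> ell2" "u \<in> ell2" "v \<in> ell2"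
  shows "ell2_inner w (\<lambda>n. a * u n + b * v n) = a * ell2_inner w u + b * ell2_inner w v"
proof -
  have "(\<lambda>n. a * (cnj (w n) * u n) + b * (cnj (w n) * v n)) sums (a * ell2_inner w u + b * ell2_inner w v)"
    by (intro sums_add sums_mult inner_sums assms)
  moreover have "(\<lambda>n. a * (cnj (w n) * u n) + b * (cnj (w n) * v n)) = (\<lambda>n. cnj (w n) * (a * u n + b * v n))"
    by (auto simp: algebra_simps)
  ultimately show ?thesis unfolding ell2_inner_def[of w "\<lambda>n. a * u n + b * v n"]
    by (simp add: sums_iff)
qed

lemma inner_cnj: "u \<in> ell2 \<Longrightarrow> v \<in> ell2 \<Longrightarrow> cnj (ell2_inner u v) = ell2_inner v u"
proof -
  assume "u \<in> ell2" "v \<in> ell2"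
  hence "(\<lambda>n. cnj (cnj (u n) * v n)) sums cnj (ell2_inner u v)"
    by (subst sums_cnj) (rule inner_sums)
  thus ?thesis unfolding ell2_inner_def[of v u] by (simp add: sums_iff mult.commute)
qed

lemma inner_lincomb_left:
  assumes "w \<in> ell2" "u \<in> ell2" "v \<in> ell2"
  shows "ell2_inner (\<lambda>n. a * u n + b * v n) w = cnj a * ell2_inner u w + cnj b * ell2_inner v w"
  using arg_cong[OF inner_lincomb_right[OF assms, of a b], of cnj]
  by (simp add: inner_cnj assms ell2_lincomb)

lemma inner_self: "u \<in> ell2 \<Longrightarrow> ell2_inner u u = of_real (nsq u)"
proof -
  assume "u \<in> ell2"
  hence "(\<lambda>n. complex_of_real ((cmod (u n))\<^sup>2)) sums of_real (nsq u)"
    unfolding nsq_def by (intro sums_of_real summable_sums ell2D)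
  thus ?thesis by (simp add: ell2_inner_def sums_iff complex_norm_square mult.commute flip: of_real_power)
qed

lemma inner_delta_left: "ell2_inner (delta m) u = u m"
proof -
  have "ell2_inner (delta m) u = (\<Sum>n\<in>{m}. cnj (delta m n) * u n)"
    unfolding ell2_inner_def by (rule suminf_finite) (auto simp: delta_def)
  thus ?thesis by (simp add: delta_def)
qed

lemma inner_trunc_left: "ell2_inner (trunc N v) u = (\<Sum>n<N. cnj (v n) * u n)"
proof -
  have "ell2_inner (trunc N v) u = (\<Sum>n<N. cnj (trunc N v n) * u n)"
    unfolding ell2_inner_def by (rule suminf_finite) (auto simp: trunc_def)
  thus ?thesis by (simp add: trunc_def)
qed

lemma trunc_tendsto:
  assumes "u \<in> ell2"
  shows "(\<lambda>N. nsq (\<lambda>n. u n - trunc N u n)) \<longlonglongrightarrow> 0"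
proof -
  let ?f = "\<lambda>n. (cmod (u n))\<^sup>2"
  have s: "summable ?f" using assms by (rule ell2D)
  have "nsq (\<lambda>n. u n - trunc N u n) = nsq u - (\<Sum>n<N. ?f n)" for N
  proof -
    have "summable (\<lambda>n. (cmod (u n - trunc N u n))\<^sup>2)"
      by (rule ell2D[OF ell2_diff[OF assms trunc_ell2]])
    hence "nsq (\<lambda>n. u n - trunc N u n) = (\<Sum>n. (cmod (u (n + N) - trunc N u (n + N)))\<^sup>2) + (\<Sum>n<N. (cmod (u n - trunc N u n))\<^sup>2)"
      unfolding nsq_def by (rule suminf_split_initial_segment)
    also have "\<dots> = (\<Sum>n. ?f (n + N))" by (simp add: trunc_def)
    also have "\<dots> = nsq u - (\<Sum>n<N. ?f n)"
      unfolding nsq_def using suminf_split_initial_segment[OF s, of N] by simp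
    finally show ?thesis .
  qed
  moreover have "(\<lambda>N. nsq u - (\<Sum>n<N. ?f n)) \<longlonglongrightarrow> nsq u - nsq u"
    unfolding nsq_def by (intro tendsto_diff tendsto_const summable_LIMSEQ s)
  ultimately show ?thesis by simp
qed

lemma ell2_norm_tendsto_zeroI: "(\<lambda>N. nsq (f N)) \<longlonglongrightarrow> 0 \<Longrightarrow> (\<lambda>N. ell2_norm (f N)) \<longlonglongrightarrow> 0"
  using tendsto_real_sqrt[of "\<lambda>N. nsq (f N)" 0 sequentially] by (simp add: ell2_norm_eq_sqrt_nsq)

text \<open>Entries of modulus at most 1 have squares no larger than themselves. This lets the
  evolution, which is controlled on \<open>ell2\<close>, be estimated on the unit ball of
  \<open>ell1\<close>.\<close>

lemma ell1_subset_ell2: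
  assumes "u \<in> ell1" "ell1_norm u \<le> 1"
  shows "u \<in> ell2" "nsq u \<le> 1"
proof -
  have s: "summable (\<lambda>n. cmod (u n))" using assms by (simp add: ell1_def)
  have le1: "cmod (u n) \<le> 1" for n
  proof -
    have "(\<Sum>k\<in>{n}. cmod (u k)) \<le> (\<Sum>k. cmod (u k))"
      by (rule sum_le_suminf[OF s]) auto
    thus ?thesis using assms(2) by (simp add: ell1_norm_def)
  qed
  have "(\<Sum>n<N. (cmod (u n))\<^sup>2) \<le> 1" for N
  proof -
    have "(\<Sum>n<N. (cmod (u n))\<^sup>2) \<le> (\<Sum>n<N. cmod (u n))"
      by (intro sum_mono) (use le1 in \<open>auto simp: power2_eq_square mult_left_le\<close>)
    also have "\<dots> \<le> (\<Sum>n. cmod (u n))" by (rule sum_le_suminf[OF s]) auto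
    finally show ?thesis using assms(2) by (simp add: ell1_norm_def)
  qed
  from ell2I_bounded[OF this] show "u \<in> ell2" "nsq u \<le> 1" by auto
qed

section \<open>Functionals satisfying dominated convergence\<close>

definition dominated :: "(real \<Rightarrow> real) \<Rightarrow> (real \<Rightarrow> complex) set" where
  "dominated h = {f \<in> borel_measurable borel. \<exists>C. \<forall>x. cmod (f x) \<le> C * h x}"

text \<open>Captures what integration against a finite complex measure satisfies without introducing
  complex measures. The weight \<open>h\<close> is 1 for bounded integrands and 1 + |x| when the
  unbounded operator is involved.\<close>

definition dct_functional :: "(real \<Rightarrow> real) \<Rightarrow> ((real \<Rightarrow> complex) \<Rightarrow> complex) \<Rightarrow> bool" where
  "dct_functional h \<Phi> \<longleftrightarrow>
     (\<forall>f\<in>dominated h. \<forall>g\<in>dominated h. \<forall>a b. \<Phi> (\<lambda>x. a * f x + b * g x) = a * \<Phi> f + b * \<Phi> g) \<and>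
     (\<forall>s f C. (\<forall>n. s n \<in> borel_measurable borel) \<longrightarrow> (\<forall>n x. cmod (s n x) \<le> C * h x) \<longrightarrow>
        (\<forall>x. (\<lambda>n. s n x) \<longlonglongrightarrow> f x) \<longrightarrow> (\<lambda>n. \<Phi> (s n)) \<longlonglongrightarrow> \<Phi> f)"

lemma dominatedI: "f \<in> borel_measurable borel \<Longrightarrow> (\<And>x. cmod (f x) \<le> C * h x) \<Longrightarrow> f \<in> dominated h"
  by (auto simp: dominated_def)

lemma dominated_bounded: "f \<in> borel_measurable borel \<Longrightarrow> (\<And>x. cmod (f x) \<le> C) \<Longrightarrow> f \<in> dominated (\<lambda>x. 1)"
  by (auto simp: dominated_def intro!: exI[of _ C])

lemma dominated_lincomb:
  assumes "f \<in> dominated h" "g \<in> dominated h"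
  shows "(\<lambda>x. a * f x + b * g x) \<in> dominated h"
proof -
  obtain C D where C: "\<And>x. cmod (f x) \<le> C * h x" and D: "\<And>x. cmod (g x) \<le> D * h x"
    using assms by (auto simp: dominated_def)
  show ?thesis
  proof (rule dominatedI[of _ "cmod a * C + cmod b * D"])
    show "(\<lambda>x. a * f x + b * g x) \<in> borel_measurable borel"
      using assms by (auto simp: dominated_def)
    fix x
    have "cmod (a * f x + b * g x) \<le> cmod a * cmod (f x) + cmod b * cmod (g x)"
      by (metis norm_mult norm_triangle_ineq)
    also have "\<dots> \<le> cmod a * (C * h x) + cmod b * (D * h x)"
      by (intro add_mono mult_left_mono C D) auto
    finally show "cmod (a * f x + b * g x) \<le> (cmod a * C + cmod b * D) * h x"
      by (simp add: algebra_simps)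
  qed
qed

lemma dominated_zero [simp]: "(\<lambda>x. 0) \<in> dominated h"
  by (rule dominatedI[of _ 0]) auto

lemma dominated_indicator: "(\<And>x. 1 \<le> h x) \<Longrightarrow> A \<in> sets borel \<Longrightarrow> indicator A \<in> dominated h"
  by (rule dominatedI[of _ 1]) (use order.trans[OF zero_le_one] in \<open>auto simp: indicator_def\<close>)

lemma dct_lincomb:
  "dct_functional h \<Phi> \<Longrightarrow> f \<in> dominated h \<Longrightarrow> g \<in> dominated h \<Longrightarrow>
    \<Phi> (\<lambda>x. a * f x + b * g x) = a * \<Phi> f + b * \<Phi> g"
  by (auto simp: dct_functional_def)

lemma dct_zero: "dct_functional h \<Phi> \<Longrightarrow> \<Phi> (\<lambda>x. 0) = 0"
  using dct_lincomb[of h \<Phi> "\<lambda>x. 0" "\<lambda>x. 0" 0 0] by simp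

lemma dct_limit:
  "dct_functional h \<Phi> \<Longrightarrow> (\<And>n. s n \<in> borel_measurable borel) \<Longrightarrow> (\<And>n x. cmod (s n x) \<le> C * h x) \<Longrightarrow>
    (\<And>x. (\<lambda>n. s n x) \<longlonglongrightarrow> f x) \<Longrightarrow> (\<lambda>n. \<Phi> (s n)) \<longlonglongrightarrow> \<Phi> f"
  unfolding dct_functional_def by blast

lemma dct_sum:
  assumes "dct_functional h \<Phi>" "finite I" "\<And>i. i \<in> I \<Longrightarrow> f i \<in> dominated h"
  shows "(\<lambda>x. \<Sum>i\<in>I. c i * f i x) \<in> dominated h \<and> \<Phi> (\<lambda>x. \<Sum>i\<in>I. c i * f i x) = (\<Sum>i\<in>I. c i * \<Phi> (f i))"
  using assms(2,3)
proof (induction I)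
  case empty
  show ?case by (simp add: dct_zero[OF assms(1)])
next
  case (insert i I)
  hence IH: "(\<lambda>x. \<Sum>i\<in>I. c i * f i x) \<in> dominated h" "\<Phi> (\<lambda>x. \<Sum>i\<in>I. c i * f i x) = (\<Sum>i\<in>I. c i * \<Phi> (f i))"
    by auto
  have fi: "f i \<in> dominated h" using insert by auto
  show ?case
    using dct_lincomb[OF assms(1) fi IH(1), of "c i" 1] dominated_lincomb[OF fi IH(1), of "c i" 1]
      IH(2) insert(1,2) by simp
qed

lemma simple_function_eq_sum:
  fixes s :: "real \<Rightarrow> 'a :: {comm_semiring_1, t2_space}"
  assumes "simple_function borel s"
  shows "s = (\<lambda>x. \<Sum>y\<in>range s. y * indicator (s -` {y}) x)"
proof
  fix x
  have fin: "finite (range s)" using simple_functionD(1)[OF assms] by simp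
  show "s x = (\<Sum>y\<in>range s. y * indicator (s -` {y}) x)"
    by (subst sum.mono_neutral_right[OF fin, of "{s x}"]) (auto simp: indicator_def)
qed

text \<open>Simple functions are combinations of indicators, and every dominated \<open>f\<close> is
  a pointwise limit of simple functions of modulus at most 2 |f|. The condition
  \<open>1 \<le> h x\<close> makes the indicators dominated.\<close>

lemma dct_eqI:
  assumes \<Phi>: "dct_functional h \<Phi>" and \<Psi>: "dct_functional h \<Psi>" and h: "\<And>x. 1 \<le> h x"
    and eq: "\<And>A. A \<in> sets borel \<Longrightarrow> \<Phi> (indicator A) = \<Psi> (indicator A)"
    and f: "f \<in> dominated h"
  shows "\<Phi> f = \<Psi> f"
proof -
  have simple: "\<Phi> s = \<Psi> s" if "simple_function borel s" for s
  proof -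
    let ?A = "\<lambda>y. s -` {y}"
    have fin: "finite (range s)" using simple_functionD(1)[OF that] by simp
    have A: "?A y \<in> sets borel" for y using simple_functionD(2)[OF that, of "{y}"] by simp
    note s = simple_function_eq_sum[OF that]
    have "\<Phi> s = (\<Sum>y\<in>range s. y * \<Phi> (indicator (?A y)))"
      using trans[OF arg_cong[OF s, of \<Phi>] conjunct2[OF dct_sum[OF \<Phi> fin dominated_indicator[OF h A], of "\<lambda>y. y"]]] .
    moreover have "\<Psi> s = (\<Sum>y\<in>range s. y * \<Psi> (indicator (?A y)))"
      using trans[OF arg_cong[OF s, of \<Psi>] conjunct2[OF dct_sum[OF \<Psi> fin dominated_indicator[OF h A], of "\<lambda>y. y"]]] .
    ultimately show ?thesis by (simp add: eq A)
  qed
  obtain C where C: "\<And>x. cmod (f x) \<le> C * h x" and fm: "f \<in> borel_measurable borel"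
    using f by (auto simp: dominated_def)
  obtain s where s: "\<And>i. simple_function borel (s i)" "\<And>x. (\<lambda>i. s i x) \<longlonglongrightarrow> f x"
    "\<And>i x. dist (s i x) 0 \<le> 2 * dist (f x) 0"
    using borel_measurable_implies_sequence_metric[OF fm, of 0] by auto
  have sb: "cmod (s n x) \<le> (2 * C) * h x" for n x
    using s(3)[of n x] C[of x] by simp
  have sm: "s n \<in> borel_measurable borel" for n
    by (rule borel_measurable_simple_function[OF s(1)])
  have "(\<lambda>n. \<Phi> (s n)) \<longlonglongrightarrow> \<Phi> f"
    by (rule dct_limit[OF \<Phi> sm sb s(2)])
  moreover have "(\<lambda>n. \<Psi> (s n)) \<longlonglongrightarrow> \<Psi> f"
    by (rule dct_limit[OF \<Psi> sm sb s(2)])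
  ultimately show ?thesis
    using simple[OF s(1)] LIMSEQ_unique by simp
qed

lemma dominated_integrable:
  assumes "sets M = sets borel" "integrable M h" "f \<in> dominated h"
  shows "integrable M f"
proof -
  obtain C where C: "\<And>x. cmod (f x) \<le> C * h x" and fm: "f \<in> borel_measurable borel"
    using assms by (auto simp: dominated_def)
  have fM: "f \<in> borel_measurable M" using fm assms(1) measurable_cong_sets by blast
  show ?thesis
    by (rule Bochner_Integration.integrable_bound[OF integrable_mult_right[OF assms(2), of C] fM])
       (auto intro!: AE_I2 order.trans[OF C] simp del: abs_mult)
qed

lemma dct_integral:
  assumes M: "sets M = sets borel" and h: "integrable M h"
  shows "dct_functional h (\<lambda>f. LINT x|M. f x)"
  unfolding dct_functional_def
proof (intro conjI ballI allI impI)
  fix f g a b assume f: "f \<in> dominated h" "g \<in> dominated h"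
  have "integrable M f" "integrable M g" by (auto intro: dominated_integrable[OF M h] f)
  thus "(LINT x|M. a * f x + b * g x) = a * (LINT x|M. f x) + b * (LINT x|M. g x)"
    by (subst Bochner_Integration.integral_add) auto
next
  fix s :: "nat \<Rightarrow> real \<Rightarrow> complex" and f C
  assume s: "\<forall>n. s n \<in> borel_measurable borel" "\<forall>n x. cmod (s n x) \<le> C * h x" "\<forall>x. (\<lambda>n. s n x) \<longlonglongrightarrow> f x"
  have sM: "s n \<in> borel_measurable M" for n using s(1) M measurable_cong_sets by blast
  have "f \<in> borel_measurable borel"
    by (rule borel_measurable_LIMSEQ_metric[of s]) (use s in auto)
  hence fM: "f \<in> borel_measurable M" using M measurable_cong_sets by blast
  show "(\<lambda>n. LINT x|M. s n x) \<longlonglongrightarrow> (LINT x|M. f x)"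
    by (rule integral_dominated_convergence[where w="\<lambda>x. C * h x"])
       (use s sM fM h in auto)
qed

lemma dct_functional_lincomb:
  assumes "dct_functional h \<Phi>" "dct_functional h \<Psi>"
  shows "dct_functional h (\<lambda>f. a * \<Phi> f + b * \<Psi> f)"
  unfolding dct_functional_def
proof (intro conjI ballI allI impI)
  fix f g c d assume "f \<in> dominated h" "g \<in> dominated h"
  thus "a * \<Phi> (\<lambda>x. c * f x + d * g x) + b * \<Psi> (\<lambda>x. c * f x + d * g x)
        = c * (a * \<Phi> f + b * \<Psi> f) + d * (a * \<Phi> g + b * \<Psi> g)"
    by (simp add: dct_lincomb[OF assms(1)] dct_lincomb[OF assms(2)] algebra_simps)
next
  fix s :: "nat \<Rightarrow> real \<Rightarrow> complex" and f C
  assume "\<forall>n. s n \<in> borel_measurable borel" "\<forall>n x. cmod (s n x) \<le> C * h x" "\<forall>x. (\<lambda>n. s n x) \<longlonglongrightarrow> f x"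
  thus "(\<lambda>n. a * \<Phi> (s n) + b * \<Psi> (s n)) \<longlonglongrightarrow> a * \<Phi> f + b * \<Psi> f"
    by (intro tendsto_intros dct_limit[OF assms(1)] dct_limit[OF assms(2)]) auto
qed

lemma dct_functional_sum:
  assumes "\<And>k. k < (n::nat) \<Longrightarrow> dct_functional h (\<Phi> k)"
  shows "dct_functional h (\<lambda>f. \<Sum>k<n. c k * \<Phi> k f)"
  using assms
proof (induction n)
  case 0
  show ?case by (simp add: dct_functional_def)
next
  case (Suc n)
  show ?case
    using dct_functional_lincomb[OF Suc.IH Suc.prems[of n], of 1 "c n"] Suc.prems by simp
qed

lemma dominated_cnj: "f \<in> dominated h \<Longrightarrow> (\<lambda>x. cnj (f x)) \<in> dominated h"
  by (auto simp: dominated_def intro!: borel_measurable_continuous_on[OF _ , of cnj] continuous_intros)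

lemma dct_functional_cnj:
  assumes "dct_functional h \<Phi>"
  shows "dct_functional h (\<lambda>f. cnj (\<Phi> (\<lambda>x. cnj (f x))))"
  unfolding dct_functional_def
proof (intro conjI ballI allI impI)
  fix f g c d assume "f \<in> dominated h" "g \<in> dominated h"
  thus "cnj (\<Phi> (\<lambda>x. cnj (c * f x + d * g x))) = c * cnj (\<Phi> (\<lambda>x. cnj (f x))) + d * cnj (\<Phi> (\<lambda>x. cnj (g x)))"
    using dct_lincomb[OF assms dominated_cnj dominated_cnj, of f g "cnj c" "cnj d"] by simp
next
  fix s :: "nat \<Rightarrow> real \<Rightarrow> complex" and f C
  assume *: "\<forall>n. s n \<in> borel_measurable borel" "\<forall>n x. cmod (s n x) \<le> C * h x" "\<forall>x. (\<lambda>n. s n x) \<longlonglongrightarrow> f x"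
  have "(\<lambda>x. cnj (s n x)) \<in> borel_measurable borel" for n
    using * by (intro borel_measurable_continuous_on[of cnj]) (auto intro: continuous_intros)
  with * show "(\<lambda>n. cnj (\<Phi> (\<lambda>x. cnj (s n x)))) \<longlonglongrightarrow> cnj (\<Phi> (\<lambda>x. cnj (f x)))"
    by (intro tendsto_cnj dct_limit[OF assms]) (auto intro: tendsto_cnj)
qed

text \<open>Absorbing a factor \<open>e\<close> into the functional changes the weight. With
  \<open>e x = x\<close> a functional for 1 + |x| becomes one for bounded functions, to which
  \<open>dct_eqI\<close> applies.\<close>

lemma dct_functional_mult:
  assumes \<Phi>: "dct_functional h \<Phi>" and e: "e \<in> borel_measurable borel"
    and k: "\<And>x. 0 \<le> k x" "\<And>x. cmod (e x) * k x \<le> D * h x"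
  shows "dct_functional k (\<lambda>f. \<Phi> (\<lambda>x. e x * f x))"
proof -
  \<comment> \<open>The domination constant in \<open>dct_functional\<close> carries no sign
    condition, hence the absolute value.\<close>
  have le: "cmod (e x * y) \<le> (\<bar>C\<bar> * D) * h x" if "cmod y \<le> C * k x" for x y C
  proof -
    have "cmod y \<le> \<bar>C\<bar> * k x" using mult_right_mono[OF abs_ge_self k(1), of C x] that by linarith
    hence "cmod (e x * y) \<le> cmod (e x) * (\<bar>C\<bar> * k x)"
      unfolding norm_mult by (rule mult_left_mono) auto
    also have "\<dots> = \<bar>C\<bar> * (cmod (e x) * k x)" by simp
    also have "\<dots> \<le> \<bar>C\<bar> * (D * h x)" by (intro mult_left_mono k) auto
    finally show ?thesis by simp
  qed
  have dom: "(\<lambda>x. e x * f x) \<in> dominated h" if "f \<in> dominated k" for f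
    proof -
    from that obtain C where C: "\<And>x. cmod (f x) \<le> C * k x" and fm: "f \<in> borel_measurable borel"
      by (auto simp: dominated_def)
    show ?thesis by (rule dominatedI[OF _ le[OF C]]) (use fm e in auto)
  qed
  show ?thesis unfolding dct_functional_def
  proof (intro conjI ballI allI impI)
    fix f g c d assume "f \<in> dominated k" "g \<in> dominated k"
    from dct_lincomb[OF \<Phi> dom[OF this(1)] dom[OF this(2)], of c d]
    show "\<Phi> (\<lambda>x. e x * (c * f x + d * g x)) = c * \<Phi> (\<lambda>x. e x * f x) + d * \<Phi> (\<lambda>x. e x * g x)"
      by (simp add: algebra_simps)
  next
    fix s :: "nat \<Rightarrow> real \<Rightarrow> complex" and f C
    assume *: "\<forall>n. s n \<in> borel_measurable borel" "\<forall>n x. cmod (s n x) \<le> C * k x" "\<forall>x. (\<lambda>n. s n x) \<longlonglongrightarrow> f x"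
    show "(\<lambda>n. \<Phi> (\<lambda>x. e x * s n x)) \<longlonglongrightarrow> \<Phi> (\<lambda>x. e x * f x)"
      proof (rule dct_limit[OF \<Phi>, where C = "\<bar>C\<bar> * D"])
      show "(\<lambda>x. e x * s n x) \<in> borel_measurable borel" for n
        using *(1) e by (intro borel_measurable_times) auto
    qed (use * le in \<open>auto intro!: tendsto_intros\<close>)
  qed
qed

section \<open>Integration against a projection-valued measure\<close>

lemma sum_lessThan_4: "(\<Sum>k<4. f k) = f 0 + f 1 + f 2 + f (3::nat)" for f :: "nat \<Rightarrow> 'a::comm_monoid_add"
  by (simp add: eval_nat_numeral add.assoc)

lemma power_i_3: "\<i> ^ 3 = - \<i>" "(- \<i>) ^ 3 = \<i>"
  by (simp_all add: power3_eq_cube)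

locale pvm =
  fixes E :: "real set \<Rightarrow> (nat \<Rightarrow> complex) \<Rightarrow> (nat \<Rightarrow> complex)"
  assumes pvm: "projection_valued_measure E"
begin

abbreviation S where "S \<equiv> spectral_form E"
abbreviation \<mu> where "\<mu> \<equiv> scalar_spectral_measure E"

lemma E_ell2: "A \<in> sets borel \<Longrightarrow> u \<in> ell2 \<Longrightarrow> E A u \<in> ell2"
  and E_lincomb: "A \<in> sets borel \<Longrightarrow> u \<in> ell2 \<Longrightarrow> v \<in> ell2 \<Longrightarrow>
    E A (\<lambda>n. a * u n + b * v n) = (\<lambda>n. a * E A u n + b * E A v n)"
  and E_sym: "A \<in> sets borel \<Longrightarrow> u \<in> ell2 \<Longrightarrow> v \<in> ell2 \<Longrightarrow> ell2_inner v (E A u) = ell2_inner (E A v) u"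
  and E_empty: "u \<in> ell2 \<Longrightarrow> E {} u = (\<lambda>n. 0)"
  and E_UNIV: "u \<in> ell2 \<Longrightarrow> E UNIV u = u"
  and E_Int: "A \<in> sets borel \<Longrightarrow> B \<in> sets borel \<Longrightarrow> u \<in> ell2 \<Longrightarrow> E (A \<inter> B) u = E A (E B u)"
  and E_UN: "range F \<subseteq> sets borel \<Longrightarrow> disjoint_family F \<Longrightarrow> u \<in> ell2 \<Longrightarrow>
    (\<lambda>N. ell2_norm (\<lambda>n. E (\<Union>i. F i) u n - (\<Sum>i<N. E (F i) u n))) \<longlonglongrightarrow> 0"
  using pvm unfolding projection_valued_measure_def ell2_projection_def by auto

text \<open>A symmetric idempotent is positive. Hence the real part taken in
  \<open>scalar_spectral_measure\<close> loses nothing, and \<open>ennreal\<close> clips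
  nothing.\<close>

lemma inner_E_self:
  assumes "A \<in> sets borel" "u \<in> ell2"
  shows "ell2_inner u (E A u) = of_real (nsq (E A u))"
proof -
  have "ell2_inner u (E A u) = ell2_inner u (E A (E A u))"
    using E_Int[of A A u] assms by simp
  also have "\<dots> = ell2_inner (E A u) (E A u)" using assms by (intro E_sym E_ell2)
  finally show ?thesis using assms by (simp add: inner_self E_ell2)
qed

lemma nsq_E_le:
  assumes "A \<in> sets borel" "u \<in> ell2"
  shows "nsq (E A u) \<le> nsq u"
proof -
  have "nsq (E A u) = cmod (ell2_inner u (E A u))"
    using assms by (simp add: inner_E_self nsq_nonneg E_ell2)
  also have "\<dots> \<le> ell2_norm u * ell2_norm (E A u)"
    using assms by (intro inner_Cauchy_Schwarz E_ell2)
  finally have le: "(ell2_norm (E A u))\<^sup>2 \<le> ell2_norm u * ell2_norm (E A u)"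
    using assms by (simp add: nsq_eq_norm_power2 E_ell2)
  have nn: "0 \<le> ell2_norm (E A u)" "0 \<le> ell2_norm u"
    using assms by (simp_all add: ell2_norm_nonneg E_ell2)
  have "ell2_norm (E A u) \<le> ell2_norm u"
    by (rule le_of_power2_le_mult) (use le nn in auto)
  thus ?thesis using nn assms by (simp add: nsq_eq_norm_power2 E_ell2 power_mono)
qed

section \<open>The scalar spectral measures\<close>

lemma sets_\<mu> [simp]: "sets (\<mu> u) = sets borel" and space_\<mu> [simp]: "space (\<mu> u) = UNIV"
  unfolding scalar_spectral_measure_def
  by (simp_all add: sets_measure_of_conv space_measure_of_conv sets.sigma_sets_eq[of borel, simplified])

text \<open>Pairing the strong convergence of the axiom with \<open>u\<close> and applying
  Cauchy-Schwarz turns it into convergence of numbers.\<close>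

lemma nsq_E_sums:
  assumes B: "range B \<subseteq> sets borel" "disjoint_family B" and u: "u \<in> ell2"
  shows "(\<lambda>i. nsq (E (B i) u)) sums nsq (E (\<Union>i. B i) u)"
proof -
  have Bi: "B i \<in> sets borel" for i using B by auto
  have U: "(\<Union>i. B i) \<in> sets borel" using Bi by auto
  let ?d = "\<lambda>N n. E (\<Union>i. B i) u n - (\<Sum>i<N. E (B i) u n)"
  have sum2: "(\<lambda>n. \<Sum>i<N. E (B i) u n) \<in> ell2" for N by (intro ell2_sum E_ell2 Bi u)
  have d2: "?d N \<in> ell2" for N
    using ell2_lincomb[OF E_ell2[OF U u] sum2[of N], of 1 "-1"] by simp
  have s: "ell2_inner u (\<lambda>n. \<Sum>i<N. E (B i) u n) = (\<Sum>i<N. of_real (nsq (E (B i) u)))" for N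
  proof (induction N)
    case (Suc N)
    have "ell2_inner u (\<lambda>n. \<Sum>i<Suc N. E (B i) u n) = 1 * ell2_inner u (\<lambda>n. \<Sum>i<N. E (B i) u n) + 1 * ell2_inner u (E (B N) u)"
      by (subst inner_lincomb_right[symmetric]) (auto intro: u sum2 E_ell2 Bi)
    thus ?case using Suc by (simp add: inner_E_self Bi u)
  qed (simp add: ell2_inner_def)
  have eq: "ell2_inner u (?d N) = of_real (nsq (E (\<Union>i. B i) u) - (\<Sum>i<N. nsq (E (B i) u)))" for N
    using inner_lincomb_right[OF u E_ell2[OF U u] sum2[of N], of 1 "-1"]
    by (simp add: s inner_E_self U u)
  have bound: "\<bar>nsq (E (\<Union>i. B i) u) - (\<Sum>i<N. nsq (E (B i) u))\<bar> \<le> ell2_norm u * ell2_norm (?d N)" for N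
    using inner_Cauchy_Schwarz[OF u d2[of N]] unfolding eq norm_of_real .
  have "(\<lambda>N. ell2_norm u * ell2_norm (?d N)) \<longlonglongrightarrow> ell2_norm u * 0"
    by (intro tendsto_mult tendsto_const E_UN B u)
  hence lim: "(\<lambda>N. ell2_norm u * ell2_norm (?d N)) \<longlonglongrightarrow> 0" by simp
  have "(\<lambda>N. nsq (E (\<Union>i. B i) u) - (\<Sum>i<N. nsq (E (B i) u))) \<longlonglongrightarrow> 0"
    by (rule Lim_null_comparison[OF _ lim]) (use bound in auto)
  hence "(\<lambda>N. nsq (E (\<Union>i. B i) u) - (nsq (E (\<Union>i. B i) u) - (\<Sum>i<N. nsq (E (B i) u)))) \<longlonglongrightarrow> nsq (E (\<Union>i. B i) u) - 0"
    by (intro tendsto_diff tendsto_const)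
  thus ?thesis by (simp add: sums_def)
qed

text \<open>\<open>measure_of\<close> falls back to the null measure unless the set function is a
  measure; countable additivity comes from \<open>nsq_E_sums\<close>.\<close>

lemma emeasure_\<mu>:
  assumes "A \<in> sets borel" "u \<in> ell2"
  shows "emeasure (\<mu> u) A = ennreal (nsq (E A u))"
proof -
  have "emeasure (\<mu> u) A = ennreal (Re (ell2_inner u (E A u)))"
    unfolding scalar_spectral_measure_def
  proof (rule emeasure_measure_of_sigma)
    show "sigma_algebra UNIV (sets (borel :: real measure))"
      using sets.sigma_algebra_axioms[of "borel :: real measure"] by simp
    show "positive (sets borel) (\<lambda>B. ennreal (Re (ell2_inner u (E B u))))"
      using assms by (simp add: positive_def E_empty ell2_inner_def)
    show "countably_additive (sets borel) (\<lambda>B. ennreal (Re (ell2_inner u (E B u))))"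
      unfolding countably_additive_def
    proof (intro allI impI)
      fix B :: "nat \<Rightarrow> real set"
      assume B: "range B \<subseteq> sets borel" "disjoint_family B" "(\<Union>i. B i) \<in> sets borel"
      from nsq_E_sums[OF B(1,2) assms(2)]
      have "(\<Sum>i. ennreal (nsq (E (B i) u))) = ennreal (nsq (E (\<Union>i. B i) u))"
        by (intro sums_unique[symmetric] iffD2[OF sums_ennreal])
           (use B assms in \<open>auto intro!: nsq_nonneg E_ell2\<close>)
      moreover have "B i \<in> sets borel" for i using B by auto
      ultimately show "(\<Sum>i. ennreal (Re (ell2_inner u (E (B i) u)))) =
          ennreal (Re (ell2_inner u (E (\<Union>i. B i) u)))"
        using B(3) assms(2) by (simp add: inner_E_self)
    qed
  qed fact
  thus ?thesis using assms by (simp add: inner_E_self)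
qed

lemma finite_measure_\<mu>: "u \<in> ell2 \<Longrightarrow> finite_measure (\<mu> u)"
  by (rule finite_measureI) (simp add: emeasure_\<mu>)

lemma measure_\<mu>: "A \<in> sets borel \<Longrightarrow> u \<in> ell2 \<Longrightarrow> measure (\<mu> u) A = nsq (E A u)"
  by (simp add: measure_def emeasure_\<mu> nsq_nonneg E_ell2)

lemma measure_\<mu>_UNIV: "u \<in> ell2 \<Longrightarrow> measure (\<mu> u) UNIV = nsq u"
  by (simp add: measure_\<mu> E_UNIV)

lemma integrable_bounded_\<mu>:
  assumes "u \<in> ell2" "f \<in> dominated (\<lambda>x. 1)"
  shows "integrable (\<mu> u) f"
proof -
  interpret finite_measure "\<mu> u" by (rule finite_measure_\<mu>[OF assms(1)])
  show ?thesis by (rule dominated_integrable[of _ "\<lambda>x. 1"]) (use assms in auto)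
qed

section \<open>The form \<open>S\<close> on bounded functions\<close>

lemma polarize_add: "u \<in> ell2 \<Longrightarrow> v \<in> ell2 \<Longrightarrow> (\<lambda>n. v n + \<i> ^ k * u n) \<in> ell2"
  using ell2_lincomb[of v u 1 "\<i> ^ k"] by simp

lemma dct_S_general:
  assumes "\<And>k. k < 4 \<Longrightarrow> integrable (\<mu> (\<lambda>n. v n + \<i> ^ k * u n)) h"
  shows "dct_functional h (\<lambda>f. S f v u)"
proof -
  have "dct_functional h (\<lambda>f. \<Sum>k<4. ((- \<i>) ^ k / 4) * (LINT x|\<mu> (\<lambda>n. v n + \<i> ^ k * u n). f x))"
    by (intro dct_functional_sum dct_integral assms) auto
  thus ?thesis by (simp add: spectral_form_def sum_divide_distrib)
qed

lemma dct_S: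
  assumes "u \<in> ell2" "v \<in> ell2"
  shows "dct_functional (\<lambda>x. 1) (\<lambda>f. S f v u)"
proof (rule dct_S_general)
  fix k
  interpret finite_measure "\<mu> (\<lambda>n. v n + \<i> ^ k * u n)"
    by (rule finite_measure_\<mu>[OF polarize_add[OF assms]])
  show "integrable (\<mu> (\<lambda>n. v n + \<i> ^ k * u n)) (\<lambda>x. 1)" by simp
qed

text \<open>Expanding the four quadratic terms, the weights (-i)^k i^k add up to 4, while the
  weights of the two diagonal terms and of the reversed cross term add up to 0.\<close>

lemma S_indicator:
  assumes A: "A \<in> sets borel" and u: "u \<in> ell2" "v \<in> ell2"
  shows "S (indicator A) v u = ell2_inner v (E A u)"
proof -
  let ?w = "\<lambda>k n. v n + \<i> ^ k * u n"
  have Ev: "E A v \<in> ell2" and Eu: "E A u \<in> ell2" using A u by (auto intro: E_ell2)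
  have int: "(LINT x|\<mu> (?w k). indicator A x :: complex) = ell2_inner (E A (?w k)) (E A (?w k))" for k
  proof -
    have w: "?w k \<in> ell2" by (rule polarize_add[OF u])
    interpret finite_measure "\<mu> (?w k)" by (rule finite_measure_\<mu>[OF w])
    have "(LINT x|\<mu> (?w k). indicator A x :: complex) = of_real (LINT x|\<mu> (?w k). indicator A x)"
      by (subst integral_complex_of_real[symmetric]) (simp add: of_real_indicator)
    also have "\<dots> = of_real (nsq (E A (?w k)))" using A w by (simp add: measure_\<mu>)
    finally show ?thesis using A w by (simp add: inner_self E_ell2)
  qed
  have exp: "ell2_inner (E A (?w k)) (E A (?w k)) =
      ell2_inner (E A v) (E A v) + \<i> ^ k * ell2_inner (E A v) (E A u)
      + cnj (\<i> ^ k) * ell2_inner (E A u) (E A v) + \<i> ^ k * cnj (\<i> ^ k) * ell2_inner (E A u) (E A u)" for k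
  proof -
    have "E A (?w k) = (\<lambda>n. 1 * E A v n + \<i> ^ k * E A u n)"
      using E_lincomb[OF A u(2,1), of 1 "\<i> ^ k"] by simp
    thus ?thesis
      by (simp add: inner_lincomb_right[OF _ Ev Eu, of _ 1, simplified]
          inner_lincomb_left[OF _ Ev Eu, of _ 1, simplified] Ev Eu ell2_add ell2_scale algebra_simps)
  qed
  have "S (indicator A) v u = ell2_inner (E A v) (E A u)"
    unfolding spectral_form_def int exp sum_lessThan_4
    by (simp add: power_i_3 algebra_simps)
  also have "\<dots> = ell2_inner v (E A u)"
    using E_Int[of A A u] E_sym[of A "E A u" v] A u Eu by simp
  finally show ?thesis .
qed

text \<open>The four measures depend quadratically on the vectors, so linearity is checked on
  indicators, where \<open>E_lincomb\<close> gives it, and spread by \<open>dct_eqI\<close>.\<close>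

lemma S_lincomb_right:
  assumes "u \<in> ell2" "v \<in> ell2" "w \<in> ell2" "f \<in> dominated (\<lambda>x. 1)"
  shows "S f w (\<lambda>n. a * u n + b * v n) = a * S f w u + b * S f w v"
  by (rule dct_eqI[OF dct_S dct_functional_lincomb[OF dct_S dct_S] _ _ assms(4)])
     (use assms in \<open>auto simp: S_indicator ell2_lincomb E_lincomb inner_lincomb_right E_ell2\<close>)

lemma S_cnj:
  assumes "u \<in> ell2" "v \<in> ell2" "f \<in> dominated (\<lambda>x. 1)"
  shows "S f v u = cnj (S (\<lambda>x. cnj (f x)) u v)"
proof (rule dct_eqI[OF dct_S dct_functional_cnj[OF dct_S] _ _ assms(3)])
  fix A :: "real set" assume A: "A \<in> sets borel"
  have "(\<lambda>x. cnj (indicator A x)) = (indicator A :: real \<Rightarrow> complex)"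
    by (auto simp: indicator_def)
  thus "S (indicator A) v u = cnj (S (\<lambda>x. cnj (indicator A x)) u v)"
    using A assms by (simp add: S_indicator inner_cnj E_ell2 E_sym)
qed (use assms in auto)

lemma S_lincomb_left:
  assumes "u \<in> ell2" "v \<in> ell2" "w \<in> ell2" "f \<in> dominated (\<lambda>x. 1)"
  shows "S f (\<lambda>n. a * u n + b * v n) w = cnj a * S f u w + cnj b * S f v w"
proof -
  have "S f (\<lambda>n. a * u n + b * v n) w = cnj (S (\<lambda>x. cnj (f x)) w (\<lambda>n. a * u n + b * v n))"
    using assms by (intro S_cnj ell2_lincomb)
  also have "\<dots> = cnj a * cnj (S (\<lambda>x. cnj (f x)) w u) + cnj b * cnj (S (\<lambda>x. cnj (f x)) w v)"
    using assms by (simp add: S_lincomb_right dominated_cnj)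
  also have "\<dots> = cnj a * S f u w + cnj b * S f v w"
    using assms by (simp add: S_cnj[of w u f] S_cnj[of w v f])
  finally show ?thesis .
qed

text \<open>Each measure has mass nsq (v + i^k u), at most 2 nsq v + 2 nsq u, and the division by 4
  compensates the four terms. The constant is not sharp; only its uniformity matters.\<close>

lemma S_bound:
  assumes "u \<in> ell2" "v \<in> ell2" "f \<in> borel_measurable borel" "\<And>x. cmod (f x) \<le> M"
  shows "cmod (S f v u) \<le> M * (2 * nsq v + 2 * nsq u)"
proof -
  let ?w = "\<lambda>k n. v n + \<i> ^ k * u n"
  have f: "f \<in> dominated (\<lambda>x. 1)" by (rule dominated_bounded) (use assms in auto)
  have M: "0 \<le> M" using assms(4)[of 0] norm_ge_zero order_trans by blast
  have "cmod (LINT x|\<mu> (?w k). f x) \<le> M * (2 * nsq v + 2 * nsq u)" for k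
  proof -
    have w: "?w k \<in> ell2" by (rule polarize_add) fact+
    interpret finite_measure "\<mu> (?w k)" by (rule finite_measure_\<mu>[OF w])
    have "cmod (LINT x|\<mu> (?w k). f x) \<le> (LINT x|\<mu> (?w k). cmod (f x))"
      by (rule integral_norm_bound)
    also have "\<dots> \<le> (LINT x|\<mu> (?w k). M)"
      by (intro integral_mono integrable_norm integrable_bounded_\<mu> w f) (use assms in auto)
    also have "\<dots> = M * nsq (?w k)" by (simp add: measure_\<mu>_UNIV w)
    also have "nsq (?w k) \<le> 2 * nsq v + 2 * nsq (\<lambda>n. \<i> ^ k * u n)"
      by (intro ell2_add assms ell2_scale)
    also have "nsq (\<lambda>n. \<i> ^ k * u n) = nsq u"
      using assms by (simp add: nsq_scale norm_power)
    finally show ?thesis using M by (simp add: mult_left_mono)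
  qed
  hence "cmod (\<Sum>k<4. (- \<i>) ^ k * (LINT x|\<mu> (?w k). f x)) \<le> (\<Sum>k<(4::nat). M * (2 * nsq v + 2 * nsq u))"
    by (intro sum_norm_le) (simp add: norm_mult norm_power)
  thus ?thesis unfolding spectral_form_def by (simp add: norm_divide)
qed

text \<open>Scaling both vectors to norm 1 turns the additive bound of \<open>S_bound\<close> into a
  product; 4 is the value 2 + 2 on unit vectors. Null vectors cannot be scaled and are treated
  separately.\<close>

lemma S_Cauchy_Schwarz:
  assumes "u \<in> ell2" "v \<in> ell2" "f \<in> borel_measurable borel" "\<And>x. cmod (f x) \<le> M"
  shows "cmod (S f v u) \<le> 4 * M * ell2_norm v * ell2_norm u"
proof -
  have f: "f \<in> dominated (\<lambda>x. 1)" by (rule dominated_bounded) (use assms in auto)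
  have S0: "S f (\<lambda>n. 0) u = 0" using S_lincomb_left[OF assms(1,1,1) f, of 0 0] by simp
  have S0': "S f v (\<lambda>n. 0) = 0" using S_lincomb_right[OF assms(2,2,2) f, of 0 0] by simp
  consider "ell2_norm v = 0" | "ell2_norm u = 0" | "ell2_norm v > 0" "ell2_norm u > 0"
    using ell2_norm_nonneg[OF assms(1)] ell2_norm_nonneg[OF assms(2)] by fastforce
  thus ?thesis
  proof cases
    case 1
    hence "v = (\<lambda>n. 0)" using assms by (intro nsq_eq_0D) (auto simp: nsq_eq_norm_power2)
    with 1 S0 show ?thesis by simp
  next
    case 2
    hence "u = (\<lambda>n. 0)" using assms by (intro nsq_eq_0D) (auto simp: nsq_eq_norm_power2)
    with 2 S0' show ?thesis by simp
  next
    case 3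
    define a b where "a = ell2_norm v" and "b = ell2_norm u"
    have ab: "a > 0" "b > 0" using 3 by (auto simp: a_def b_def)
    let ?v = "\<lambda>n. of_real (1/a) * v n" and ?u = "\<lambda>n. of_real (1/b) * u n"
    have v: "?v \<in> ell2" "nsq ?v = 1" and u: "?u \<in> ell2" "nsq ?u = 1"
      using assms ab
      by (auto simp only: ell2_scale nsq_scale) (auto simp: nsq_eq_norm_power2 a_def b_def norm_divide power_divide)
    have "S f ?v ?u = of_real (1/a) * S f v ?u"
      using S_lincomb_left[OF assms(2) ell2_zero u(1) f, of "of_real (1/a)" 0] by simp
    also have "S f v ?u = of_real (1/b) * S f v u"
      using S_lincomb_right[OF assms(1) ell2_zero assms(2) f, of "of_real (1/b)" 0] by simp
    finally have "S f v u = of_real (a * b) * S f ?v ?u" using ab by (simp add: field_simps)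
    hence "cmod (S f v u) = a * b * cmod (S f ?v ?u)" using ab by (simp add: norm_mult)
    also have "\<dots> \<le> a * b * (M * 4)"
      using S_bound[OF u(1) v(1) assms(3,4)] u v ab by (intro mult_left_mono) auto
    finally show ?thesis by (simp add: a_def b_def mult_ac)
  qed
qed

text \<open>The vector f(T) u for the operator T behind \<open>E\<close>, given by its coordinates
  in the same way as in \<open>functional_calculus\<close>. That it lies in \<open>ell2\<close> has
  to be proved.\<close>

definition \<Phi> :: "(real \<Rightarrow> complex) \<Rightarrow> (nat \<Rightarrow> complex) \<Rightarrow> nat \<Rightarrow> complex" where
  "\<Phi> f u n = S f (delta n) u"

lemma S_trunc:
  assumes "u \<in> ell2" "f \<in> dominated (\<lambda>x. 1)"
  shows "S f (trunc N v) u = (\<Sum>n<N. cnj (v n) * \<Phi> f u n)"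
proof (induction N)
  case 0
  show ?case using S_lincomb_left[OF assms(1,1,1,2), of 0 0] by (simp add: trunc_def)
next
  case (Suc N)
  have "trunc (Suc N) v = (\<lambda>n. 1 * trunc N v n + v N * delta N n)"
    by (rule ext) (auto simp: trunc_def delta_def less_Suc_eq)
  thus ?case
    using S_lincomb_left[OF trunc_ell2 delta_ell2 assms, of 1 N v "v N" N] Suc by (simp add: \<Phi>_def)
qed

text \<open>Testing the form against the truncated vector w itself gives |w|^2 = S f w u, which is
  at most 4 M |w| |u|; one factor |w| cancels, and the resulting bound does not depend on the
  truncation.\<close>

lemma \<Phi>_ell2:
  assumes u: "u \<in> ell2" and f: "f \<in> dominated (\<lambda>x. 1)"
  shows "\<Phi> f u \<in> ell2"
proof -
  obtain M where M: "\<And>x. cmod (f x) \<le> M" and fm: "f \<in> borel_measurable borel"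
    using f by (auto simp: dominated_def)
  show ?thesis
  proof (rule ell2I_bounded)
    fix N
    let ?w = "trunc N (\<Phi> f u)" and ?s = "\<Sum>n<N. (cmod (\<Phi> f u n))\<^sup>2"
    have "S f ?w u = of_real ?s"
      unfolding S_trunc[OF u f] of_real_sum
      by (intro sum.cong) (auto simp: complex_norm_square mult.commute simp flip: of_real_power)
    moreover have "?s \<ge> 0" by (intro sum_nonneg) auto
    ultimately have "?s \<le> 4 * M * ell2_norm ?w * ell2_norm u"
      using S_Cauchy_Schwarz[OF u trunc_ell2 fm M, of N "\<Phi> f u"] by (metis abs_of_nonneg norm_of_real)
    moreover have s: "?s = (ell2_norm ?w)\<^sup>2" by (metis nsq_trunc nsq_eq_norm_power2 trunc_ell2)
    ultimately have le: "(ell2_norm ?w)\<^sup>2 \<le> 4 * M * ell2_norm u * ell2_norm ?w" by (simp add: mult_ac)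
    have M0: "0 \<le> M" using M[of 0] norm_ge_zero order_trans by blast
    have nn: "0 \<le> ell2_norm ?w" "0 \<le> 4 * M * ell2_norm u"
      using M0 u by (auto simp: ell2_norm_nonneg trunc_ell2)
    have "ell2_norm ?w \<le> 4 * M * ell2_norm u"
      by (rule le_of_power2_le_mult) (use le nn in auto)
    thus "?s \<le> (4 * M * ell2_norm u)\<^sup>2" unfolding s by (intro power_mono nn)
  qed
qed

text \<open>For finitely supported left vectors this is \<open>S_trunc\<close>; both sides are
  continuous in the left vector, the right one by \<open>S_Cauchy_Schwarz\<close>.\<close>

lemma inner_\<Phi>:
  assumes u: "u \<in> ell2" and v: "v \<in> ell2" and f: "f \<in> dominated (\<lambda>x. 1)"
  shows "ell2_inner v (\<Phi> f u) = S f v u"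
proof -
  obtain M where M: "\<And>x. cmod (f x) \<le> M" and fm: "f \<in> borel_measurable borel"
    using f by (auto simp: dominated_def)
  let ?d = "\<lambda>N n. v n - trunc N v n"
  have d2: "?d N \<in> ell2" for N by (intro ell2_diff v trunc_ell2)
  have eq: "S f v u - S f (trunc N v) u = S f (?d N) u" for N
    using S_lincomb_left[OF v trunc_ell2 u f, of 1 "-1" N v] by simp
  have "(\<lambda>N. 4 * M * ell2_norm (?d N) * ell2_norm u) \<longlonglongrightarrow> 4 * M * 0 * ell2_norm u"
    by (intro tendsto_intros ell2_norm_tendsto_zeroI trunc_tendsto v)
  hence lim: "(\<lambda>N. 4 * M * ell2_norm (?d N) * ell2_norm u) \<longlonglongrightarrow> 0" by simp
  have "(\<lambda>N. S f v u - S f (trunc N v) u) \<longlonglongrightarrow> 0"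
    unfolding eq
    by (rule Lim_null_comparison[OF _ lim]) (use S_Cauchy_Schwarz[OF u d2 fm M] in auto)
  hence "(\<lambda>N. S f v u - (S f v u - S f (trunc N v) u)) \<longlonglongrightarrow> S f v u - 0"
    by (intro tendsto_diff tendsto_const)
  moreover have "(\<lambda>N. S f (trunc N v) u) \<longlonglongrightarrow> ell2_inner v (\<Phi> f u)"
    using inner_sums[OF v \<Phi>_ell2[OF u f]] by (simp add: S_trunc[OF u f] sums_def)
  ultimately show ?thesis using LIMSEQ_unique by force
qed

lemma \<Phi>_indicator: "A \<in> sets borel \<Longrightarrow> u \<in> ell2 \<Longrightarrow> \<Phi> (indicator A) u = E A u"
  by (auto simp: \<Phi>_def S_indicator delta_ell2 inner_delta_left)

lemma dominated_mult:
  assumes "f \<in> dominated (\<lambda>x. 1)" "g \<in> dominated h" "\<And>x. 0 \<le> h x"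
  shows "(\<lambda>x. f x * g x) \<in> dominated h"
proof -
  obtain C D where C: "\<And>x. cmod (f x) \<le> C" and D: "\<And>x. cmod (g x) \<le> D * h x"
    using assms by (auto simp: dominated_def)
  show ?thesis
  proof (rule dominatedI[of _ "C * D"])
    show "(\<lambda>x. f x * g x) \<in> borel_measurable borel" using assms by (auto simp: dominated_def)
    fix x
    have "0 \<le> C" using C[of 0] norm_ge_zero order_trans by blast
    thus "cmod (f x * g x) \<le> C * D * h x"
      unfolding norm_mult mult.assoc by (intro mult_mono C D) auto
  qed
qed

text \<open>On an indicator of B both sides are the pairing of v with the projection of u for A
  intersected with B. The weight is left open because both 1 and 1 + |x| are needed later.\<close>

lemma S_E_left:
  assumes A: "A \<in> sets borel" and h: "\<And>x. 1 \<le> h x"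
    and dct: "dct_functional h (\<lambda>f. S f v u)" "dct_functional h (\<lambda>f. S f (E A v) u)"
    and uv: "u \<in> ell2" "v \<in> ell2" and f: "f \<in> dominated h"
  shows "S f (E A v) u = S (\<lambda>x. indicator A x * f x) v u"
proof (rule dct_eqI[OF dct(2) dct_functional_mult[OF dct(1), where D=1] h _ f])
  fix B :: "real set" assume B: "B \<in> sets borel"
  have "(\<lambda>x. indicator A x * indicator B x :: complex) = indicator (A \<inter> B)"
    by (auto simp: indicator_def)
  thus "S (indicator B) (E A v) u = S (\<lambda>x. indicator A x * indicator B x) v u"
    using A B uv by (simp add: S_indicator E_ell2 E_Int E_sym[symmetric])
qed (use A order.trans[OF zero_le_one h] in \<open>auto simp: indicator_def\<close>)

text \<open>Multiplicativity of the calculus in weak form. For \<open>f\<close> an indicator, the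
  projection moves to the left vector, \<open>inner_\<Phi>\<close> introduces \<open>g\<close>, and
  \<open>S_E_left\<close> brings the indicator back into the integrand.\<close>

lemma S_mult:
  assumes f: "f \<in> dominated (\<lambda>x. 1)" and g: "g \<in> dominated (\<lambda>x. 1)"
    and uv: "u \<in> ell2" "v \<in> ell2"
  shows "S f v (\<Phi> g u) = S (\<lambda>x. g x * f x) v u"
proof -
  obtain M where M: "\<And>x. cmod (g x) \<le> M" and gm: "g \<in> borel_measurable borel"
    using g by (auto simp: dominated_def)
  have \<Phi>g: "\<Phi> g u \<in> ell2" using uv g by (intro \<Phi>_ell2)
  show ?thesis
  proof (rule dct_eqI[OF dct_S[OF \<Phi>g uv(2)] dct_functional_mult[OF dct_S[OF uv] gm, where D=M] _ _ f])
    fix A :: "real set" assume A: "A \<in> sets borel"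
    have "S (indicator A) v (\<Phi> g u) = ell2_inner (E A v) (\<Phi> g u)"
      using A uv \<Phi>g by (simp add: S_indicator E_sym)
    also have "\<dots> = S g (E A v) u" using A uv g by (intro inner_\<Phi> E_ell2)
    also have "\<dots> = S (\<lambda>x. indicator A x * g x) v u"
      using A uv g by (intro S_E_left[where h="\<lambda>x. 1"] dct_S E_ell2) auto
    finally show "S (indicator A) v (\<Phi> g u) = S (\<lambda>x. g x * indicator A x) v u"
      by (simp add: mult.commute)
  qed (use M in auto)
qed

lemma S_self:
  assumes "u \<in> ell2" "f \<in> dominated (\<lambda>x. 1)"
  shows "S f u u = (LINT x|\<mu> u. f x)"
proof -
  interpret finite_measure "\<mu> u" by (rule finite_measure_\<mu>[OF assms(1)])
  show ?thesis
  proof (rule dct_eqI[OF dct_S[OF assms(1,1)] dct_integral _ _ assms(2)])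
    fix A :: "real set" assume A: "A \<in> sets borel"
    have "(LINT x|\<mu> u. indicator A x :: complex) = of_real (LINT x|\<mu> u. indicator A x)"
      by (subst integral_complex_of_real[symmetric]) (simp add: of_real_indicator)
    thus "S (indicator A) u u = (LINT x|\<mu> u. indicator A x)"
      using A assms by (simp add: S_indicator inner_E_self measure_\<mu>)
  qed auto
qed

text \<open>The square of |f| is f times its conjugate, so \<open>S_cnj\<close> and
  \<open>S_mult\<close> reduce the norm to a diagonal form. It yields the norm bound for the
  evolution and, later, the truncated second moments.\<close>

lemma nsq_\<Phi>:
  assumes u: "u \<in> ell2" and f: "f \<in> dominated (\<lambda>x. 1)"
  shows "nsq (\<Phi> f u) = (LINT x|\<mu> u. (cmod (f x))\<^sup>2)"
proof -
  have \<Phi>u: "\<Phi> f u \<in> ell2" by (rule \<Phi>_ell2[OF u f])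
  have "complex_of_real (nsq (\<Phi> f u)) = ell2_inner (\<Phi> f u) (\<Phi> f u)" by (simp add: inner_self \<Phi>u)
  also have "\<dots> = S f (\<Phi> f u) u" by (rule inner_\<Phi>[OF u \<Phi>u f])
  also have "\<dots> = cnj (S (\<lambda>x. cnj (f x)) u (\<Phi> f u))" by (rule S_cnj[OF u \<Phi>u f])
  also have "\<dots> = cnj (S (\<lambda>x. f x * cnj (f x)) u u)"
    by (subst S_mult[OF dominated_cnj[OF f] f u u]) simp
  also have "(\<lambda>x. f x * cnj (f x)) = (\<lambda>x. complex_of_real ((cmod (f x))\<^sup>2))"
    by (simp add: complex_norm_square del: of_real_power)
  also have "S \<dots> u u = (LINT x|\<mu> u. complex_of_real ((cmod (f x))\<^sup>2))"
    using dominated_mult[OF f dominated_cnj[OF f]] by (intro S_self u) (simp add: complex_norm_square del: of_real_power)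
  also have "\<dots> = complex_of_real (LINT x|\<mu> u. (cmod (f x))\<^sup>2)" by (rule integral_complex_of_real)
  finally show ?thesis by (simp del: of_real_power)
qed

end

section \<open>The Jacobi operator on its maximal domain\<close>

definition jac_a :: "real \<Rightarrow> nat \<Rightarrow> real" where
  "jac_a \<alpha> n = sqrt (real n * (real n + \<alpha>))"

definition jac_b :: "real \<Rightarrow> nat \<Rightarrow> real" where
  "jac_b \<alpha> n = 2 * real n + 1 + \<alpha>"

lemma jac_a_0 [simp]: "jac_a \<alpha> 0 = 0"
  by (simp add: jac_a_def)

text \<open>For \<open>n = 0\<close> the natural subtraction produces the value \<open>u 0\<close>
  instead of u_(-1) = 0; the factor \<open>jac_a \<alpha> 0 = 0\<close> removes it, so no case
  distinction is needed.\<close>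

lemma laguerre_op_eq:
  "laguerre_op \<alpha> u n = of_real (jac_a \<alpha> n) * u (n - 1) + of_real (jac_b \<alpha> n) * u n
     + of_real (jac_a \<alpha> (Suc n)) * u (Suc n)"
  by (simp add: laguerre_op_def jac_a_def jac_b_def algebra_simps)

lemma jac_a_pos: "0 \<le> \<alpha> \<Longrightarrow> 0 < jac_a \<alpha> (Suc n)"
  by (simp add: jac_a_def add_pos_nonneg)

lemma jac_a_le:
  assumes "0 \<le> \<alpha>" shows "jac_a \<alpha> (Suc n) \<le> (1 + \<alpha>) * real (Suc n)"
proof -
  have "jac_a \<alpha> (Suc n) \<le> sqrt ((real (Suc n) + \<alpha>)\<^sup>2)"
    unfolding jac_a_def power2_eq_square using assms by (intro real_sqrt_le_mono mult_right_mono) auto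
  also have "\<dots> = real (Suc n) + \<alpha>" using assms by simp
  also have "\<dots> \<le> (1 + \<alpha>) * real (Suc n)" using assms by (simp add: algebra_simps)
  finally show ?thesis .
qed

text \<open>Linear growth of the off-diagonal entries bounds the series below by a multiple of the
  harmonic series. This is Carleman's condition.\<close>

lemma not_summable_inverse_jac_a:
  assumes "0 \<le> \<alpha>" shows "\<not> summable (\<lambda>n. 1 / jac_a \<alpha> (Suc n))"
proof
  assume s: "summable (\<lambda>n. 1 / jac_a \<alpha> (Suc n))"
  have "summable (\<lambda>n. 1 / ((1 + \<alpha>) * real (Suc n)))"
  proof (rule summable_comparison_test'[OF s])
    fix n :: nat
    show "norm (1 / ((1 + \<alpha>) * real (Suc n))) \<le> 1 / jac_a \<alpha> (Suc n)"
      using jac_a_le[OF assms, of n] jac_a_pos[OF assms, of n] assms by (auto intro!: divide_left_mono simp: mult_pos_pos)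
  qed
  from summable_mult[OF this, of "1 + \<alpha>"] have "summable (\<lambda>n. inverse (real (Suc n)))"
    using assms by (simp add: divide_inverse)
  thus False using not_summable_harmonic[where 'a=real] summable_Suc_iff[of "\<lambda>n. inverse (real n)"] by simp
qed

text \<open>The matrix is real and symmetric, so all interior terms cancel in pairs and only the
  coupling between \<open>N\<close> and \<open>Suc N\<close> is left.\<close>

lemma laguerre_green:
  "(\<Sum>n<Suc N. cnj (laguerre_op \<alpha> w n) * u n - cnj (w n) * laguerre_op \<alpha> u n)
    = of_real (jac_a \<alpha> (Suc N)) * (cnj (w (Suc N)) * u N - cnj (w N) * u (Suc N))"
  by (induction N) (simp_all add: laguerre_op_eq algebra_simps)

text \<open>Carleman's argument: the boundary term in Green's formula converges, and a nonzero limit would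
  bound \<open>1 / a\<^sub>n\<close> by a summable sequence.\<close>

lemma laguerre_op_symmetric:
  assumes \<alpha>: "0 \<le> \<alpha>" and u: "u \<in> laguerre_dom \<alpha>" and w: "w \<in> laguerre_dom \<alpha>"
  shows "ell2_inner (laguerre_op \<alpha> w) u = ell2_inner w (laguerre_op \<alpha> u)"
proof (rule ccontr)
  have u2: "u \<in> ell2" "laguerre_op \<alpha> u \<in> ell2" and w2: "w \<in> ell2" "laguerre_op \<alpha> w \<in> ell2"
    using u w by (auto simp: laguerre_dom_def)
  let ?L = "ell2_inner (laguerre_op \<alpha> w) u - ell2_inner w (laguerre_op \<alpha> u)"
  assume "\<not> ?thesis"
  hence L: "cmod ?L > 0" by simp
  let ?G = "\<lambda>N. of_real (jac_a \<alpha> (Suc N)) * (cnj (w (Suc N)) * u N - cnj (w N) * u (Suc N))"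
  let ?x = "\<lambda>N. cmod (w (Suc N)) * cmod (u N) + cmod (w N) * cmod (u (Suc N))"
  have "(\<lambda>n. cnj (laguerre_op \<alpha> w n) * u n - cnj (w n) * laguerre_op \<alpha> u n) sums ?L"
    by (intro sums_diff inner_sums u2 w2)
  hence "?G \<longlonglongrightarrow> ?L"
    unfolding sums_def_le lessThan_Suc_atMost[symmetric] laguerre_green .
  hence "(\<lambda>N. cmod (?G N)) \<longlonglongrightarrow> cmod ?L" by (rule tendsto_norm)
  hence "eventually (\<lambda>N. cmod (?G N) > cmod ?L / 2) sequentially"
    by (rule order_tendstoD) (use L in simp)
  hence ev: "eventually (\<lambda>N. norm (1 / jac_a \<alpha> (Suc N)) \<le> 2 / cmod ?L * ?x N) sequentially"
  proof eventually_elim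
    case (elim N)
    have a: "jac_a \<alpha> (Suc N) > 0" by (rule jac_a_pos[OF \<alpha>])
    have "cmod (?G N) \<le> jac_a \<alpha> (Suc N) * ?x N"
      unfolding norm_mult using a
      by (intro mult_mono order.trans[OF norm_triangle_ineq4]) (auto simp: norm_mult)
    with elim have "cmod ?L / 2 \<le> jac_a \<alpha> (Suc N) * ?x N" by linarith
    thus ?case using a L by (simp add: field_simps)
  qed
  have "(\<lambda>n. u (Suc n)) \<in> ell2" "(\<lambda>n. w (Suc n)) \<in> ell2"
    using u2 w2 by (simp_all add: ell2_def summable_Suc_iff[of "\<lambda>n. (cmod (u n))\<^sup>2"] summable_Suc_iff[of "\<lambda>n. (cmod (w n))\<^sup>2"])
  hence "summable ?x"
    by (intro summable_add summable_ell2_product u2 w2)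
  hence "summable (\<lambda>N. 2 / cmod ?L * ?x N)" by (rule summable_mult)
  from summable_comparison_test_ev[OF ev this] show False
    using not_summable_inverse_jac_a[OF \<alpha>] by simp
qed

lemma laguerre_op_lincomb:
  "laguerre_op \<alpha> (\<lambda>n. a * u n + b * v n) = (\<lambda>n. a * laguerre_op \<alpha> u n + b * laguerre_op \<alpha> v n)"
  by (auto simp: laguerre_op_eq algebra_simps)

lemma laguerre_dom_lincomb:
  "u \<in> laguerre_dom \<alpha> \<Longrightarrow> v \<in> laguerre_dom \<alpha> \<Longrightarrow> (\<lambda>n. a * u n + b * v n) \<in> laguerre_dom \<alpha>"
  by (auto simp: laguerre_dom_def laguerre_op_lincomb ell2_lincomb)

lemma laguerre_op_delta:
  "laguerre_op \<alpha> (delta k) = (\<lambda>n. of_real (jac_a \<alpha> k) * delta (k - 1) n + of_real (jac_b \<alpha> k) * delta k n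
     + of_real (jac_a \<alpha> (Suc k)) * delta (Suc k) n)"
proof
  fix n show "laguerre_op \<alpha> (delta k) n = of_real (jac_a \<alpha> k) * delta (k - 1) n + of_real (jac_b \<alpha> k) * delta k n
     + of_real (jac_a \<alpha> (Suc k)) * delta (Suc k) n"
    by (cases k; cases n) (auto simp: laguerre_op_eq delta_def)
qed

lemma delta_dom: "delta k \<in> laguerre_dom \<alpha>"
  unfolding laguerre_dom_def by (auto simp: laguerre_op_delta intro!: delta_ell2 ell2_add ell2_scale)

section \<open>Uniqueness of bounded solutions of the evolution equation\<close>

text \<open>The truncated energies \<open>s\<^sub>N\<close> change only through the boundary term, so the weighted sums
  \<open>Q\<^sub>K = \<Sum>\<^sub>N\<^sub><\<^sub>K s\<^sub>N / a\<^sub>N\<^sub>+\<^sub>1\<close> have derivatives bounded independently of \<open>K\<close>, while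
  \<open>\<Sum> 1 / a\<^sub>n\<close> diverges.\<close>

lemma jacobi_evolution_unique:
  fixes w :: "nat \<Rightarrow> real \<Rightarrow> complex"
  assumes \<alpha>: "0 \<le> \<alpha>"
    and ode: "\<And>k t. (w k has_vector_derivative - \<i> * laguerre_op \<alpha> (\<lambda>k. w k t) k) (at t)"
    and w0: "\<And>k. w k 0 = 0" and bound: "\<And>N t. (\<Sum>k<N. (cmod (w k t))\<^sup>2) \<le> C"
  shows "w k t = 0"
proof -
  let ?a = "\<lambda>n. jac_a \<alpha> (Suc n)"
  have apos: "?a n > 0" for n by (rule jac_a_pos[OF \<alpha>])
  define s where "s N t = (\<Sum>k<Suc N. (cmod (w k t))\<^sup>2)" for N t
  define s' where "s' N t = 2 * ?a N * Im (cnj (w N t) * w (Suc N) t)" for N t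
  have ds: "(s N has_real_derivative s' N t) (at t)" for N t
  proof -
    have d1: "((\<lambda>t. (cmod (w k t))\<^sup>2) has_real_derivative 2 * Im (cnj (w k t) * laguerre_op \<alpha> (\<lambda>k. w k t) k)) (at t)" for k
    proof -
      define D where "D = - \<i> * laguerre_op \<alpha> (\<lambda>k. w k t) k"
      have "((\<lambda>t. w k t \<bullet> w k t) has_derivative (\<lambda>h. w k t \<bullet> (h *\<^sub>R D) + (h *\<^sub>R D) \<bullet> w k t)) (at t)"
        using ode[of k t] unfolding has_vector_derivative_def D_def[symmetric]
        by (intro has_derivative_inner)
      hence "((\<lambda>t. (cmod (w k t))\<^sup>2) has_derivative (\<lambda>h. (2 * (w k t \<bullet> D)) * h)) (at t)"
        by (simp add: power2_norm_eq_inner inner_commute algebra_simps)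
      moreover have "w k t \<bullet> D = Im (cnj (w k t) * laguerre_op \<alpha> (\<lambda>k. w k t) k)"
        by (simp add: D_def inner_complex_def algebra_simps)
      ultimately show ?thesis unfolding has_field_derivative_def by (simp only:)
    qed
    have "(s N has_real_derivative (\<Sum>k<Suc N. 2 * Im (cnj (w k t) * laguerre_op \<alpha> (\<lambda>k. w k t) k))) (at t)"
      unfolding s_def by (intro DERIV_sum d1)
    \<comment> \<open>The diagonal contributions are real and the off-diagonal ones cancel between
      neighbours, so only the flux from site \<open>N\<close> to \<open>Suc N\<close>
      survives.\<close>
    moreover have "(\<Sum>k<Suc N. 2 * Im (cnj (w k t) * laguerre_op \<alpha> (\<lambda>k. w k t) k)) = s' N t"
      unfolding s'_def by (induction N) (simp_all add: laguerre_op_eq algebra_simps)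
    ultimately show ?thesis by simp
  qed
  define Q where "Q K t = (\<Sum>N<K. s N t / ?a N)" for K t
  define Q' where "Q' K t = (\<Sum>N<K. s' N t / ?a N)" for K t
  have dQ: "(Q K has_real_derivative Q' K t) (at t)" for K t
    unfolding Q_def Q'_def by (intro DERIV_sum DERIV_cdivide ds)
  have Q'_bound: "\<bar>Q' K t\<bar> \<le> 2 * C" for K t
  proof -
    have "\<bar>Q' K t\<bar> \<le> (\<Sum>N<K. \<bar>s' N t / ?a N\<bar>)" unfolding Q'_def by (rule sum_abs)
    also have "\<dots> \<le> (\<Sum>N<K. (cmod (w N t))\<^sup>2 + (cmod (w (Suc N) t))\<^sup>2)"
    proof (rule sum_mono)
      fix N
      \<comment> \<open>The weight 1 / a_(N+1) in \<open>Q\<close> is chosen to cancel the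
        coefficient of the flux.\<close>
      have "\<bar>s' N t / ?a N\<bar> = 2 * \<bar>Im (cnj (w N t) * w (Suc N) t)\<bar>"
        using apos[of N] unfolding s'_def by (subst abs_divide) (simp add: abs_mult del: Im_complex_div_eq_0 times_complex.sel)
      also have "\<dots> \<le> 2 * (cmod (w N t) * cmod (w (Suc N) t))"
        using abs_Im_le_cmod[of "cnj (w N t) * w (Suc N) t"] by (simp add: norm_mult)
      also have "\<dots> \<le> (cmod (w N t))\<^sup>2 + (cmod (w (Suc N) t))\<^sup>2"
        using sum_squares_bound[of "cmod (w N t)" "cmod (w (Suc N) t)"] by simp
      finally show "\<bar>s' N t / ?a N\<bar> \<le> (cmod (w N t))\<^sup>2 + (cmod (w (Suc N) t))\<^sup>2" .
    qed
    also have "\<dots> = (\<Sum>N<K. (cmod (w N t))\<^sup>2) + (\<Sum>N<K. (cmod (w (Suc N) t))\<^sup>2)" by (rule sum.distrib)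
    also have "(\<Sum>N<K. (cmod (w (Suc N) t))\<^sup>2) \<le> (\<Sum>N<Suc K. (cmod (w N t))\<^sup>2)"
      by (subst sum.lessThan_Suc_shift) simp
    finally show ?thesis using bound[where N=K and t=t] bound[where N="Suc K" and t=t] by linarith
  qed
  have Q0: "Q K 0 = 0" for K by (simp add: Q_def s_def w0)
  have Q_bound: "Q K t \<le> 2 * C * \<bar>t\<bar>" for K
  proof -
    have "norm (Q K t - Q K 0) \<le> 2 * C * norm (t - 0)"
      by (rule field_differentiable_bound[where S=UNIV and f'="Q' K"])
         (use dQ Q'_bound in \<open>auto intro: has_field_derivative_at_within\<close>)
    thus ?thesis by (simp add: Q0)
  qed
  show ?thesis
  proof (rule ccontr)
    assume "w k t \<noteq> 0"
    define c where "c = (cmod (w k t))\<^sup>2"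
    have c: "c > 0" using \<open>w k t \<noteq> 0\<close> by (simp add: c_def)
    have s_ge: "s N t \<ge> c" if "N \<ge> k" for N
      unfolding s_def c_def using that by (intro member_le_sum) auto
    have s_nn: "s N t \<ge> 0" for N unfolding s_def by (intro sum_nonneg) auto
    have "summable (\<lambda>n. 1 / ?a (n + k))"
    proof (rule summableI_nonneg_bounded[where x="2 * C * \<bar>t\<bar> / c"])
      show "0 \<le> 1 / ?a (n + k)" for n using apos[of "n + k"] by simp
      fix n
      have "c * (\<Sum>i<n. 1 / ?a (i + k)) = (\<Sum>i<n. c / ?a (i + k))" by (simp add: sum_distrib_left)
      also have "\<dots> \<le> (\<Sum>i<n. s (i + k) t / ?a (i + k))"
        by (intro sum_mono divide_right_mono s_ge less_imp_le[OF apos]) simp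
      also have "\<dots> = (\<Sum>N\<in>(\<lambda>i. i + k) ` {..<n}. s N t / ?a N)"
        by (subst sum.reindex) (auto simp: inj_on_def)
      also have "\<dots> \<le> Q (n + k) t"
        unfolding Q_def by (rule sum_mono2) (use s_nn apos less_imp_le[OF apos] in auto)
      also have "\<dots> \<le> 2 * C * \<bar>t\<bar>" by (rule Q_bound)
      finally show "(\<Sum>i<n. 1 / ?a (i + k)) \<le> 2 * C * \<bar>t\<bar> / c" using c by (simp add: field_simps)
    qed
    hence "summable (\<lambda>n. 1 / ?a n)" by (subst (asm) summable_iff_shift)
    thus False using not_summable_inverse_jac_a[OF \<alpha>] by simp
  qed
qed

section \<open>The explicit solution\<close>

definition lag_c :: "real \<Rightarrow> nat \<Rightarrow> real" where
  "lag_c \<alpha> k = sqrt (pochhammer (\<alpha> + 1) k / fact k)"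

lemma lag_c_0 [simp]: "lag_c \<alpha> 0 = 1"
  by (simp add: lag_c_def)

lemma lag_c_power2: "0 \<le> \<alpha> \<Longrightarrow> (lag_c \<alpha> k)\<^sup>2 = pochhammer (\<alpha> + 1) k / fact k"
  by (simp add: lag_c_def pochhammer_nonneg)

lemma lag_c_Suc:
  assumes "0 \<le> \<alpha>"
  shows "lag_c \<alpha> (Suc k) = lag_c \<alpha> k * sqrt ((real k + 1 + \<alpha>) / (real k + 1))"
  unfolding lag_c_def real_sqrt_mult[symmetric] pochhammer_Suc fact_Suc
  by (simp add: field_simps)

text \<open>With p^2 = k + 1 and q^2 = k + 1 + \<alpha>, the matrix entry is p q and the quotient of
  consecutive \<open>lag_c\<close> is q / p. Their product or quotient is free of roots, which is
  what makes a geometric ansatz succeed.\<close>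

lemma jac_a_lag_c:
  assumes "0 \<le> \<alpha>"
  shows "jac_a \<alpha> (Suc k) * lag_c \<alpha> k = (real k + 1) * lag_c \<alpha> (Suc k)"
    and "jac_a \<alpha> (Suc k) * lag_c \<alpha> (Suc k) = (real k + 1 + \<alpha>) * lag_c \<alpha> k"
proof -
  define p q where "p = sqrt (real k + 1)" and "q = sqrt (real k + 1 + \<alpha>)"
  have pq: "p > 0" "q > 0" "p * p = real k + 1" "q * q = real k + 1 + \<alpha>"
    using assms by (auto simp: p_def q_def)
  have a: "jac_a \<alpha> (Suc k) = p * q" by (simp add: jac_a_def p_def q_def add_ac flip: real_sqrt_mult)
  have c: "lag_c \<alpha> (Suc k) = lag_c \<alpha> k * (q / p)"
    by (simp add: lag_c_Suc[OF assms] p_def q_def real_sqrt_divide)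
  show "jac_a \<alpha> (Suc k) * lag_c \<alpha> k = (real k + 1) * lag_c \<alpha> (Suc k)"
    unfolding a c pq(3)[symmetric] using pq(1) by simp
  show "jac_a \<alpha> (Suc k) * lag_c \<alpha> (Suc k) = (real k + 1 + \<alpha>) * lag_c \<alpha> k"
    unfolding a c pq(4)[symmetric] using pq(1) by simp
qed

text \<open>The same identity drives the time evolution (complex \<open>r\<close>) and the Laplace transforms of the
  orthonormal polynomials (real \<open>r\<close>).\<close>

lemma jacobi_geometric:
  fixes r :: "'a :: {real_normed_field}"
  assumes "0 \<le> \<alpha>"
  shows "of_real (jac_a \<alpha> k) * (of_real (lag_c \<alpha> (k - 1)) * r ^ (k - 1)) + of_real (jac_b \<alpha> k) * (of_real (lag_c \<alpha> k) * r ^ k)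
      + of_real (jac_a \<alpha> (Suc k)) * (of_real (lag_c \<alpha> (Suc k)) * r ^ Suc k)
    = of_real (lag_c \<alpha> k) * (of_nat k * r ^ (k - 1) * (1 + r)\<^sup>2 + of_real (\<alpha> + 1) * r ^ k * (1 + r))"
proof -
  have 1: "of_real (jac_a \<alpha> k) * (of_real (lag_c \<alpha> (k - 1)) * r ^ (k - 1)) = of_real (lag_c \<alpha> k) * (of_nat k * r ^ (k - 1))"
  proof (cases k)
    case (Suc j)
    show ?thesis using arg_cong[OF jac_a_lag_c(1)[OF assms, of j], of "of_real :: real \<Rightarrow> 'a"]
      by (simp add: Suc algebra_simps)
  qed simp
  have 2: "of_real (jac_a \<alpha> (Suc k)) * (of_real (lag_c \<alpha> (Suc k)) * r ^ Suc k)
      = of_real (lag_c \<alpha> k) * ((of_nat k + 1 + of_real \<alpha>) * r ^ Suc k)"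
    using arg_cong[OF jac_a_lag_c(2)[OF assms, of k], of "of_real :: real \<Rightarrow> 'a"]
    by (simp add: algebra_simps)
  have "of_real (jac_a \<alpha> k) * (of_real (lag_c \<alpha> (k - 1)) * r ^ (k - 1)) + of_real (jac_b \<alpha> k) * (of_real (lag_c \<alpha> k) * r ^ k)
      + of_real (jac_a \<alpha> (Suc k)) * (of_real (lag_c \<alpha> (Suc k)) * r ^ Suc k)
     = of_real (lag_c \<alpha> k) * (of_nat k * r ^ (k - 1) + (2 * of_nat k + 1 + of_real \<alpha>) * r ^ k
         + (of_nat k + 1 + of_real \<alpha>) * r ^ Suc k)"
    unfolding 1 2 by (simp add: jac_b_def algebra_simps)
  \<comment> \<open>Grouped to match the product rule: with 1 + r = 1 / z, the first term is what
    differentiating r^k produces and the second what differentiating z^(-\<alpha>-1) produces, up to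
    sign.\<close>
  also have "of_nat k * r ^ (k - 1) + (2 * of_nat k + 1 + of_real \<alpha>) * r ^ k
         + (of_nat k + 1 + of_real \<alpha>) * r ^ Suc k
      = of_nat k * r ^ (k - 1) * (1 + r)\<^sup>2 + of_real (\<alpha> + 1) * r ^ k * (1 + r)"
    by (cases k) (simp_all add: power2_eq_square algebra_simps)
  finally show ?thesis .
qed

text \<open>The squares of \<open>lag_c\<close> are the Taylor coefficients of (1 -
  x)^(-\<alpha>-1). This series gives both the norm of the explicit solution and Parseval's equality
  for exponentials.\<close>

lemma negative_binomial_sums:
  assumes "0 \<le> \<alpha>" "\<bar>x\<bar> < 1"
  shows "(\<lambda>k. (lag_c \<alpha> k)\<^sup>2 * x ^ k) sums (1 - x) powr (- (\<alpha> + 1))"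
proof -
  have "(\<lambda>n. (- (\<alpha> + 1) gchoose n) * (- x) ^ n) sums (1 + (- x)) powr (- (\<alpha> + 1))"
    using assms by (intro gen_binomial_real) auto
  moreover have "(- (\<alpha> + 1) gchoose n) * (- x) ^ n = (lag_c \<alpha> n)\<^sup>2 * x ^ n" for n
  proof -
    have "(- (\<alpha> + 1) gchoose n) * (- x) ^ n = ((-1) ^ n * (-1) ^ n) * (pochhammer (\<alpha> + 1) n / fact n * x ^ n)"
      by (simp add: gbinomial_pochhammer power_minus[of x] algebra_simps)
    thus ?thesis by (simp add: lag_c_power2 assms flip: power_mult_distrib)
  qed
  ultimately show ?thesis by simp
qed

definition lag_psi :: "real \<Rightarrow> nat \<Rightarrow> real \<Rightarrow> complex" where
  "lag_psi \<alpha> k t = of_real (lag_c \<alpha> k) * ((- \<i> * of_real t / (1 + \<i> * of_real t)) ^ k *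
     (1 + \<i> * of_real t) powr (- of_real (\<alpha> + 1)))"

lemma norm_powr_of_real: "z \<noteq> 0 \<Longrightarrow> cmod (z powr of_real a) = cmod z powr a"
  by (simp add: powr_def)

lemma lag_psi_norm:
  assumes "0 \<le> \<alpha>"
  shows "(cmod (lag_psi \<alpha> k t))\<^sup>2 = (lag_c \<alpha> k)\<^sup>2 * (t\<^sup>2 / (1 + t\<^sup>2)) ^ k * (1 + t\<^sup>2) powr (- (\<alpha> + 1))"
proof -
  let ?z = "1 + \<i> * complex_of_real t"
  have z: "?z \<noteq> 0" by (auto simp: complex_eq_iff)
  have n: "(cmod ?z)\<^sup>2 = 1 + t\<^sup>2" by (simp add: cmod_power2)
  have pos: "1 + t\<^sup>2 > 0" by (rule add_pos_nonneg) auto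
  have 1: "(cmod ((- \<i> * of_real t / ?z) ^ k))\<^sup>2 = (t\<^sup>2 / (1 + t\<^sup>2)) ^ k"
  proof -
    have "(cmod (y ^ k))\<^sup>2 = ((cmod y)\<^sup>2) ^ k" for y
      by (simp add: norm_power mult.commute flip: power_mult)
    thus ?thesis by (simp only:) (simp add: norm_divide norm_mult power_divide n)
  qed
  have "cmod ?z = sqrt (1 + t\<^sup>2)" by (simp add: cmod_def)
  hence "cmod (?z powr (- of_real (\<alpha> + 1))) = sqrt (1 + t\<^sup>2) powr (- (\<alpha> + 1))"
    using norm_powr_of_real[OF z, of "- (\<alpha> + 1)"] by simp
  hence "(cmod (?z powr (- of_real (\<alpha> + 1))))\<^sup>2 = (sqrt (1 + t\<^sup>2) powr (- (\<alpha> + 1))) * (sqrt (1 + t\<^sup>2) powr (- (\<alpha> + 1)))"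
    by (simp only: power2_eq_square)
  also have "\<dots> = (sqrt (1 + t\<^sup>2) * sqrt (1 + t\<^sup>2)) powr (- (\<alpha> + 1))"
    by (rule powr_mult[symmetric])
  also have "\<dots> = (1 + t\<^sup>2) powr (- (\<alpha> + 1))" using pos by simp
  finally have 2: "(cmod (?z powr (- of_real (\<alpha> + 1))))\<^sup>2 = (1 + t\<^sup>2) powr (- (\<alpha> + 1))" .
  show ?thesis unfolding lag_psi_def norm_mult power_mult_distrib 1 2 by simp
qed

text \<open>With x = t^2 / (1 + t^2) one has 1 - x = 1 / (1 + t^2), so the negative binomial series
  sums the squares to exactly 1. The bound is an input of
  \<open>jacobi_evolution_unique\<close>.\<close>

lemma lag_psi_bound:
  assumes "0 \<le> \<alpha>" shows "(\<Sum>k<N. (cmod (lag_psi \<alpha> k t))\<^sup>2) \<le> 1"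
proof -
  have pos: "1 + t\<^sup>2 > 0" by (rule add_pos_nonneg) auto
  have "(\<lambda>k. (lag_c \<alpha> k)\<^sup>2 * (t\<^sup>2 / (1 + t\<^sup>2)) ^ k) sums (1 - t\<^sup>2 / (1 + t\<^sup>2)) powr (- (\<alpha> + 1))"
    using pos by (intro negative_binomial_sums assms) simp
  from sums_mult2[OF this, of "(1 + t\<^sup>2) powr (- (\<alpha> + 1))"]
  have "(\<lambda>k. (cmod (lag_psi \<alpha> k t))\<^sup>2) sums
      ((1 - t\<^sup>2 / (1 + t\<^sup>2)) powr (- (\<alpha> + 1)) * (1 + t\<^sup>2) powr (- (\<alpha> + 1)))"
    by (simp add: lag_psi_norm[OF assms])
  also have "(1 - t\<^sup>2 / (1 + t\<^sup>2)) powr (- (\<alpha> + 1)) * (1 + t\<^sup>2) powr (- (\<alpha> + 1))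
      = ((1 - t\<^sup>2 / (1 + t\<^sup>2)) * (1 + t\<^sup>2)) powr (- (\<alpha> + 1))"
    using pos by (intro powr_mult[symmetric]) 
  also have "(1 - t\<^sup>2 / (1 + t\<^sup>2)) * (1 + t\<^sup>2) = 1" using pos by (simp add: field_simps)
  finally have "(\<lambda>k. (cmod (lag_psi \<alpha> k t))\<^sup>2) sums 1" by simp
  thus ?thesis using sum_le_suminf[of "\<lambda>k. (cmod (lag_psi \<alpha> k t))\<^sup>2" "{..<N}"]
    by (auto simp: sums_iff)
qed

lemma lag_psi_0: "lag_psi \<alpha> k 0 = delta 0 k"
  by (simp add: lag_psi_def delta_def)

text \<open>In terms of z = 1 + i t the ansatz depends on z alone, since - i t / z = (1 - z) / z,
  and z has real part 1, away from the branch cut of the power. The chain rule followed by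
  \<open>jacobi_geometric\<close> gives the equation.\<close>

lemma lag_psi_ode:
  assumes "0 \<le> \<alpha>"
  shows "(lag_psi \<alpha> k has_vector_derivative - \<i> * laguerre_op \<alpha> (\<lambda>k. lag_psi \<alpha> k t) k) (at t)"
proof -
  define z where "z = 1 + \<i> * complex_of_real t"
  define r where "r = - \<i> * complex_of_real t / z"
  define h where "h = z powr (- of_real (\<alpha> + 1))"
  have zn: "z \<notin> \<real>\<^sub>\<le>\<^sub>0" by (auto simp: z_def complex_nonpos_Reals_iff)
  have z0: "z \<noteq> 0" using zn by auto
  have r1: "1 + r = 1 / z" using z0 by (simp add: r_def z_def field_simps)
  have r2: "(1 - z) / z = r" by (simp add: r_def z_def)
  define g where "g y = of_real (lag_c \<alpha> k) * (((1 - y) / y) ^ k * y powr (- of_real (\<alpha> + 1)))" for y :: complex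
  have "(g has_field_derivative of_real (lag_c \<alpha> k) *
      (of_nat k * ((1 - z) / z) ^ (k - 1) * (- 1 / z\<^sup>2) * h + (- of_real (\<alpha> + 1)) * (h / z) * ((1 - z) / z) ^ k)) (at z)"
  proof -
    have d1: "((\<lambda>y. (1 - y) / y) has_field_derivative - 1 / z\<^sup>2) (at z)"
      using z0 by (auto intro!: derivative_eq_intros simp: field_simps power2_eq_square)
    have d2: "((\<lambda>y. y powr (- of_real (\<alpha> + 1))) has_field_derivative (- of_real (\<alpha> + 1)) * (h / z)) (at z)"
    proof -
      have "z powr (- of_real (\<alpha> + 1) - 1) = h / z"
        using z0 powr_diff[of z "- of_real (\<alpha> + 1)" 1] by (simp only: h_def powr_to_1 simp_thms if_False)
      thus ?thesis using has_field_derivative_powr[OF zn, of "- of_real (\<alpha> + 1)"] by (simp only:)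
    qed
    show ?thesis unfolding g_def
      by (rule DERIV_cmult, rule DERIV_cong[OF DERIV_mult[OF DERIV_power[OF d1, of k] d2]]) (simp add: h_def)
  qed
  moreover have "((\<lambda>t. 1 + \<i> * complex_of_real t) has_vector_derivative \<i>) (at t)"
    by (auto intro!: derivative_eq_intros)
  ultimately have "((g \<circ> (\<lambda>t. 1 + \<i> * complex_of_real t)) has_vector_derivative \<i> * (of_real (lag_c \<alpha> k) *
      (of_nat k * r ^ (k - 1) * (- 1 / z\<^sup>2) * h + (- of_real (\<alpha> + 1)) * (h / z) * r ^ k))) (at t)"
    unfolding r2 by (intro field_vector_diff_chain_at) (simp_all add: z_def)
  moreover have "g \<circ> (\<lambda>t. 1 + \<i> * complex_of_real t) = lag_psi \<alpha> k"
    by (auto simp: g_def lag_psi_def)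
  moreover have "\<i> * (of_real (lag_c \<alpha> k) *
      (of_nat k * r ^ (k - 1) * (- 1 / z\<^sup>2) * h + (- of_real (\<alpha> + 1)) * (h / z) * r ^ k))
    = - \<i> * laguerre_op \<alpha> (\<lambda>k. lag_psi \<alpha> k t) k"
  proof -
    have psi: "lag_psi \<alpha> j t = of_real (lag_c \<alpha> j) * r ^ j * h" for j
      by (simp add: lag_psi_def r_def z_def h_def)
    have "laguerre_op \<alpha> (\<lambda>k. lag_psi \<alpha> k t) k = h * (of_real (jac_a \<alpha> k) * (of_real (lag_c \<alpha> (k - 1)) * r ^ (k - 1))
       + of_real (jac_b \<alpha> k) * (of_real (lag_c \<alpha> k) * r ^ k)
       + of_real (jac_a \<alpha> (Suc k)) * (of_real (lag_c \<alpha> (Suc k)) * r ^ Suc k))"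
      unfolding laguerre_op_eq psi by (simp only: algebra_simps)
    also have "\<dots> = h * (of_real (lag_c \<alpha> k) * (of_nat k * r ^ (k - 1) * (1 / z)\<^sup>2 + of_real (\<alpha> + 1) * r ^ k * (1 / z)))"
      unfolding jacobi_geometric[OF assms] r1 ..
    finally show ?thesis by (simp add: power_divide algebra_simps)
  qed
  ultimately show ?thesis by simp
qed

section \<open>The evolution kernel of an arbitrary spectral resolution\<close>

text \<open>The derivative of exp has modulus at most 1 on the closed left half-plane, which is
  convex.\<close>

lemma cmod_exp_diff_le:
  assumes "Re a \<le> 0" "Re b \<le> 0"
  shows "cmod (exp a - exp b) \<le> cmod (a - b)"
proof -
  have "cmod (exp a - exp b) \<le> 1 * cmod (a - b)"
    by (rule field_differentiable_bound[where S="{z. Re z \<le> 0}" and f'=exp])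
       (use assms in \<open>auto intro: DERIV_exp has_field_derivative_at_within convex_halfspace_Re_le\<close>)
  thus ?thesis by simp
qed

definition osc :: "real \<Rightarrow> real \<Rightarrow> complex" where
  "osc t x = exp (- \<i> * complex_of_real t * complex_of_real x)"

lemma osc_measurable [measurable]: "osc t \<in> borel_measurable borel"
  unfolding osc_def by (intro borel_measurable_continuous_onI continuous_intros)

lemma norm_osc [simp]: "cmod (osc t x) = 1"
  by (simp add: osc_def)

lemma osc_dominated: "osc t \<in> dominated (\<lambda>x. 1)"
  by (rule dominated_bounded[of _ 1]) (auto simp: osc_measurable)

lemma osc_diff_bound: "cmod (osc s x - osc t x) \<le> \<bar>s - t\<bar> * \<bar>x\<bar>"
proof -
  have "cmod (osc s x - osc t x) \<le> cmod (- \<i> * complex_of_real s * complex_of_real x - - \<i> * complex_of_real t * complex_of_real x)"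
    unfolding osc_def by (rule cmod_exp_diff_le) auto
  also have "- \<i> * complex_of_real s * complex_of_real x - - \<i> * complex_of_real t * complex_of_real x = - \<i> * of_real ((s - t) * x)"
    by (simp add: algebra_simps)
  also have "cmod \<dots> = \<bar>s - t\<bar> * \<bar>x\<bar>" unfolding norm_mult norm_of_real by (simp add: abs_mult)
  finally show ?thesis .
qed

lemma osc_derivative: "((\<lambda>s. osc s x) has_vector_derivative - \<i> * of_real x * osc t x) (at t)"
proof -
  have "((\<lambda>z. exp (- \<i> * z * complex_of_real x)) has_field_derivative - \<i> * of_real x * osc t x) (at (of_real t))"
    by (auto intro!: derivative_eq_intros simp: osc_def)
  from has_vector_derivative_real_field[OF this] show ?thesis by (simp add: osc_def)
qed

text \<open>Puts derivatives into the form of difference quotients, to which dominated convergence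
  along sequences applies.\<close>

lemma has_vector_derivative_iff_Lim:
  "(f has_vector_derivative D) (at t) \<longleftrightarrow> ((\<lambda>s. (f s - f t) /\<^sub>R (s - t)) \<longlongrightarrow> D) (at t)"
proof -
  have eq: "norm (f s - f t - (s - t) *\<^sub>R D) / norm (s - t) = norm ((f s - f t) /\<^sub>R (s - t) - D)"
    if "s \<noteq> t" for s
  proof -
    have "(f s - f t) /\<^sub>R (s - t) - D = (f s - f t - (s - t) *\<^sub>R D) /\<^sub>R (s - t)"
      using that by (simp add: scaleR_diff_right)
    thus ?thesis by (simp add: divide_inverse mult.commute)
  qed
  have "(f has_vector_derivative D) (at t) \<longleftrightarrow>
      ((\<lambda>s. norm (f s - f t - (s - t) *\<^sub>R D) / norm (s - t)) \<longlongrightarrow> 0) (at t)"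
    by (simp add: has_vector_derivative_def has_derivative_iff_norm bounded_linear_scaleR_left)
  also have "\<dots> \<longleftrightarrow> ((\<lambda>s. norm ((f s - f t) /\<^sub>R (s - t) - D)) \<longlongrightarrow> 0) (at t)"
    by (intro tendsto_cong) (use eq in \<open>auto simp: eventually_at_filter\<close>)
  also have "\<dots> \<longleftrightarrow> ((\<lambda>s. (f s - f t) /\<^sub>R (s - t)) \<longlongrightarrow> D) (at t)"
    by (simp only: tendsto_norm_zero_iff LIM_zero_iff)
  finally show ?thesis .
qed

lemma (in pvm) measurable_\<mu> [simp]: "measurable (\<mu> u) M = measurable borel M"
  by (rule measurable_cong_sets) auto

text \<open>Domains of spectral resolutions are given by second moments, whereas the form of the
  operator needs the weight 1 + |x|, which is at most 2 + x^2.\<close>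

lemma (in pvm) integrable_first_moment:
  assumes u: "u \<in> ell2" "(\<integral>\<^sup>+x. ennreal (x\<^sup>2) \<partial>\<mu> u) < \<infinity>"
  shows "integrable (\<mu> u) (\<lambda>x. 1 + \<bar>x\<bar>)"
proof -
  interpret finite_measure "\<mu> u" using u by (intro finite_measure_\<mu>)
  have "integrable (\<mu> u) (\<lambda>x. x\<^sup>2)"
    by (rule integrableI_bounded) (use u in simp_all)
  hence "integrable (\<mu> u) (\<lambda>x. 2 + x\<^sup>2)" by simp
  thus ?thesis
  proof (rule Bochner_Integration.integrable_bound)
    show "(\<lambda>x. 1 + \<bar>x\<bar>) \<in> borel_measurable (\<mu> u)" by simp
    have "1 + \<bar>x\<bar> \<le> 2 + x\<^sup>2" for x :: real
      using sum_squares_bound[of 1 "\<bar>x\<bar>"] zero_le_power2[of x] by simp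
    thus "AE x in \<mu> u. norm (1 + \<bar>x\<bar>) \<le> norm (2 + x\<^sup>2)" by (auto intro!: AE_I2)
  qed
qed

locale laguerre_resolution = pvm +
  fixes \<alpha> :: real
  assumes \<alpha>: "0 \<le> \<alpha>" and res: "spectral_resolution (laguerre_dom \<alpha>) (laguerre_op \<alpha>) E"
begin

abbreviation "H \<equiv> laguerre_op \<alpha>"
abbreviation "D \<equiv> laguerre_dom \<alpha>"

lemma dom_iff: "u \<in> D \<longleftrightarrow> u \<in> ell2 \<and> (\<integral>\<^sup>+x. ennreal (x\<^sup>2) \<partial>\<mu> u) < \<infinity>"
  using res by (auto simp: spectral_resolution_def)

lemma dom_ell2: "u \<in> D \<Longrightarrow> u \<in> ell2" "u \<in> D \<Longrightarrow> H u \<in> ell2"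
  by (auto simp: laguerre_dom_def)

lemma form_eq: "u \<in> D \<Longrightarrow> v \<in> D \<Longrightarrow>
    ell2_inner v (H u) = S complex_of_real v u"
  using res by (auto simp: spectral_resolution_def)

text \<open>The measure of the projected vector is the restriction of the original one to
  \<open>A\<close>, so its second moment cannot grow. \<open>form_eq\<close> can therefore be
  applied to projected vectors.\<close>

lemma E_dom:
  assumes u: "u \<in> D" and A: "A \<in> sets borel"
  shows "E A u \<in> D"
proof -
  have u2: "u \<in> ell2" using u by (rule dom_ell2)
  have "\<mu> (E A u) = density (\<mu> u) (indicator A)"
  proof (rule measure_eqI)
    fix B assume "B \<in> sets (\<mu> (E A u))"
    hence B: "B \<in> sets borel" by simp
    have "emeasure (density (\<mu> u) (indicator A)) B = (\<integral>\<^sup>+x. indicator (A \<inter> B) x \<partial>\<mu> u)"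
      using A B by (subst emeasure_density) (simp_all add: indicator_inter_arith[symmetric] del: nn_integral_indicator)
    also have "\<dots> = ennreal (nsq (E (B \<inter> A) u))"
      using A B u2 by (simp add: emeasure_\<mu> Int_commute)
    finally show "emeasure (\<mu> (E A u)) B = emeasure (density (\<mu> u) (indicator A)) B"
      using A B u2 by (simp add: emeasure_\<mu> E_ell2 E_Int)
  qed simp
  hence "(\<integral>\<^sup>+x. ennreal (x\<^sup>2) \<partial>\<mu> (E A u)) = (\<integral>\<^sup>+x. indicator A x * ennreal (x\<^sup>2) \<partial>\<mu> u)"
    using A by (simp add: nn_integral_density)
  also have "\<dots> \<le> (\<integral>\<^sup>+x. ennreal (x\<^sup>2) \<partial>\<mu> u)"
    by (intro nn_integral_mono) (auto simp: indicator_def)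
  also have "\<dots> < \<infinity>" using u by (simp add: dom_iff)
  finally show ?thesis using A u2 by (simp add: dom_iff E_ell2)
qed

text \<open>The domain is a linear space, so all four polarization vectors have integrable first
  moments.\<close>

lemma dct_S_dom:
  assumes "u \<in> D" "v \<in> D"
  shows "dct_functional (\<lambda>x. 1 + \<bar>x\<bar>) (\<lambda>f. S f v u)"
  using laguerre_dom_lincomb[OF assms(2,1), of 1] dom_iff
  by (intro dct_S_general integrable_first_moment) auto

lemma of_real_dominated: "complex_of_real \<in> dominated (\<lambda>x. 1 + \<bar>x\<bar>)"
  by (rule dominatedI[of _ 1]) auto

text \<open>For \<open>f\<close> an indicator the projection moves to the left vector, which stays
  in the domain, and the defining identity \<open>form_eq\<close> applies there. Both sides are then
  functionals of bounded \<open>f\<close>.\<close>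

lemma S_op:
  assumes u: "u \<in> D" and v: "v \<in> D" and f: "f \<in> dominated (\<lambda>x. 1)"
  shows "S (\<lambda>x. of_real x * f x) v u = S f v (H u)"
proof (rule dct_eqI[OF dct_functional_mult[OF dct_S_dom[OF u v], where D=1] dct_S _ _ f])
  fix A :: "real set" assume A: "A \<in> sets borel"
  have "S (indicator A) v (H u) = ell2_inner (E A v) (H u)"
    using A u v by (simp add: S_indicator dom_ell2 E_sym)
  also have "\<dots> = S complex_of_real (E A v) u" by (intro form_eq u E_dom v A)
  also have "\<dots> = S (\<lambda>x. indicator A x * of_real x) v u"
    by (rule S_E_left[where h="\<lambda>x. 1 + \<bar>x\<bar>"])
       (use A u v in \<open>auto intro: dct_S_dom E_dom dom_ell2 of_real_dominated\<close>)
  finally show "S (\<lambda>x. of_real x * indicator A x) v u = S (indicator A) v (H u)"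
    by (simp add: mult.commute)
qed (use u v in \<open>auto intro: dom_ell2\<close>)

text \<open>Difference quotients of \<open>osc\<close> are bounded by |x|, a dominated function for
  vectors of the domain, so the limit passes through \<open>S\<close>; the factor x it produces
  becomes \<open>H\<close> by \<open>S_op\<close>.\<close>

lemma S_osc_derivative:
  assumes u: "u \<in> D" and v: "v \<in> D"
  shows "((\<lambda>t. S (osc t) v u) has_vector_derivative - \<i> * S (osc t) v (H u)) (at t)"
proof -
  note dct = dct_S_dom[OF u v]
  have oscd: "osc s \<in> dominated (\<lambda>x. 1 + \<bar>x\<bar>)" for s by (rule dominatedI[of _ 1]) auto
  have "((\<lambda>s. (S (osc s) v u - S (osc t) v u) /\<^sub>R (s - t)) \<longlongrightarrow> - \<i> * S (osc t) v (H u)) (at t)"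
    unfolding tendsto_at_iff_sequentially
  proof (intro allI impI)
    fix X assume X: "\<forall>i. X i \<in> UNIV - {t}" "X \<longlonglongrightarrow> t"
    let ?q = "\<lambda>n x. of_real (1 / (X n - t)) * osc (X n) x + (- of_real (1 / (X n - t))) * osc t x"
    have "(\<lambda>n. S (?q n) v u) \<longlonglongrightarrow> S (\<lambda>x. - \<i> * (of_real x * osc t x)) v u"
    proof (rule dct_limit[OF dct, where C=1])
      show "?q n \<in> borel_measurable borel" for n by measurable
      show "cmod (?q n x) \<le> 1 * (1 + \<bar>x\<bar>)" for n x
      proof -
        have ne: "X n \<noteq> t" using X(1) by auto
        have "?q n x = of_real (1 / (X n - t)) * (osc (X n) x - osc t x)" by (simp add: diff_divide_distrib)
        hence "cmod (?q n x) = \<bar>1 / (X n - t)\<bar> * cmod (osc (X n) x - osc t x)"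
          by (simp only: norm_mult norm_of_real)
        also have "\<dots> \<le> \<bar>1 / (X n - t)\<bar> * (\<bar>X n - t\<bar> * \<bar>x\<bar>)"
          by (intro mult_left_mono osc_diff_bound) auto
        also have "\<dots> = \<bar>x\<bar>" using ne by simp
        finally show ?thesis by simp
      qed
      show "(\<lambda>n. ?q n x) \<longlonglongrightarrow> - \<i> * (of_real x * osc t x)" for x
      proof -
        have "((\<lambda>s. (osc s x - osc t x) /\<^sub>R (s - t)) \<longlongrightarrow> - \<i> * of_real x * osc t x) (at t)"
          using osc_derivative[of x t] by (simp only: has_vector_derivative_iff_Lim)
        from this[unfolded tendsto_at_iff_sequentially, rule_format, OF X(1)[rule_format] X(2)]
        show ?thesis by (simp add: o_def scaleR_conv_of_real algebra_simps divide_inverse)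
      qed
    qed
    moreover have "S (?q n) v u = (S (osc (X n)) v u - S (osc t) v u) /\<^sub>R (X n - t)" for n
      unfolding dct_lincomb[OF dct oscd oscd] by (simp add: scaleR_conv_of_real divide_inverse algebra_simps)
    moreover have "S (\<lambda>x. - \<i> * (of_real x * osc t x)) v u = - \<i> * S (osc t) v (H u)"
    proof -
      have "(\<lambda>x. of_real x * osc t x) \<in> dominated (\<lambda>x. 1 + \<bar>x\<bar>)"
        by (rule dominatedI[of _ 1]) (auto simp: norm_mult)
      from dct_lincomb[OF dct this this, of "-\<i>" 0]
      show ?thesis by (simp add: S_op[OF u v osc_dominated])
    qed
    ultimately show "((\<lambda>s. (S (osc s) v u - S (osc t) v u) /\<^sub>R (s - t)) \<circ> X)
        \<longlonglongrightarrow> - \<i> * S (osc t) v (H u)"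
      by (simp add: o_def)
  qed
  thus ?thesis by (simp only: has_vector_derivative_iff_Lim)
qed

text \<open>Both sides solve the same evolution equation with the same initial value and bounded
  partial sums. Only the axioms of a resolution are used, so the choice made by \<open>SOME\<close>
  cannot influence these entries.\<close>

lemma S_osc_eq_psi: "S (osc t) (delta 0) (delta k) = lag_psi \<alpha> k t"
proof -
  define w where "w k t = S (osc t) (delta 0) (delta k) - lag_psi \<alpha> k t" for k t
  have "w k t = 0"
  \<comment> \<open>Both families have squared norm at most 1, and the square of a difference is at
    most twice the sum of the squares, whence 4.\<close>
  proof (rule jacobi_evolution_unique[OF \<alpha>, where C="4"])
    fix k t
    have "S (osc t) (delta 0) (H (delta k)) =
        of_real (jac_a \<alpha> k) * S (osc t) (delta 0) (delta (k - 1)) + of_real (jac_b \<alpha> k) * S (osc t) (delta 0) (delta k)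
        + of_real (jac_a \<alpha> (Suc k)) * S (osc t) (delta 0) (delta (Suc k))"
      unfolding laguerre_op_delta
      using S_lincomb_right[where a=1 and b="of_real (jac_a \<alpha> (Suc k))" and f="osc t" and w="delta 0" and v="delta (Suc k)"
          and u="\<lambda>n. of_real (jac_a \<alpha> k) * delta (k - 1) n + of_real (jac_b \<alpha> k) * delta k n"]
      by (simp add: S_lincomb_right delta_ell2 osc_dominated ell2_lincomb)
    hence "(w k has_vector_derivative
        (- \<i> * (of_real (jac_a \<alpha> k) * S (osc t) (delta 0) (delta (k - 1)) + of_real (jac_b \<alpha> k) * S (osc t) (delta 0) (delta k)
        + of_real (jac_a \<alpha> (Suc k)) * S (osc t) (delta 0) (delta (Suc k)))
        - (- \<i> * H (\<lambda>k. lag_psi \<alpha> k t) k))) (at t)"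
      unfolding w_def
      using S_osc_derivative[OF delta_dom delta_dom, of 0 k t]
      by (intro has_vector_derivative_diff lag_psi_ode[OF \<alpha>]) simp
    thus "(w k has_vector_derivative - \<i> * H (\<lambda>k. w k t) k) (at t)"
      by (simp add: laguerre_op_eq w_def algebra_simps)
  next
    fix k
    have "osc 0 = indicator UNIV" by (auto simp: osc_def)
    hence "S (osc 0) (delta 0) (delta k) = delta k 0"
      by (simp add: S_indicator delta_ell2 E_UNIV inner_delta_left del: indicator_UNIV)
    thus "w k 0 = 0" by (simp add: w_def lag_psi_0 delta_def)
  next
    fix N t
    \<comment> \<open>The sum over \<open>k\<close> runs in the second slot of \<open>S\<close>.
      Conjugation turns its terms into the coordinates of the single vector
      \<open>\<Phi> ?f (delta 0)\<close>.\<close>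
    let ?f = "\<lambda>x. cnj (osc t x)"
    have f: "?f \<in> dominated (\<lambda>x. 1)" by (intro dominated_cnj osc_dominated)
    have "S (osc t) (delta 0) (delta k) = cnj (\<Phi> ?f (delta 0) k)" for k
      unfolding \<Phi>_def using S_cnj[OF delta_ell2 delta_ell2 osc_dominated] by simp
    hence eq: "cmod (S (osc t) (delta 0) (delta k)) = cmod (\<Phi> ?f (delta 0) k)" for k by simp
    have "nsq (\<Phi> ?f (delta 0)) \<le> 1"
    proof -
      interpret finite_measure "\<mu> (delta 0)" by (intro finite_measure_\<mu> delta_ell2)
      show ?thesis using nsq_\<Phi>[OF delta_ell2 f, of 0] by (simp add: measure_\<mu>_UNIV delta_ell2 nsq_delta)
    qed
    hence "(\<Sum>k<N. (cmod (S (osc t) (delta 0) (delta k)))\<^sup>2) \<le> 1"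
      unfolding eq using sum_le_nsq[OF \<Phi>_ell2[OF delta_ell2 f], of 0 N] by simp
    moreover have "(\<Sum>k<N. (cmod (w k t))\<^sup>2) \<le> (\<Sum>k<N. 2 * (cmod (S (osc t) (delta 0) (delta k)))\<^sup>2 + 2 * (cmod (lag_psi \<alpha> k t))\<^sup>2)"
      proof (rule sum_mono)
      fix k
      show "(cmod (w k t))\<^sup>2 \<le> 2 * (cmod (S (osc t) (delta 0) (delta k)))\<^sup>2 + 2 * (cmod (lag_psi \<alpha> k t))\<^sup>2"
        unfolding w_def using cmod_add_power2_le[of "S (osc t) (delta 0) (delta k)" "- lag_psi \<alpha> k t"] by simp
    qed
    moreover have "\<dots> = 2 * (\<Sum>k<N. (cmod (S (osc t) (delta 0) (delta k)))\<^sup>2) + 2 * (\<Sum>k<N. (cmod (lag_psi \<alpha> k t))\<^sup>2)"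
      by (simp add: sum.distrib sum_distrib_left)
    ultimately show "(\<Sum>k<N. (cmod (w k t))\<^sup>2) \<le> 4"
      using lag_psi_bound[OF \<alpha>, of t N] by linarith
  qed
  thus ?thesis by (simp add: w_def)
qed

end

section \<open>Orthonormal polynomials for the Gamma weight\<close>

text \<open>The Laguerre weight normalised to total mass 1; by \<open>S_delta_delta\<close> with
  both indices 0 it becomes the spectral measure of \<open>delta 0\<close> for the resolution
  constructed below.\<close>

definition gamma_measure :: "real \<Rightarrow> real measure" where
  "gamma_measure \<alpha> = density lborel (\<lambda>x. ennreal (indicator {0<..} x * (x powr \<alpha> * exp (- x) / Gamma (\<alpha> + 1))))"

lemma sets_gamma_measure [simp, measurable_cong]: "sets (gamma_measure \<alpha>) = sets borel"
  and space_gamma_measure [simp]: "space (gamma_measure \<alpha>) = UNIV"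
  by (simp_all add: gamma_measure_def)

lemma AE_gamma_measure_pos: "AE x in gamma_measure \<alpha>. 0 < x"
  unfolding gamma_measure_def
  by (subst AE_density) (auto intro!: AE_I2 simp: indicator_def split: if_splits)

text \<open>Euler's integral after the substitution t = a x. Working with nonnegative integrals
  makes integrability a consequence rather than a premise.\<close>

lemma nn_integral_powr_exp:
  assumes "0 < s" "0 < a"
  shows "(\<integral>\<^sup>+x. ennreal (indicator {0<..} x * (x powr (s - 1) * exp (- (a * x)))) \<partial>lborel) = ennreal (Gamma s * a powr (- s))"
proof -
  let ?f = "\<lambda>t. ennreal (indicator {0..} t * t powr (s - 1) / exp t)"
  let ?g = "\<lambda>x. ennreal (indicator {0<..} x * (x powr (s - 1) * exp (- (a * x))))"
  have "ennreal (Gamma s) = (\<integral>\<^sup>+t. ?f t \<partial>lborel)"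
    by (rule Gamma_conv_nn_integral_real[OF assms(1)])
  also have "\<dots> = ennreal \<bar>a\<bar> * (\<integral>\<^sup>+x. ?f (0 + a * x) \<partial>lborel)"
    by (rule nn_integral_real_affine) (use assms in auto)
  also have "(\<integral>\<^sup>+x. ?f (0 + a * x) \<partial>lborel) = (\<integral>\<^sup>+x. ennreal (a powr (s - 1)) * ?g x \<partial>lborel)"
  proof (rule nn_integral_cong)
    fix x :: real
    show "?f (0 + a * x) = ennreal (a powr (s - 1)) * ?g x"
    proof (cases "x > 0")
      case True
      thus ?thesis using assms
        by (simp add: powr_mult exp_minus divide_inverse mult.assoc flip: ennreal_mult)
    next
      case False
      hence "x < 0 \<or> x = 0" by auto
      thus ?thesis using assms mult_pos_neg[OF assms(2), of x] by (auto simp: indicator_def)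
    qed
  qed
  also have "\<dots> = ennreal (a powr (s - 1)) * (\<integral>\<^sup>+x. ?g x \<partial>lborel)"
    by (rule nn_integral_cmult) measurable
  also have "ennreal \<bar>a\<bar> * (ennreal (a powr (s - 1)) * (\<integral>\<^sup>+x. ?g x \<partial>lborel)) = ennreal (a powr s) * (\<integral>\<^sup>+x. ?g x \<partial>lborel)"
    using assms by (simp add: powr_diff mult.assoc[symmetric] ennreal_mult[symmetric])
  finally have eq: "ennreal (Gamma s) = ennreal (a powr s) * (\<integral>\<^sup>+x. ?g x \<partial>lborel)" .
  have "ennreal (Gamma s * a powr (- s)) = ennreal (a powr (- s)) * ennreal (Gamma s)"
    using assms Gamma_real_pos[OF assms(1)] by (subst ennreal_mult[symmetric]) (auto simp: mult.commute)
  also have "\<dots> = (ennreal (a powr (- s)) * ennreal (a powr s)) * (\<integral>\<^sup>+x. ?g x \<partial>lborel)"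
    unfolding eq by (simp add: mult.assoc)
  also have "ennreal (a powr (- s)) * ennreal (a powr s) = 1"
    using assms by (subst ennreal_mult[symmetric]) (auto simp: powr_minus)
  finally show ?thesis by simp
qed

text \<open>This is (-1)^j times the j-th derivative of (1 + c)^(-\<alpha>-1), the Laplace transform
  of the weight.\<close>

definition gamma_moment :: "real \<Rightarrow> nat \<Rightarrow> real \<Rightarrow> real" where
  "gamma_moment \<alpha> j c = pochhammer (\<alpha> + 1) j * (1 + c) powr (- (\<alpha> + 1 + real j))"

lemma gamma_measure_moment:
  assumes \<alpha>: "0 \<le> \<alpha>" and c: "- 1 < c"
  shows "has_bochner_integral (gamma_measure \<alpha>) (\<lambda>x. exp (- (c * x)) * x ^ j) (gamma_moment \<alpha> j c)"
proof -
  let ?s = "\<alpha> + 1 + real j"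
  have s: "?s > 0" using \<alpha> by simp
  have G: "Gamma (\<alpha> + 1) > 0" using \<alpha> by (intro Gamma_real_pos) simp
  have "(\<integral>\<^sup>+x. ennreal (exp (- (c * x)) * x ^ j) \<partial>gamma_measure \<alpha>) =
      (\<integral>\<^sup>+x. ennreal (1 / Gamma (\<alpha> + 1)) * ennreal (indicator {0<..} x * (x powr (?s - 1) * exp (- ((1 + c) * x)))) \<partial>lborel)"
    unfolding gamma_measure_def
    by (subst nn_integral_density)
       (use G in \<open>auto intro!: nn_integral_cong arg_cong[where f=ennreal] simp: indicator_def powr_add powr_realpow
           distrib_right exp_add exp_diff exp_minus field_simps simp flip: ennreal_mult\<close>)
  also have "\<dots> = ennreal (1 / Gamma (\<alpha> + 1)) * ennreal (Gamma ?s * (1 + c) powr (- ?s))"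
    by (subst nn_integral_cmult, measurable) (use nn_integral_powr_exp[OF s, of "1 + c"] c in simp)
  also have "\<dots> = ennreal (gamma_moment \<alpha> j c)"
  proof -
    have "\<alpha> + 1 \<notin> \<int>\<^sub>\<le>\<^sub>0" using \<alpha> by (auto elim!: nonpos_Ints_cases)
    hence "Gamma ?s = pochhammer (\<alpha> + 1) j * Gamma (\<alpha> + 1)"
      using G by (simp add: pochhammer_Gamma)
    thus ?thesis using G Gamma_real_pos[OF s]
      by (subst ennreal_mult[symmetric]) (auto simp: gamma_moment_def)
  qed
  finally have nn: "(\<integral>\<^sup>+x. ennreal (exp (- (c * x)) * x ^ j) \<partial>gamma_measure \<alpha>) = ennreal (gamma_moment \<alpha> j c)" .
  show ?thesis
  proof (rule has_bochner_integral_nn_integral)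
    show "AE x in gamma_measure \<alpha>. 0 \<le> exp (- (c * x)) * x ^ j"
      using AE_gamma_measure_pos by eventually_elim auto
    show "0 \<le> gamma_moment \<alpha> j c" using \<alpha> by (simp add: gamma_moment_def pochhammer_nonneg)
  qed (use nn in auto)
qed

definition gamma_laplace :: "real \<Rightarrow> real \<Rightarrow> (real \<Rightarrow> real) \<Rightarrow> real" where
  "gamma_laplace \<alpha> c f = (LINT x|gamma_measure \<alpha>. exp (- (c * x)) * f x)"

lemma powr_shift_derivative:
  "- 1 < c \<Longrightarrow> ((\<lambda>c. (1 + c) powr a) has_real_derivative a * (1 + c) powr (a - 1)) (at c)" for c :: real
  by (rule DERIV_cong[OF DERIV_chain2[OF has_real_derivative_powr]]) (auto intro!: derivative_eq_intros)

text \<open>For a polynomial the transform is a finite combination of explicit moments, so it is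
  differentiated termwise and no limit is exchanged with an integral.\<close>

lemma gamma_laplace_polynomial:
  assumes \<alpha>: "0 \<le> \<alpha>" and c: "- 1 < c" and f: "real_polynomial_function f"
  shows integrable_exp_polynomial: "integrable (gamma_measure \<alpha>) (\<lambda>x. exp (- (c * x)) * f x)"
    and gamma_laplace_derivative:
      "((\<lambda>c. gamma_laplace \<alpha> c f) has_real_derivative - gamma_laplace \<alpha> c (\<lambda>x. x * f x)) (at c)"
proof -
  obtain a n where f_eq: "f = (\<lambda>x. \<Sum>i\<le>n. a i * x ^ i)"
    using f real_polynomial_function_iff_sum by blast
  \<comment> \<open>The shift \<open>k\<close> serves both \<open>f\<close> (with 0) and x times
    \<open>f\<close> (with 1).\<close>
  have hb: "has_bochner_integral (gamma_measure \<alpha>) (\<lambda>x. exp (- (c * x)) * (\<Sum>i\<le>n. a i * x ^ (i + k)))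
      (\<Sum>i\<le>n. a i * gamma_moment \<alpha> (i + k) c)" if "-1 < c" for c k
  proof -
    have "has_bochner_integral (gamma_measure \<alpha>) (\<lambda>x. \<Sum>i\<le>n. a i * (exp (- (c * x)) * x ^ (i + k)))
      (\<Sum>i\<le>n. a i * gamma_moment \<alpha> (i + k) c)"
      by (intro has_bochner_integral_sum has_bochner_integral_mult_right gamma_measure_moment[OF \<alpha> that])
    thus ?thesis by (simp add: sum_distrib_left mult_ac)
  qed
  show "integrable (gamma_measure \<alpha>) (\<lambda>x. exp (- (c * x)) * f x)"
    using hb[OF c, of 0] by (auto simp: f_eq dest: integrable.intros)
  have L: "gamma_laplace \<alpha> c f = (\<Sum>i\<le>n. a i * gamma_moment \<alpha> i c)" if "-1 < c" for c
    using hb[OF that, of 0] by (simp add: gamma_laplace_def f_eq has_bochner_integral_integral_eq)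
  have "(\<lambda>x. x * f x) = (\<lambda>x. \<Sum>i\<le>n. a i * x ^ (i + 1))"
    by (simp add: f_eq sum_distrib_left mult_ac)
  hence Lx: "gamma_laplace \<alpha> c (\<lambda>x. x * f x) = (\<Sum>i\<le>n. a i * gamma_moment \<alpha> (i + 1) c)"
    using hb[OF c, of 1] by (simp add: gamma_laplace_def has_bochner_integral_integral_eq)
  have dm: "(gamma_moment \<alpha> i has_real_derivative - gamma_moment \<alpha> (i + 1) c) (at c)" for i
  proof -
    have e: "- (\<alpha> + 1 + real i) - 1 = - (\<alpha> + 1 + real (i + 1))" by simp
    show ?thesis unfolding gamma_moment_def
      by (rule DERIV_cong[OF DERIV_cmult[OF powr_shift_derivative[OF c]]]) (simp only: e, simp add: pochhammer_Suc algebra_simps)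
  qed
  have "((\<lambda>c. \<Sum>i\<le>n. a i * gamma_moment \<alpha> i c) has_real_derivative (\<Sum>i\<le>n. a i * - gamma_moment \<alpha> (i + 1) c)) (at c)"
    by (intro DERIV_sum DERIV_cmult dm)
  also have "(\<Sum>i\<le>n. a i * - gamma_moment \<alpha> (i + 1) c) = - gamma_laplace \<alpha> c (\<lambda>x. x * f x)"
    by (simp add: Lx sum_negf)
  finally show "((\<lambda>c. gamma_laplace \<alpha> c f) has_real_derivative - gamma_laplace \<alpha> c (\<lambda>x. x * f x)) (at c)"
    by (rule has_field_derivative_transform_within_open[of _ _ _ "{-1<..}"]) (use c L in auto)
qed

text \<open>These are (-1)^n times the classical Laguerre polynomials of parameter \<alpha>, divided
  by \<open>lag_c \<alpha> n\<close>; the sign makes the off-diagonal coefficients positive. Only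
  the recurrence is used below.\<close>

fun lag_poly :: "real \<Rightarrow> nat \<Rightarrow> real \<Rightarrow> real" where
  "lag_poly \<alpha> 0 x = 1"
| "lag_poly \<alpha> (Suc 0) x = (x - jac_b \<alpha> 0) / jac_a \<alpha> 1"
| "lag_poly \<alpha> (Suc (Suc n)) x =
     ((x - jac_b \<alpha> (Suc n)) * lag_poly \<alpha> (Suc n) x - jac_a \<alpha> (Suc n) * lag_poly \<alpha> n x) / jac_a \<alpha> (Suc (Suc n))"

lemma lag_poly_recurrence:
  assumes "0 \<le> \<alpha>"
  shows "jac_a \<alpha> n * lag_poly \<alpha> (n - 1) x + jac_b \<alpha> n * lag_poly \<alpha> n x + jac_a \<alpha> (Suc n) * lag_poly \<alpha> (Suc n) x
    = x * lag_poly \<alpha> n x"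
  using jac_a_pos[OF assms, of n] by (cases n) (auto simp: field_simps)

lemma lag_poly_polynomial: "real_polynomial_function (lag_poly \<alpha> n)"
proof (induction n rule: less_induct)
  case (less n)
  note intros = real_polynomial_function.intros(2-4) real_polynomial_function_diff
    real_polynomial_function.intros(1)[OF bounded_linear_ident]
  consider "n = 0" | "n = Suc 0" | k where "n = Suc (Suc k)" by (metis not0_implies_Suc)
  thus ?case
  proof cases
    case 1
    have "lag_poly \<alpha> 0 = (\<lambda>x. 1)" by auto
    thus ?thesis using 1 by (simp add: intros(1))
  next
    case 2
    have "lag_poly \<alpha> (Suc 0) = (\<lambda>x. (x - jac_b \<alpha> 0) * (1 / jac_a \<alpha> 1))" by auto
    thus ?thesis using 2 by (simp only:) (intro intros)
  next
    case 3
    have "lag_poly \<alpha> n = (\<lambda>x. ((x - jac_b \<alpha> (Suc k)) * lag_poly \<alpha> (Suc k) x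
        - jac_a \<alpha> (Suc k) * lag_poly \<alpha> k x) * (1 / jac_a \<alpha> (Suc (Suc k))))"
      using 3 by auto
    moreover have "real_polynomial_function (lag_poly \<alpha> k)" "real_polynomial_function (lag_poly \<alpha> (Suc k))"
      using less.IH 3 by auto
    ultimately show ?thesis by (simp only:) (intro intros)
  qed
qed

lemma gamma_laplace_lincomb:
  assumes "0 \<le> \<alpha>" "- 1 < c" "real_polynomial_function f" "real_polynomial_function g"
  shows "gamma_laplace \<alpha> c (\<lambda>x. a * f x + b * g x) = a * gamma_laplace \<alpha> c f + b * gamma_laplace \<alpha> c g"
proof -
  note i = integrable_exp_polynomial[OF assms(1,2)]
  have "gamma_laplace \<alpha> c (\<lambda>x. a * f x + b * g x) =
      (LINT x|gamma_measure \<alpha>. a * (exp (- (c * x)) * f x) + b * (exp (- (c * x)) * g x))"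
    by (simp add: gamma_laplace_def algebra_simps)
  also have "\<dots> = a * gamma_laplace \<alpha> c f + b * gamma_laplace \<alpha> c g"
    using i[OF assms(3)] i[OF assms(4)] by (simp add: gamma_laplace_def)
  finally show ?thesis .
qed

definition lag_laplace :: "real \<Rightarrow> nat \<Rightarrow> real \<Rightarrow> real" where
  "lag_laplace \<alpha> n c = lag_c \<alpha> n * (- c / (1 + c)) ^ n * (1 + c) powr (- (\<alpha> + 1))"

text \<open>Real counterpart of \<open>lag_psi_ode\<close>: the operator -d/dc corresponds to
  multiplication by x, hence to the Jacobi matrix.\<close>

lemma lag_laplace_derivative:
  assumes \<alpha>: "0 \<le> \<alpha>" and c: "- 1 < c"
  shows "(lag_laplace \<alpha> n has_real_derivative
     - (jac_a \<alpha> n * lag_laplace \<alpha> (n - 1) c + jac_b \<alpha> n * lag_laplace \<alpha> n c + jac_a \<alpha> (Suc n) * lag_laplace \<alpha> (Suc n) c)) (at c)"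
proof -
  define z r h where "z = 1 + c" and "r = - c / (1 + c)" and "h = (1 + c) powr (- (\<alpha> + 1))"
  have z: "z > 0" using c by (simp add: z_def)
  have r1: "1 + r = 1 / z" using z by (simp add: r_def z_def field_simps)
  have d1: "((\<lambda>c. - c / (1 + c)) has_real_derivative - 1 / z\<^sup>2) (at c)"
    using z by (auto intro!: derivative_eq_intros simp: z_def field_simps power2_eq_square)
  have d2: "((\<lambda>c. (1 + c) powr (- (\<alpha> + 1))) has_real_derivative (- (\<alpha> + 1)) * (h / z)) (at c)"
    using DERIV_cong[OF powr_shift_derivative[OF c, of "- (\<alpha> + 1)"]] z
    by (simp add: z_def h_def powr_diff[of _ "- (\<alpha> + 1)" 1, simplified])
  have "(lag_laplace \<alpha> n has_real_derivative lag_c \<alpha> n *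
      (real n * r ^ (n - 1) * (- 1 / z\<^sup>2) * h + (- (\<alpha> + 1)) * (h / z) * r ^ n)) (at c)"
    unfolding lag_laplace_def mult.assoc[of "lag_c \<alpha> n"]
    by (rule DERIV_cmult, rule DERIV_cong[OF DERIV_mult[OF DERIV_power[OF d1, of n] d2]]) (simp add: h_def r_def)
  moreover have "lag_c \<alpha> n * (real n * r ^ (n - 1) * (- 1 / z\<^sup>2) * h + (- (\<alpha> + 1)) * (h / z) * r ^ n)
    = - (jac_a \<alpha> n * lag_laplace \<alpha> (n - 1) c + jac_b \<alpha> n * lag_laplace \<alpha> n c + jac_a \<alpha> (Suc n) * lag_laplace \<alpha> (Suc n) c)"
  proof -
    have l: "lag_laplace \<alpha> j c = lag_c \<alpha> j * r ^ j * h" for j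
      by (simp add: lag_laplace_def r_def h_def)
    have "jac_a \<alpha> n * lag_laplace \<alpha> (n - 1) c + jac_b \<alpha> n * lag_laplace \<alpha> n c + jac_a \<alpha> (Suc n) * lag_laplace \<alpha> (Suc n) c
      = h * (jac_a \<alpha> n * (lag_c \<alpha> (n - 1) * r ^ (n - 1)) + jac_b \<alpha> n * (lag_c \<alpha> n * r ^ n)
       + jac_a \<alpha> (Suc n) * (lag_c \<alpha> (Suc n) * r ^ Suc n))"
      unfolding l by (simp only: algebra_simps)
    also have "\<dots> = h * (lag_c \<alpha> n * (real n * r ^ (n - 1) * (1 / z)\<^sup>2 + (\<alpha> + 1) * r ^ n * (1 / z)))"
      using jacobi_geometric[OF \<alpha>, of n r] r1 by simp
    finally show ?thesis by (simp add: power_divide algebra_simps)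
  qed
  ultimately show ?thesis by simp
qed

text \<open>Differentiating the transform of P_k gives that of x P_k. In the recurrence for x P_k
  everything except P_(k+1) is known by induction, and \<open>lag_laplace_derivative\<close> shows
  that the formula solves the same relation.\<close>

lemma gamma_laplace_lag_poly:
  assumes \<alpha>: "0 \<le> \<alpha>"
  shows "- 1 < c \<Longrightarrow> gamma_laplace \<alpha> c (lag_poly \<alpha> n) = lag_laplace \<alpha> n c"
proof (induction n arbitrary: c rule: less_induct)
  case (less n)
  show ?case
  proof (cases n)
    case 0
    have "lag_poly \<alpha> 0 = (\<lambda>x. 1)" by auto
    thus ?thesis
      using has_bochner_integral_integral_eq[OF gamma_measure_moment[OF \<alpha> less.prems, of 0]]
      by (simp add: 0 gamma_laplace_def lag_laplace_def gamma_moment_def)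
  next
    case (Suc k)
    let ?L = "gamma_laplace \<alpha> c"
    have k: "\<And>c. -1 < c \<Longrightarrow> gamma_laplace \<alpha> c (lag_poly \<alpha> k) = lag_laplace \<alpha> k c"
      using less.IH[of k] Suc by auto
    \<comment> \<open>For \<open>k = 0\<close> there is no predecessor; the coefficient
      \<open>jac_a \<alpha> 0 = 0\<close> makes the equation trivial.\<close>
    have k1: "jac_a \<alpha> k * ?L (lag_poly \<alpha> (k - 1)) = jac_a \<alpha> k * lag_laplace \<alpha> (k - 1) c"
      using less.IH[of "k - 1" c] less.prems Suc by (cases k) auto
    note P = lag_poly_polynomial
    have "((\<lambda>c. gamma_laplace \<alpha> c (lag_poly \<alpha> k)) has_real_derivative - ?L (\<lambda>x. x * lag_poly \<alpha> k x)) (at c)"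
      by (rule gamma_laplace_derivative[OF \<alpha> less.prems P])
    hence "(lag_laplace \<alpha> k has_real_derivative - ?L (\<lambda>x. x * lag_poly \<alpha> k x)) (at c)"
      by (rule has_field_derivative_transform_within_open[of _ _ _ "{-1<..}"]) (use less.prems k in auto)
    from DERIV_unique[OF this lag_laplace_derivative[OF \<alpha> less.prems]]
    have x: "?L (\<lambda>x. x * lag_poly \<alpha> k x) =
       jac_a \<alpha> k * lag_laplace \<alpha> (k - 1) c + jac_b \<alpha> k * lag_laplace \<alpha> k c + jac_a \<alpha> (Suc k) * lag_laplace \<alpha> (Suc k) c"
      by simp
    have "(\<lambda>x. x * lag_poly \<alpha> k x) = (\<lambda>x. 1 * (jac_a \<alpha> k * lag_poly \<alpha> (k - 1) x + jac_b \<alpha> k * lag_poly \<alpha> k x) + jac_a \<alpha> (Suc k) * lag_poly \<alpha> (Suc k) x)"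
      using lag_poly_recurrence[OF \<alpha>, of k] by auto
    hence "?L (\<lambda>x. x * lag_poly \<alpha> k x) =
        jac_a \<alpha> k * ?L (lag_poly \<alpha> (k - 1)) + jac_b \<alpha> k * ?L (lag_poly \<alpha> k) + jac_a \<alpha> (Suc k) * ?L (lag_poly \<alpha> (Suc k))"
      using gamma_laplace_lincomb[OF \<alpha> less.prems real_polynomial_function.intros(3)[OF
            real_polynomial_function.intros(4)[OF real_polynomial_function.intros(2) P]
            real_polynomial_function.intros(4)[OF real_polynomial_function.intros(2) P]] P,
          of 1 "jac_a \<alpha> k" \<alpha> "k - 1" "jac_b \<alpha> k" \<alpha> k "jac_a \<alpha> (Suc k)" \<alpha> "Suc k"]
        gamma_laplace_lincomb[OF \<alpha> less.prems P P]
      by (simp only: mult_1)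
    hence "jac_a \<alpha> (Suc k) * ?L (lag_poly \<alpha> (Suc k)) = jac_a \<alpha> (Suc k) * lag_laplace \<alpha> (Suc k) c"
      using x k1 unfolding k[OF less.prems] by linarith
    thus ?thesis using jac_a_pos[OF \<alpha>, of k] Suc by simp
  qed
qed

lemma integrable_polynomial:
  assumes "0 \<le> \<alpha>" "real_polynomial_function f"
  shows "integrable (gamma_measure \<alpha>) f"
  using integrable_exp_polynomial[OF assms(1) _ assms(2), of 0] by simp

text \<open>The case m = 0 is the transform at c = 0, where (- c / (1 + c))^n vanishes for n > 0.
  The step raises m by the symmetry of multiplication by x.\<close>

lemma lag_poly_orthonormal:
  assumes \<alpha>: "0 \<le> \<alpha>"
  shows "(LINT x|gamma_measure \<alpha>. lag_poly \<alpha> n x * lag_poly \<alpha> m x) = (if n = m then 1 else 0)"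
proof (induction m arbitrary: n rule: less_induct)
  case (less m)
  define I where "I n m = (LINT x|gamma_measure \<alpha>. lag_poly \<alpha> n x * lag_poly \<alpha> m x)" for n m
  note P = lag_poly_polynomial
  have int: "integrable (gamma_measure \<alpha>) (\<lambda>x. lag_poly \<alpha> n x * lag_poly \<alpha> m x)" for n m
    by (intro integrable_polynomial \<alpha> real_polynomial_function.intros(4) P)
  have exp: "(LINT x|gamma_measure \<alpha>. x * lag_poly \<alpha> n x * lag_poly \<alpha> m x) = jac_a \<alpha> n * I (n - 1) m + jac_b \<alpha> n * I n m + jac_a \<alpha> (Suc n) * I (Suc n) m" for n m
  proof -
    have "(LINT x|gamma_measure \<alpha>. x * lag_poly \<alpha> n x * lag_poly \<alpha> m x) =
       (LINT x|gamma_measure \<alpha>. jac_a \<alpha> n * (lag_poly \<alpha> (n - 1) x * lag_poly \<alpha> m x) + jac_b \<alpha> n * (lag_poly \<alpha> n x * lag_poly \<alpha> m x)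
        + jac_a \<alpha> (Suc n) * (lag_poly \<alpha> (Suc n) x * lag_poly \<alpha> m x))"
      unfolding lag_poly_recurrence[OF \<alpha>, symmetric] by (simp add: algebra_simps)
    also have "\<dots> = jac_a \<alpha> n * I (n - 1) m + jac_b \<alpha> n * I n m + jac_a \<alpha> (Suc n) * I (Suc n) m"
      using int[of n m] int[of "n - 1" m] int[of "Suc n" m] by (simp add: I_def)
    finally show ?thesis .
  qed
  have sym: "I n m = I m n" for n m by (simp add: I_def mult.commute)
  show ?case
  proof (cases m)
    case 0
    have "I n 0 = gamma_laplace \<alpha> 0 (lag_poly \<alpha> n)" by (simp add: I_def gamma_laplace_def)
    also have "\<dots> = (if n = 0 then 1 else 0)"
      by (subst gamma_laplace_lag_poly[OF \<alpha>]) (auto simp: lag_laplace_def)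
    finally show ?thesis using 0 by (simp add: I_def)
  next
    case (Suc k)
    have Ik: "I n k = (if n = k then 1 else 0)" for n
      using less.IH[of k n] Suc by (simp add: I_def)
    have Ik1: "jac_a \<alpha> k * I n (k - 1) = jac_a \<alpha> k * (if n = k - 1 then 1 else 0)"
      using less.IH[of "k - 1" n] Suc by (cases k) (auto simp: I_def)
    \<comment> \<open>Both sides are the integral of x P_k P_n, with the recurrence applied to one
      or the other factor.\<close>
    have "jac_a \<alpha> k * I (k - 1) n + jac_b \<alpha> k * I k n + jac_a \<alpha> (Suc k) * I (Suc k) n =
       jac_a \<alpha> n * I (n - 1) k + jac_b \<alpha> n * I n k + jac_a \<alpha> (Suc n) * I (Suc n) k"
      using exp[of k n] exp[of n k] by (simp add: mult_ac)
    hence "jac_a \<alpha> (Suc k) * I n (Suc k) = jac_a \<alpha> n * I (n - 1) k + jac_b \<alpha> n * I n k + jac_a \<alpha> (Suc n) * I (Suc n) k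
       - jac_b \<alpha> k * I n k - jac_a \<alpha> k * I n (k - 1)"
      by (simp add: sym)
    also have "\<dots> = jac_a \<alpha> (Suc k) * (if n = Suc k then 1 else 0)"
      unfolding Ik Ik1 by (cases n; cases k) auto
    finally have "I n (Suc k) = (if n = Suc k then 1 else 0)" using jac_a_pos[OF \<alpha>, of k] by simp
    thus ?thesis using Suc by (simp add: I_def)
  qed
qed

section \<open>Completeness of the orthonormal polynomials\<close>

locale laguerre_weight =
  fixes \<alpha> :: real
  assumes \<alpha>: "0 \<le> \<alpha>"
begin

abbreviation "\<rho> \<equiv> gamma_measure \<alpha>"
abbreviation "P \<equiv> lag_poly \<alpha>"

lemma measurable_\<rho> [simp]: "measurable \<rho> N = measurable borel N"
  by (rule measurable_cong_sets) auto

lemma finite_measure_\<rho>: "finite_measure \<rho>"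
proof
  have "integrable \<rho> (\<lambda>x. 1 :: real)"
    using integrable_polynomial[OF \<alpha> real_polynomial_function.intros(2), of 1] .
  thus "emeasure \<rho> (space \<rho>) \<noteq> \<infinity>" by (simp add: integrable_iff_bounded)
qed

definition L2 :: "(real \<Rightarrow> real) \<Rightarrow> bool" where
  "L2 f \<longleftrightarrow> f \<in> borel_measurable borel \<and> integrable \<rho> (\<lambda>x. (f x)\<^sup>2)"

definition ip :: "(real \<Rightarrow> real) \<Rightarrow> (real \<Rightarrow> real) \<Rightarrow> real" where
  "ip f g = (LINT x|\<rho>. f x * g x)"

lemma L2_mult_integrable:
  assumes "L2 f" "L2 g"
  shows "integrable \<rho> (\<lambda>x. f x * g x)"
proof (rule Bochner_Integration.integrable_bound)
  show "integrable \<rho> (\<lambda>x. (f x)\<^sup>2 + (g x)\<^sup>2)" using assms by (auto simp: L2_def)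
  show "(\<lambda>x. f x * g x) \<in> borel_measurable \<rho>" using assms by (auto simp: L2_def)
  have "\<bar>f x * g x\<bar> \<le> (f x)\<^sup>2 + (g x)\<^sup>2" for x
    using sum_squares_bound[of "\<bar>f x\<bar>" "\<bar>g x\<bar>"] mult_nonneg_nonneg[of "\<bar>f x\<bar>" "\<bar>g x\<bar>"]
    by (simp add: abs_mult del: mult_nonneg_nonneg)
  thus "AE x in \<rho>. norm (f x * g x) \<le> norm ((f x)\<^sup>2 + (g x)\<^sup>2)" by auto
qed

lemma L2_lincomb:
  assumes "L2 f" "L2 g" shows "L2 (\<lambda>x. a * f x + b * g x)"
proof -
  have "integrable \<rho> (\<lambda>x. a\<^sup>2 * (f x)\<^sup>2 + (2 * a * b) * (f x * g x) + b\<^sup>2 * (g x)\<^sup>2)"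
    using assms L2_mult_integrable[OF assms] by (auto simp: L2_def)
  moreover have "(\<lambda>x. a\<^sup>2 * (f x)\<^sup>2 + (2 * a * b) * (f x * g x) + b\<^sup>2 * (g x)\<^sup>2) = (\<lambda>x. (a * f x + b * g x)\<^sup>2)"
    by (auto simp: power2_eq_square algebra_simps)
  ultimately show ?thesis using assms by (auto simp: L2_def)
qed

lemma ip_lincomb_left:
  assumes "L2 f" "L2 g" "L2 h"
  shows "ip (\<lambda>x. a * f x + b * g x) h = a * ip f h + b * ip g h"
proof -
  have "ip (\<lambda>x. a * f x + b * g x) h = (LINT x|\<rho>. a * (f x * h x) + b * (g x * h x))"
    by (simp add: ip_def algebra_simps)
  thus ?thesis using L2_mult_integrable[OF assms(1,3)] L2_mult_integrable[OF assms(2,3)]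
    by (simp add: ip_def)
qed

lemma ip_commute: "ip f g = ip g f"
  by (simp add: ip_def mult.commute)

lemma ip_lincomb_right:
  "L2 f \<Longrightarrow> L2 g \<Longrightarrow> L2 h \<Longrightarrow> ip h (\<lambda>x. a * f x + b * g x) = a * ip h f + b * ip h g"
  using ip_lincomb_left[of f g h a b] by (simp add: ip_commute)

lemma L2_zero: "L2 (\<lambda>x. 0)" by (simp add: L2_def)

lemma L2_P: "L2 (P n)"
proof -
  have "integrable \<rho> (\<lambda>x. P n x * P n x)"
    by (intro integrable_polynomial \<alpha> real_polynomial_function.intros(4) lag_poly_polynomial)
  moreover have "P n \<in> borel_measurable borel"
    using lag_poly_polynomial[of \<alpha> n]
    by (intro borel_measurable_continuous_onI continuous_on_polymonial_function) (simp add: real_polynomial_function_eq)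
  ultimately show ?thesis by (simp add: L2_def power2_eq_square)
qed

lemma ip_P: "ip (P n) (P m) = (if n = m then 1 else 0)"
  by (simp add: ip_def lag_poly_orthonormal[OF \<alpha>])

definition comb :: "nat \<Rightarrow> (nat \<Rightarrow> real) \<Rightarrow> real \<Rightarrow> real" where
  "comb N c x = (\<Sum>k<N. c k * P k x)"

lemma comb_Suc: "comb (Suc N) c = (\<lambda>x. 1 * comb N c x + c N * P N x)"
  by (auto simp: comb_def)

lemma L2_comb: "L2 (comb N c)"
proof (induction N)
  case 0
  have "comb 0 c = (\<lambda>x. 0)" by (auto simp: comb_def)
  thus ?case by (simp add: L2_zero)
next
  case (Suc N)
  show ?case unfolding comb_Suc by (rule L2_lincomb[OF Suc L2_P])
qed

lemma ip_comb: "L2 f \<Longrightarrow> ip f (comb N c) = (\<Sum>k<N. c k * ip f (P k))"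
proof (induction N)
  case 0
  have "comb 0 c = (\<lambda>x. 0)" by (auto simp: comb_def)
  thus ?case by (simp add: ip_def)
next
  case (Suc N)
  thus ?case unfolding comb_Suc by (subst ip_lincomb_right[OF L2_comb L2_P]) auto
qed

lemma ip_comb_comb: "ip (comb N c) (comb N c) = (\<Sum>k<N. (c k)\<^sup>2)"
proof -
  have "ip (comb N c) (P k) = c k" if "k < N" for k
    using that by (simp add: ip_commute[of "comb N c" "P k"] ip_comb[OF L2_P] ip_P if_distrib sum.delta cong: if_cong)
  thus ?thesis by (simp add: ip_comb[OF L2_comb] power2_eq_square)
qed

definition dist2 :: "(real \<Rightarrow> real) \<Rightarrow> (real \<Rightarrow> real) \<Rightarrow> real" where
  "dist2 f g = (LINT x|\<rho>. (f x - g x)\<^sup>2)"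

text \<open>Completing the square: the distance splits into the Bessel defect and the deviation of
  the coefficients from the Fourier coefficients.\<close>

lemma dist2_comb:
  assumes "L2 f"
  shows "dist2 f (comb N c) = ip f f - (\<Sum>k<N. (ip f (P k))\<^sup>2) + (\<Sum>k<N. (c k - ip f (P k))\<^sup>2)"
proof -
  have "dist2 f (comb N c) = ip (\<lambda>x. 1 * f x + (- 1) * comb N c x) (\<lambda>x. 1 * f x + (- 1) * comb N c x)"
    by (simp add: dist2_def ip_def power2_eq_square)
  also have "\<dots> = ip f f - 2 * ip f (comb N c) + ip (comb N c) (comb N c)"
    unfolding ip_lincomb_left[OF assms L2_comb L2_lincomb[OF assms L2_comb]]
      ip_lincomb_right[OF assms L2_comb assms] ip_lincomb_right[OF assms L2_comb L2_comb]
    by (simp add: ip_commute[of "comb N c" f])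
  also have "\<dots> = ip f f - (\<Sum>k<N. (ip f (P k))\<^sup>2) + (\<Sum>k<N. (c k - ip f (P k))\<^sup>2)"
    by (simp add: ip_comb[OF assms] ip_comb_comb power2_diff sum.distrib sum_subtractf sum_distrib_left algebra_simps)
  finally show ?thesis .
qed

lemma dist2_triangle:
  assumes "L2 f" "L2 g" "L2 h"
  shows "dist2 f h \<le> 2 * dist2 f g + 2 * dist2 g h"
proof -
  have i: "integrable \<rho> (\<lambda>x. (u x - v x)\<^sup>2)" if "L2 u" "L2 v" for u v
    using L2_lincomb[OF that, of 1 "-1"] by (simp add: L2_def)
  have "dist2 f h \<le> (LINT x|\<rho>. 2 * (f x - g x)\<^sup>2 + 2 * (g x - h x)\<^sup>2)"
    unfolding dist2_def
  proof (rule integral_mono)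
    fix x
    show "(f x - h x)\<^sup>2 \<le> 2 * (f x - g x)\<^sup>2 + 2 * (g x - h x)\<^sup>2"
      using zero_le_power2[of "(f x - g x) - (g x - h x)"] by (simp add: power2_eq_square algebra_simps)
  qed (use i assms in auto)
  also have "\<dots> = 2 * dist2 f g + 2 * dist2 g h"
    using i[OF assms(1,2)] i[OF assms(2,3)] by (simp add: dist2_def)
  finally show ?thesis .
qed

text \<open>Membership in the closed span of the \<open>P n\<close>. Stated by approximation with
  free coefficients, it is easily closed under limits and combinations before completeness is
  known.\<close>

definition approx :: "(real \<Rightarrow> real) \<Rightarrow> bool" where
  "approx f \<longleftrightarrow> L2 f \<and> (\<forall>\<epsilon>>0. \<exists>N c. dist2 f (comb N c) < \<epsilon>)"

lemma approxD: "approx f \<Longrightarrow> L2 f"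
  by (simp add: approx_def)

lemma approx_limit:
  assumes "L2 f" "\<And>\<epsilon>. \<epsilon> > 0 \<Longrightarrow> \<exists>g. approx g \<and> dist2 f g < \<epsilon>"
  shows "approx f"
  unfolding approx_def
proof (intro conjI allI impI)
  fix \<epsilon> :: real assume "\<epsilon> > 0"
  then obtain g where g: "approx g" "dist2 f g < \<epsilon> / 4" using assms(2)[of "\<epsilon> / 4"] by auto
  then obtain N c where "dist2 g (comb N c) < \<epsilon> / 4" using \<open>\<epsilon> > 0\<close> by (auto simp: approx_def dest: spec[of _ "\<epsilon>/4"])
  with g(2) dist2_triangle[OF assms(1) approxD[OF g(1)] L2_comb, of N c]
  have "dist2 f (comb N c) < \<epsilon>" by simp
  thus "\<exists>N c. dist2 f (comb N c) < \<epsilon>" by blast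
qed fact

text \<open>Fourier coefficients are optimal by \<open>dist2_comb\<close>. The backward direction
  lets an explicit series certify that exponentials are in the closure; the forward one yields
  Parseval once everything is.\<close>

lemma approx_iff_parseval: "approx f \<longleftrightarrow> L2 f \<and> (\<lambda>k. (ip f (P k))\<^sup>2) sums ip f f"
proof (intro iffI conjI)
  assume f: "approx f"
  show L: "L2 f" using f by (rule approxD)
  let ?s = "\<lambda>N. \<Sum>k<N. (ip f (P k))\<^sup>2"
  show "(\<lambda>k. (ip f (P k))\<^sup>2) sums ip f f"
    unfolding sums_def
  proof (rule LIMSEQ_I)
    fix \<epsilon> :: real assume "\<epsilon> > 0"
    then obtain N c where "dist2 f (comb N c) < \<epsilon>" using f by (auto simp: approx_def)
    moreover have "(\<Sum>k<N. (c k - ip f (P k))\<^sup>2) \<ge> 0" by (intro sum_nonneg) auto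
    ultimately have N: "ip f f - ?s N < \<epsilon>" using dist2_comb[OF L, of N c] by linarith
    have upper: "?s n \<le> ip f f" for n
    proof -
      have "0 \<le> dist2 f (comb n (\<lambda>k. ip f (P k)))" by (simp add: dist2_def integral_nonneg_AE)
      thus ?thesis using dist2_comb[OF L, of n "\<lambda>k. ip f (P k)"] by simp
    qed
    show "\<exists>n0. \<forall>n\<ge>n0. norm (?s n - ip f f) < \<epsilon>"
    proof (intro exI allI impI)
      fix n assume "N \<le> n"
      hence "?s N \<le> ?s n" by (intro sum_mono2) auto
      thus "norm (?s n - ip f f) < \<epsilon>" using N upper[of n] by simp
    qed
  qed
next
  assume *: "L2 f \<and> (\<lambda>k. (ip f (P k))\<^sup>2) sums ip f f"
  show "approx f" unfolding approx_def
  proof (intro conjI allI impI)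
    fix \<epsilon> :: real assume "\<epsilon> > 0"
    with * obtain N where "norm ((\<Sum>k<N. (ip f (P k))\<^sup>2) - ip f f) < \<epsilon>"
      unfolding sums_def by (meson LIMSEQ_D order_refl)
    hence "dist2 f (comb N (\<lambda>k. ip f (P k))) < \<epsilon>" using * by (simp add: dist2_comb abs_less_iff)
    thus "\<exists>N c. dist2 f (comb N c) < \<epsilon>" by blast
  qed (use * in simp)
qed

section \<open>Enlarging the class of functions approximated by polynomials\<close>

lemma approx_comb: "approx (comb N c)"
  unfolding approx_def by (auto intro!: L2_comb exI[of _ N] exI[of _ c] simp: dist2_def)

lemma approx_lincomb:
  assumes f: "approx f" and g: "approx g"
  shows "approx (\<lambda>x. a * f x + b * g x)"
proof -
  note L = approxD[OF f] approxD[OF g]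
  \<comment> \<open>The summand 1 keeps \<open>D\<close> positive and the final estimate strict,
    even for vanishing \<open>a\<close> and \<open>b\<close>.\<close>
  define D where "D = 2 * a\<^sup>2 + 2 * b\<^sup>2 + 1"
  have D: "D > 0" unfolding D_def by (intro add_nonneg_pos) auto
  show ?thesis unfolding approx_def
  proof (intro conjI allI impI)
    show "L2 (\<lambda>x. a * f x + b * g x)" by (rule L2_lincomb[OF L])
    fix \<epsilon> :: real assume "\<epsilon> > 0"
    hence "\<epsilon> / D > 0" using D by simp
    then obtain N c M d where nc: "dist2 f (comb N c) < \<epsilon> / D" and md: "dist2 g (comb M d) < \<epsilon> / D"
      using f g unfolding approx_def by meson
    define K where "K = max N M"
    let ?c = "\<lambda>k. if k < N then c k else 0" and ?d = "\<lambda>k. if k < M then d k else 0"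
    have c: "comb N c = comb K ?c" and d: "comb M d = comb K ?d"
      by (auto simp: comb_def K_def fun_eq_iff intro!: sum.mono_neutral_cong_left split: if_splits)
    let ?e = "\<lambda>k. a * ?c k + b * ?d k"
    have e: "comb K ?e x = a * comb N c x + b * comb M d x" for x
      unfolding c d by (simp add: comb_def sum.distrib sum_distrib_left algebra_simps)
    have i: "integrable \<rho> (\<lambda>x. (u x - v x)\<^sup>2)" if "L2 u" "L2 v" for u v
      using L2_lincomb[OF that, of 1 "-1"] by (simp add: L2_def)
    have "dist2 (\<lambda>x. a * f x + b * g x) (comb K ?e) \<le>
        (LINT x|\<rho>. 2 * a\<^sup>2 * (f x - comb N c x)\<^sup>2 + 2 * b\<^sup>2 * (g x - comb M d x)\<^sup>2)"
      unfolding dist2_def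
    proof (rule integral_mono)
      fix x
      have sq: "(p + q)\<^sup>2 \<le> 2 * p\<^sup>2 + 2 * q\<^sup>2" for p q :: real
        using zero_le_power2[of "p - q"] by (simp add: power2_eq_square algebra_simps)
      have "a * f x + b * g x - comb K ?e x = a * (f x - comb N c x) + b * (g x - comb M d x)"
        unfolding e by (simp add: algebra_simps)
      thus "(a * f x + b * g x - comb K ?e x)\<^sup>2 \<le> 2 * a\<^sup>2 * (f x - comb N c x)\<^sup>2 + 2 * b\<^sup>2 * (g x - comb M d x)\<^sup>2"
        using sq[of "a * (f x - comb N c x)" "b * (g x - comb M d x)"] by (simp add: power_mult_distrib mult.assoc)
      show "integrable \<rho> (\<lambda>x. (a * f x + b * g x - comb K ?e x)\<^sup>2)"
        by (rule i[OF L2_lincomb[OF L] L2_comb])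
    qed (use i[OF L(1) L2_comb] i[OF L(2) L2_comb] in auto)
    also have "\<dots> = 2 * a\<^sup>2 * dist2 f (comb N c) + 2 * b\<^sup>2 * dist2 g (comb M d)"
      using i[OF L(1) L2_comb] i[OF L(2) L2_comb] by (simp add: dist2_def)
    also have "\<dots> \<le> 2 * a\<^sup>2 * (\<epsilon> / D) + 2 * b\<^sup>2 * (\<epsilon> / D)"
      using nc md by (intro add_mono mult_left_mono) auto
    also have "\<dots> = (2 * a\<^sup>2 + 2 * b\<^sup>2) / D * \<epsilon>" by (simp add: add_divide_distrib algebra_simps)
    also have "\<dots> < 1 * \<epsilon>" using D \<open>\<epsilon> > 0\<close> by (intro mult_strict_right_mono) (auto simp: D_def field_simps)
    finally show "\<exists>N c. dist2 (\<lambda>x. a * f x + b * g x) (comb N c) < \<epsilon>" by auto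
  qed
qed

lemma approx_zero: "approx (\<lambda>x. 0)"
  using approx_comb[of 0 "\<lambda>k. 0"] unfolding comb_def by simp

lemma approx_sum: "finite I \<Longrightarrow> (\<And>i. i \<in> I \<Longrightarrow> approx (f i)) \<Longrightarrow> approx (\<lambda>x. \<Sum>i\<in>I. a i * f i x)"
proof (induction I rule: finite_induct)
  case (insert i I)
  thus ?case using approx_lincomb[of "f i" "\<lambda>x. \<Sum>i\<in>I. a i * f i x" "a i" 1] by simp
qed (simp add: approx_zero)

text \<open>Dominated convergence for the squared difference, with majorant (2 w)^2. Pointwise
  conditions for x > 0 suffice because the measure is carried by the positive half-line.\<close>

lemma approx_dominated_limit:
  assumes s: "\<And>n. approx (s n)" and f: "f \<in> borel_measurable borel" and w: "L2 w"
    and lim: "\<And>x. 0 < x \<Longrightarrow> (\<lambda>n. s n x) \<longlonglongrightarrow> f x" and bound: "\<And>n x. 0 < x \<Longrightarrow> \<bar>s n x\<bar> \<le> w x"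
  shows "approx f"
proof (rule approx_limit)
  have fb: "\<bar>f x\<bar> \<le> w x" if "0 < x" for x
    by (rule LIMSEQ_le_const2[OF tendsto_rabs[OF lim[OF that]]]) (use bound[OF that] in auto)
  show L: "L2 f" unfolding L2_def
  proof
    show "integrable \<rho> (\<lambda>x. (f x)\<^sup>2)"
    proof (rule Bochner_Integration.integrable_bound)
      show "integrable \<rho> (\<lambda>x. (w x)\<^sup>2)" using w by (simp add: L2_def)
      show "AE x in \<rho>. norm ((f x)\<^sup>2) \<le> norm ((w x)\<^sup>2)"
        using AE_gamma_measure_pos by eventually_elim (use fb in \<open>auto intro!: abs_le_square_iff[THEN iffD1] simp: order.trans[OF _ abs_ge_self]\<close>)
    qed (use f in simp)
  qed fact
  fix \<epsilon> :: real assume "\<epsilon> > 0"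
  have "(\<lambda>n. LINT x|\<rho>. (f x - s n x)\<^sup>2) \<longlonglongrightarrow> (LINT x|\<rho>. 0)"
  proof (rule integral_dominated_convergence[where w="\<lambda>x. 4 * (w x)\<^sup>2"])
    show "integrable \<rho> (\<lambda>x. 4 * (w x)\<^sup>2)" using w by (simp add: L2_def)
    show "(\<lambda>x. (f x - s n x)\<^sup>2) \<in> borel_measurable \<rho>" for n
      using f approxD[OF s[of n]] by (auto simp: L2_def)
    show "AE x in \<rho>. (\<lambda>n. (f x - s n x)\<^sup>2) \<longlonglongrightarrow> 0"
      using AE_gamma_measure_pos
    proof eventually_elim
      case (elim x)
      have "(\<lambda>n. (f x - s n x)\<^sup>2) \<longlonglongrightarrow> (f x - f x)\<^sup>2" by (intro tendsto_intros lim elim)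
      thus ?case by simp
    qed
    show "AE x in \<rho>. norm ((f x - s n x)\<^sup>2) \<le> 4 * (w x)\<^sup>2" for n
      using AE_gamma_measure_pos
    proof eventually_elim
      case (elim x)
      have "\<bar>f x - s n x\<bar> \<le> 2 * w x" using fb[OF elim] bound[OF elim, of n] by simp
      hence "\<bar>f x - s n x\<bar>\<^sup>2 \<le> (2 * w x)\<^sup>2" by (intro power_mono) auto
      thus ?case by (simp add: power_mult_distrib)
    qed
  qed simp
  hence "(\<lambda>n. dist2 f (s n)) \<longlonglongrightarrow> 0" by (simp add: dist2_def)
  hence "eventually (\<lambda>n. dist2 f (s n) < \<epsilon>) sequentially" by (rule order_tendstoD) fact
  thus "\<exists>g. approx g \<and> dist2 f g < \<epsilon>" using s by (auto simp: eventually_sequentially)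
qed

text \<open>For \<open>exp (- c x)\<close> Parseval's equality is the negative binomial series.\<close>

lemma approx_exp:
  assumes c: "0 \<le> c"
  shows "approx (\<lambda>x. exp (- (c * x)))"
proof -
  have c1: "-1 < c" "-1 < 2 * c" using c by auto
  have sq: "(\<lambda>x. exp (- (c * x)) * exp (- (c * x))) = (\<lambda>x. exp (- (2 * c * x)))"
    by (simp add: exp_add[symmetric] mult_ac)
  have hb: "has_bochner_integral \<rho> (\<lambda>x. exp (- (2 * c * x))) ((1 + 2 * c) powr (- (\<alpha> + 1)))"
    using gamma_measure_moment[OF \<alpha> c1(2), of 0] by (simp add: gamma_moment_def)
  have L: "L2 (\<lambda>x. exp (- (c * x)))"
    using hb unfolding L2_def power2_eq_square sq by (auto dest: integrable.intros)
  have ip: "ip (\<lambda>x. exp (- (c * x))) (P k) = lag_laplace \<alpha> k c" for k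
    using gamma_laplace_lag_poly[OF \<alpha> c1(1), of k] by (simp add: gamma_laplace_def ip_def)
  have ipe: "ip (\<lambda>x. exp (- (c * x))) (\<lambda>x. exp (- (c * x))) = (1 + 2 * c) powr (- (\<alpha> + 1))"
    unfolding ip_def sq using hb by (rule has_bochner_integral_integral_eq)
  \<comment> \<open>The ratio that appears on squaring \<open>lag_laplace\<close>. Since (1 - ?q) (1
    + c)^2 = 1 + 2 c, the series sums to the squared norm of the exponential.\<close>
  let ?q = "c\<^sup>2 / (1 + c)\<^sup>2"
  have q: "?q < 1" using c by (simp add: power_strict_mono)
  have "(\<lambda>k. (lag_c \<alpha> k)\<^sup>2 * ?q ^ k) sums (1 - ?q) powr (- (\<alpha> + 1))"
    by (rule negative_binomial_sums[OF \<alpha>]) (use q in simp)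
  from sums_mult2[OF this, of "(1 + c) powr (- (\<alpha> + 1)) * (1 + c) powr (- (\<alpha> + 1))"]
  have "(\<lambda>k. (lag_laplace \<alpha> k c)\<^sup>2) sums ((1 - ?q) powr (- (\<alpha> + 1)) * ((1 + c) powr (- (\<alpha> + 1)) * (1 + c) powr (- (\<alpha> + 1))))"
  proof -
    have "(lag_laplace \<alpha> k c)\<^sup>2 = (lag_c \<alpha> k)\<^sup>2 * ?q ^ k * ((1 + c) powr (- (\<alpha> + 1)) * (1 + c) powr (- (\<alpha> + 1)))" for k
    proof -
      have "((- c / (1 + c)) ^ k)\<^sup>2 = ?q ^ k"
        by (simp add: power_divide mult.commute flip: power_mult)
      thus ?thesis unfolding lag_laplace_def power_mult_distrib by (simp add: power2_eq_square)
    qed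
    thus ?thesis using \<open>(\<lambda>k. (lag_c \<alpha> k)\<^sup>2 * ?q ^ k * _) sums _\<close> by simp
  qed
  also have "(1 - ?q) powr (- (\<alpha> + 1)) * ((1 + c) powr (- (\<alpha> + 1)) * (1 + c) powr (- (\<alpha> + 1)))
      = ((1 - ?q) * ((1 + c) * (1 + c))) powr (- (\<alpha> + 1))"
    by (simp only: powr_mult)
  also have "(1 - ?q) * ((1 + c) * (1 + c)) = 1 + 2 * c"
  proof -
    have "c\<^sup>2 / (1 + c)\<^sup>2 * (1 + c)\<^sup>2 = c\<^sup>2" using c by simp
    thus ?thesis by (simp add: power2_eq_square algebra_simps)
  qed
  finally show ?thesis unfolding approx_iff_parseval ip ipe using L by simp
qed

lemma L2_const: "L2 (\<lambda>x. a)"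
proof -
  interpret finite_measure \<rho> by (rule finite_measure_\<rho>)
  show ?thesis by (simp add: L2_def)
qed

text \<open>For x > 0 the variable exp (- x) lies in [0, 1], where Weierstrass applies. A polynomial
  in exp (- x) is a combination of exponentials, covered by \<open>approx_exp\<close>, and the
  approximants are bounded by B + 1, an integrable majorant.\<close>

lemma approx_continuous_exp:
  assumes g: "continuous_on UNIV g" and B: "\<And>y. \<bar>g y\<bar> \<le> B"
  shows "approx (\<lambda>x. g (exp (- x)))"
proof -
  have "\<exists>p. real_polynomial_function p \<and> (\<forall>y\<in>{0..1}. \<bar>g y - p y\<bar> < 1 / real (Suc n))" for n
    using Stone_Weierstrass_real_polynomial_function[of "{0..1::real}" g "1 / real (Suc n)"]
      continuous_on_subset[OF g] by (metis compact_Icc divide_pos_pos of_nat_0_less_iff subset_UNIV zero_less_Suc zero_less_one)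
  then obtain p where p: "\<And>n. real_polynomial_function (p n)" "\<And>n y. y \<in> {0..1} \<Longrightarrow> \<bar>g y - p n y\<bar> < 1 / real (Suc n)"
    by metis
  show ?thesis
  proof (rule approx_dominated_limit[where s="\<lambda>n x. p n (exp (- x))" and w="\<lambda>x. B + 1"])
    fix n
    obtain a m where "p n = (\<lambda>x. \<Sum>i\<le>m. a i * x ^ i)" using p(1) real_polynomial_function_iff_sum by blast
    hence "(\<lambda>x. p n (exp (- x))) = (\<lambda>x. \<Sum>i\<le>m. a i * exp (- (real i * x)))"
      by (simp add: exp_of_nat_mult[symmetric])
    thus "approx (\<lambda>x. p n (exp (- x)))" by (simp only:) (intro approx_sum approx_exp, auto)
  next
    fix x :: real assume x: "0 < x"
    have "(\<lambda>n. g (exp (- x)) - p n (exp (- x))) \<longlonglongrightarrow> 0"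
    proof (rule Lim_null_comparison)
      show "eventually (\<lambda>n. norm (g (exp (- x)) - p n (exp (- x))) \<le> 1 / real (Suc n)) sequentially"
        using p(2)[of "exp (- x)"] x by (auto intro!: always_eventually less_imp_le)
      show "(\<lambda>n. 1 / real (Suc n)) \<longlonglongrightarrow> 0" using LIMSEQ_inverse_real_of_nat by (simp add: inverse_eq_divide)
    qed
    from tendsto_diff[OF tendsto_const[of "g (exp (- x))"] this]
    show "(\<lambda>n. p n (exp (- x))) \<longlonglongrightarrow> g (exp (- x))" by simp
    fix n
    have "\<bar>g (exp (- x)) - p n (exp (- x))\<bar> < 1 / real (Suc n)" using p(2) x by auto
    also have "\<dots> \<le> 1" by simp
    finally show "\<bar>p n (exp (- x))\<bar> \<le> B + 1" using B[of "exp (- x)"] by linarith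
  next
    show "(\<lambda>x. g (exp (- x))) \<in> borel_measurable borel"
      by (intro borel_measurable_continuous_onI continuous_on_compose2[OF g] continuous_intros) auto
  qed (rule L2_const)
qed

text \<open>Clamped ramps in exp (- x) with slope n tend to 1 where exp (- x) exceeds exp (- a) and
  vanish elsewhere, in particular at x = a; hence the open ray.\<close>

lemma approx_indicator_lessThan: "approx (indicator {..<a})"
proof (rule approx_dominated_limit[where s="\<lambda>n x. min 1 (max 0 (real n * (exp (- x) - exp (- a))))" and w="\<lambda>x. 1"])
  fix n
  show "approx (\<lambda>x. min 1 (max 0 (real n * (exp (- x) - exp (- a)))))"
    by (rule approx_continuous_exp[where g="\<lambda>y. min 1 (max 0 (real n * (y - exp (- a))))" and B=1])
       (auto intro!: continuous_intros)
next
  fix x :: real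
  show "(\<lambda>n. min 1 (max 0 (real n * (exp (- x) - exp (- a))))) \<longlonglongrightarrow> indicator {..<a} x"
  proof (cases "x < a")
    case True
    hence d: "exp (- x) - exp (- a) > 0" by simp
    obtain N :: nat where N: "1 / (exp (- x) - exp (- a)) < real N" using reals_Archimedean2 by blast
    have "eventually (\<lambda>n. min 1 (max 0 (real n * (exp (- x) - exp (- a)))) = 1) sequentially"
      using eventually_ge_at_top[of N]
    proof eventually_elim
      case (elim n)
      have "1 < real N * (exp (- x) - exp (- a))" using N d by (simp add: field_simps)
      also have "\<dots> \<le> real n * (exp (- x) - exp (- a))" using elim d by (intro mult_right_mono) auto
      finally show ?case by simp
    qed
    thus ?thesis using True by (simp add: tendsto_eventually)
  next
    case False
    hence "real n * (exp (- x) - exp (- a)) \<le> 0" for n by (intro mult_nonneg_nonpos) auto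
    thus ?thesis using False by (simp add: max_absorb1)
  qed
qed (auto intro: L2_const)

text \<open>Dynkin's theorem: closedness under complements and disjoint unions is available for
  \<open>approx\<close>, closedness under intersections only for the generating rays.\<close>

lemma approx_indicator:
  assumes "A \<in> sets borel"
  shows "approx (indicator A)"
proof -
  have "Int_stable (range (lessThan :: real \<Rightarrow> real set))"
  proof -
    have "{..<a} \<inter> {..<b} = {..<min a b}" for a b :: real by auto
    thus ?thesis by (auto simp: Int_stable_def)
  qed
  moreover have "range (lessThan :: real \<Rightarrow> real set) \<subseteq> Pow UNIV" by simp
  moreover have "A \<in> sigma_sets UNIV (range lessThan)"
    using assms by (simp add: borel_Iio sets_measure_of)
  ultimately show ?thesis
  proof (induction rule: sigma_sets_induct_disjoint)
    case (basic A)
    thus ?case using approx_indicator_lessThan by auto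
  next
    case empty
    thus ?case using approx_zero by (simp add: indicator_def)
  next
    case (compl A)
    have "approx (indicator (UNIV :: real set))"
      using approx_exp[of 0] by (simp add: indicator_def)
    from approx_lincomb[OF this compl(2), of 1 "-1"]
    have "approx (\<lambda>x. indicator UNIV x - indicator A x)" by simp
    moreover have "(\<lambda>x. indicator UNIV x - indicator A x :: real) = indicator (UNIV - A)"
      by (auto simp: indicator_def)
    ultimately show ?case by simp
  next
    case (union A)
    show ?case
    proof (rule approx_dominated_limit[where s="\<lambda>n x. \<Sum>i<n. 1 * indicator (A i) x" and w="\<lambda>x. 1"])
      show "approx (\<lambda>x. \<Sum>i<n. 1 * indicator (A i) x)" for n
        by (intro approx_sum union) auto
      have eq: "(\<Sum>i<n. 1 * indicator (A i) x :: real) = indicator (\<Union>i<n. A i) x" for n x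
        using union(1) by (simp add: indicator_UN_disjoint disjoint_family_on_def)
      show "(\<lambda>n. \<Sum>i<n. 1 * indicator (A i) x) \<longlonglongrightarrow> (indicator (\<Union> (range A)) x :: real)" for x
        unfolding eq by (rule LIMSEQ_indicator_UN)
      show "\<bar>\<Sum>i<n. 1 * indicator (A i) x\<bar> \<le> (1::real)" for n x
        unfolding eq by (simp add: indicator_def)
      show "indicator (\<Union> (range A)) \<in> borel_measurable borel"
      proof (intro borel_measurable_indicator sets.countable_UN)
        show "range A \<subseteq> sets borel" using union(2) by (simp add: borel_Iio sets_measure_of)
      qed
    qed (rule L2_const)
  qed
qed

lemma approx_L2:
  assumes "L2 f" shows "approx f"
proof -
  have fm: "f \<in> borel_measurable borel" using assms by (simp add: L2_def)
  obtain s where s: "\<And>i. simple_function borel (s i)" "\<And>x. (\<lambda>i. s i x) \<longlonglongrightarrow> f x"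
    "\<And>i x. dist (s i x) 0 \<le> 2 * dist (f x) 0"
    using borel_measurable_implies_sequence_metric[OF fm, of 0] by auto
  show ?thesis
  proof (rule approx_dominated_limit[where s=s and w="\<lambda>x. 2 * \<bar>f x\<bar>"])
    fix n
    let ?A = "\<lambda>y. s n -` {y}"
    have fin: "finite (range (s n))" using simple_functionD(1)[OF s(1)[of n]] by simp
    have A: "?A y \<in> sets borel" for y using simple_functionD(2)[OF s(1)[of n], of "{y}"] by simp
    have "approx (\<lambda>x. \<Sum>y\<in>range (s n). y * indicator (?A y) x)"
      by (intro approx_sum fin approx_indicator A)
    thus "approx (s n)" using simple_function_eq_sum[OF s(1)[of n]] by metis
  next
    show "L2 (\<lambda>x. 2 * \<bar>f x\<bar>)" using assms by (auto simp: L2_def power_mult_distrib)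
  qed (use s fm in \<open>auto simp: dist_real_def\<close>)
qed

lemma parseval:
  assumes f: "L2 f" and g: "L2 g"
  shows "(\<lambda>k. ip f (P k) * ip g (P k)) sums ip f g"
proof -
  have s: "(\<lambda>k. (ip h (P k))\<^sup>2) sums ip h h" if "L2 h" for h
    using approx_L2[OF that] by (simp add: approx_iff_parseval)
  let ?p = "\<lambda>x. 1 * f x + 1 * g x" and ?m = "\<lambda>x. 1 * f x + (-1) * g x"
  have "(\<lambda>k. ((ip ?p (P k))\<^sup>2 - (ip ?m (P k))\<^sup>2) / 4) sums ((ip ?p ?p - ip ?m ?m) / 4)"
    by (intro sums_divide sums_diff s L2_lincomb f g)
  moreover have "((ip ?p (P k))\<^sup>2 - (ip ?m (P k))\<^sup>2) / 4 = ip f (P k) * ip g (P k)" for k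
    unfolding ip_lincomb_left[OF f g L2_P] by (simp add: power2_eq_square algebra_simps)
  moreover have "(ip ?p ?p - ip ?m ?m) / 4 = ip f g"
    using ip_commute[of g f]
    unfolding ip_lincomb_left[OF f g L2_lincomb[OF f g]] ip_lincomb_right[OF f g f] ip_lincomb_right[OF f g g]
    by (simp add: algebra_simps)
  ultimately show ?thesis by simp
qed

end

section \<open>Projection-valued measures from matrices\<close>

lemma inner_sum_right:
  assumes "w \<in> ell2" "\<And>i. i \<in> I \<Longrightarrow> f i \<in> ell2"
  shows "ell2_inner w (\<lambda>n. \<Sum>i\<in>I. c i * f i n) = (\<Sum>i\<in>I. c i * ell2_inner w (f i))"
  using assms(2)
proof (induction I rule: infinite_finite_induct)
  case (insert i I)
  have "(\<lambda>n. \<Sum>i\<in>I. c i * f i n) \<in> ell2" using insert by (intro ell2_sum ell2_scale) auto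
  thus ?case using inner_lincomb_right[OF assms(1), of "f i" "\<lambda>n. \<Sum>i\<in>I. c i * f i n" "c i" 1] insert by simp
qed (auto simp: ell2_inner_def)

lemma inner_sum_left:
  assumes "w \<in> ell2" "\<And>i. i \<in> I \<Longrightarrow> f i \<in> ell2"
  shows "ell2_inner (\<lambda>n. \<Sum>i\<in>I. c i * f i n) w = (\<Sum>i\<in>I. cnj (c i) * ell2_inner (f i) w)"
proof -
  have "(\<lambda>n. \<Sum>i\<in>I. c i * f i n) \<in> ell2" using assms by (intro ell2_sum ell2_scale) auto
  hence "ell2_inner (\<lambda>n. \<Sum>i\<in>I. c i * f i n) w = cnj (ell2_inner w (\<lambda>n. \<Sum>i\<in>I. c i * f i n))"
    using assms by (simp add: inner_cnj)
  also have "\<dots> = (\<Sum>i\<in>I. cnj (c i) * ell2_inner (f i) w)"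
    using assms by (simp add: inner_sum_right inner_cnj)
  finally show ?thesis .
qed

text \<open>Everything is stated entrywise. Boundedness on \<open>ell2\<close> is not assumed: the
  product rule with A = B makes the rows square-summable and the matrices idempotent, and symmetry
  then makes them contractions.\<close>

locale projection_matrices =
  fixes M :: "real set \<Rightarrow> nat \<Rightarrow> nat \<Rightarrow> real"
  assumes M_sym: "M A n m = M A m n"
    and M_UNIV: "M UNIV n m = (if n = m then 1 else 0)"
    and M_Int: "A \<in> sets borel \<Longrightarrow> B \<in> sets borel \<Longrightarrow> (\<lambda>k. M A n k * M B k m) sums M (A \<inter> B) n m"
    and M_UN: "range F \<subseteq> sets borel \<Longrightarrow> disjoint_family F \<Longrightarrow> (\<lambda>i. M (F i) n m) sums M (\<Union>i. F i) n m"
begin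

definition row :: "real set \<Rightarrow> nat \<Rightarrow> nat \<Rightarrow> complex" where
  "row A n k = of_real (M A n k)"

definition E0 :: "real set \<Rightarrow> (nat \<Rightarrow> complex) \<Rightarrow> nat \<Rightarrow> complex" where
  "E0 A u n = ell2_inner (row A n) u"

text \<open>Infinitely many copies of the empty set are disjoint, and a convergent series with equal
  terms must vanish.\<close>

lemma M_empty: "M {} n m = 0"
  using sums_summable[OF M_UN[of "\<lambda>i. {}" n m]] by (simp add: disjoint_family_on_def summable_const_iff)

lemma row_ell2: "A \<in> sets borel \<Longrightarrow> row A n \<in> ell2"
  using sums_summable[OF M_Int[of A A n n]] M_sym[of A]
  unfolding ell2_def row_def by (simp add: power2_eq_square)

lemma inner_row: "A \<in> sets borel \<Longrightarrow> B \<in> sets borel \<Longrightarrow> ell2_inner (row A n) (row B m) = of_real (M (A \<inter> B) n m)"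
proof -
  assume AB: "A \<in> sets borel" "B \<in> sets borel"
  have "(\<lambda>k. complex_of_real (M A n k * M B k m)) sums of_real (M (A \<inter> B) n m)"
    by (intro sums_of_real M_Int AB)
  thus ?thesis unfolding ell2_inner_def row_def by (simp add: sums_iff M_sym[of B])
qed

lemma E0_lincomb:
  "A \<in> sets borel \<Longrightarrow> u \<in> ell2 \<Longrightarrow> v \<in> ell2 \<Longrightarrow> E0 A (\<lambda>n. a * u n + b * v n) = (\<lambda>n. a * E0 A u n + b * E0 A v n)"
  by (auto simp: E0_def inner_lincomb_right row_ell2)

lemma E0_trunc: "A \<in> sets borel \<Longrightarrow> E0 A (trunc N u) = (\<lambda>n. \<Sum>m<N. u m * row A m n)"
proof
  fix n assume A: "A \<in> sets borel"
  have "E0 A (trunc N u) n = (\<Sum>m<N. cnj (row A n m) * trunc N u m)"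
    unfolding E0_def ell2_inner_def by (rule suminf_finite) (auto simp: trunc_def)
  thus "E0 A (trunc N u) n = (\<Sum>m<N. u m * row A m n)"
    by (simp add: row_def trunc_def M_sym[of A n] mult.commute)
qed

lemma E0_trunc_ell2: "A \<in> sets borel \<Longrightarrow> E0 A (trunc N u) \<in> ell2"
  by (simp add: E0_trunc ell2_sum ell2_scale row_ell2)

text \<open>On finitely supported vectors the norm becomes a finite expression in the entries. It
  gives the contraction bound and, in \<open>E0_UN\<close>, lets entrywise convergence imply norm
  convergence.\<close>

lemma nsq_E0_trunc_eq:
  assumes A: "A \<in> sets borel"
  shows "of_real (nsq (E0 A (trunc N u))) = (\<Sum>n<N. cnj (u n) * (\<Sum>m<N. u m * of_real (M A n m)))"
proof -
  let ?w = "E0 A (trunc N u)"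
  have "ell2_inner (row A n) ?w = (\<Sum>m<N. u m * of_real (M A n m))" for n
    unfolding E0_trunc[OF A] using A by (subst inner_sum_right) (auto simp: row_ell2 inner_row)
  moreover have "of_real (nsq ?w) = ell2_inner ?w ?w" by (simp add: inner_self E0_trunc_ell2 A)
  moreover have "ell2_inner ?w ?w = (\<Sum>n<N. cnj (u n) * ell2_inner (row A n) ?w)"
    using inner_sum_left[OF E0_trunc_ell2[OF A, of N u], of "{..<N}" "row A" u] row_ell2[OF A]
    by (simp add: E0_trunc[OF A])
  ultimately show ?thesis by simp
qed

lemma nsq_E0_trunc_le:
  assumes A: "A \<in> sets borel"
  shows "nsq (E0 A (trunc N u)) \<le> nsq (trunc N u)"
proof -
  let ?w = "E0 A (trunc N u)"
  have w: "?w \<in> ell2" by (rule E0_trunc_ell2[OF A])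
  have "?w n = (\<Sum>m<N. u m * of_real (M A n m))" for n
    by (simp add: E0_trunc[OF A] row_def M_sym[of A n])
  hence "of_real (nsq ?w) = ell2_inner (trunc N u) ?w"
    unfolding nsq_E0_trunc_eq[OF A] inner_trunc_left by simp
  hence "nsq ?w = cmod (ell2_inner (trunc N u) ?w)"
    using nsq_nonneg[OF w] by (metis abs_of_nonneg norm_of_real)
  also have "\<dots> \<le> ell2_norm (trunc N u) * ell2_norm ?w"
    by (rule inner_Cauchy_Schwarz[OF trunc_ell2 w])
  finally have le: "(ell2_norm ?w)\<^sup>2 \<le> ell2_norm (trunc N u) * ell2_norm ?w"
    using w by (simp add: nsq_eq_norm_power2)
  have nn: "0 \<le> ell2_norm ?w" "0 \<le> ell2_norm (trunc N u)"
    by (simp_all add: ell2_norm_nonneg w trunc_ell2)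
  have "ell2_norm ?w \<le> ell2_norm (trunc N u)"
    by (rule le_of_power2_le_mult) (use le nn in auto)
  thus ?thesis using nn by (simp add: nsq_eq_norm_power2 w trunc_ell2 power_mono)
qed

text \<open>A fixed number of coordinates of the image is the limit of those for truncated
  arguments, and the contraction bound for truncations is uniform in the cutoff.\<close>

lemma
  assumes A: "A \<in> sets borel" and u: "u \<in> ell2"
  shows E0_ell2: "E0 A u \<in> ell2" and nsq_E0_le: "nsq (E0 A u) \<le> nsq u"
proof -
  have "(\<Sum>n<K. (cmod (E0 A u n))\<^sup>2) \<le> nsq u" for K
  proof (rule LIMSEQ_le_const2)
    have "(\<lambda>N. E0 A (trunc N u) n) \<longlonglongrightarrow> E0 A u n" for n
      using inner_sums[OF row_ell2[OF A] u, of n]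
      by (simp add: E0_def sums_def E0_trunc[OF A, unfolded E0_def, THEN fun_cong] row_def M_sym[of A n] mult.commute)
    thus "(\<lambda>N. \<Sum>n<K. (cmod (E0 A (trunc N u) n))\<^sup>2) \<longlonglongrightarrow> (\<Sum>n<K. (cmod (E0 A u n))\<^sup>2)"
      by (intro tendsto_intros)
    have "(\<Sum>n<K. (cmod (E0 A (trunc N u) n))\<^sup>2) \<le> nsq u" for N
    proof -
      have "(\<Sum>n<K. (cmod (E0 A (trunc N u) n))\<^sup>2) \<le> nsq (E0 A (trunc N u))"
        by (rule sum_le_nsq[OF E0_trunc_ell2[OF A]])
      also have "\<dots> \<le> nsq (trunc N u)" by (rule nsq_E0_trunc_le[OF A])
      also have "\<dots> \<le> nsq u" unfolding nsq_trunc by (rule sum_le_nsq[OF u])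
      finally show ?thesis .
    qed
    thus "\<exists>N0. \<forall>N\<ge>N0. (\<Sum>n<K. (cmod (E0 A (trunc N u) n))\<^sup>2) \<le> nsq u" by blast
  qed
  from ell2I_bounded[OF this] show "E0 A u \<in> ell2" "nsq (E0 A u) \<le> nsq u" by auto
qed

lemma E0_diff:
  "A \<in> sets borel \<Longrightarrow> u \<in> ell2 \<Longrightarrow> v \<in> ell2 \<Longrightarrow> E0 A (\<lambda>n. u n - v n) = (\<lambda>n. E0 A u n - E0 A v n)"
  using E0_lincomb[of A u v 1 "-1"] by simp

text \<open>Truncating \<open>v\<close> makes the outer sum finite, so no double series has to be
  interchanged; contractivity controls the truncation error.\<close>

lemma E0_sym:
  assumes A: "A \<in> sets borel" and u: "u \<in> ell2" and v: "v \<in> ell2"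
  shows "ell2_inner v (E0 A u) = ell2_inner (E0 A v) u"
proof -
  have eq: "ell2_inner (E0 A (trunc N v)) u = (\<Sum>n<N. cnj (v n) * E0 A u n)" for N
    unfolding E0_trunc[OF A] E0_def by (rule inner_sum_left) (use A u row_ell2 in auto)
  have lim1: "(\<lambda>N. ell2_inner (E0 A (trunc N v)) u) \<longlonglongrightarrow> ell2_inner v (E0 A u)"
    using inner_sums[OF v E0_ell2[OF A u]] by (simp add: eq sums_def)
  let ?d = "\<lambda>N n. v n - trunc N v n"
  have d: "?d N \<in> ell2" for N by (intro ell2_diff v trunc_ell2)
  have diff: "ell2_inner (E0 A v) u - ell2_inner (E0 A (trunc N v)) u = ell2_inner (E0 A (?d N)) u" for N
    using inner_lincomb_left[OF u E0_ell2[OF A v] E0_trunc_ell2[OF A], of 1 "-1" N v]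
    by (simp add: E0_diff[OF A v trunc_ell2])
  have "(\<lambda>N. ell2_norm (?d N) * ell2_norm u) \<longlonglongrightarrow> 0 * ell2_norm u"
    by (intro tendsto_mult tendsto_const ell2_norm_tendsto_zeroI trunc_tendsto v)
  hence lim0: "(\<lambda>N. ell2_norm (?d N) * ell2_norm u) \<longlonglongrightarrow> 0" by simp
  have "(\<lambda>N. ell2_inner (E0 A v) u - ell2_inner (E0 A (trunc N v)) u) \<longlonglongrightarrow> 0"
    unfolding diff
  proof (rule Lim_null_comparison[OF always_eventually lim0], rule allI)
    fix N
    have "cmod (ell2_inner (E0 A (?d N)) u) \<le> ell2_norm (E0 A (?d N)) * ell2_norm u"
      by (rule inner_Cauchy_Schwarz[OF E0_ell2[OF A d] u])
    also have "\<dots> \<le> ell2_norm (?d N) * ell2_norm u"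
      unfolding ell2_norm_eq_sqrt_nsq[of "E0 A (?d N)"] ell2_norm_eq_sqrt_nsq[of "?d N"]
      by (intro mult_right_mono real_sqrt_le_mono nsq_E0_le A d ell2_norm_nonneg u)
    finally show "cmod (ell2_inner (E0 A (?d N)) u) \<le> ell2_norm (?d N) * ell2_norm u" .
  qed
  from tendsto_diff[OF tendsto_const[of "ell2_inner (E0 A v) u"] this]
  have "(\<lambda>N. ell2_inner (E0 A (trunc N v)) u) \<longlonglongrightarrow> ell2_inner (E0 A v) u" by simp
  with lim1 show ?thesis by (rule LIMSEQ_unique)
qed

text \<open>By the product rule \<open>E0 B\<close> maps row n of A to row n of the intersection;
  symmetry transfers this action to \<open>u\<close>.\<close>

lemma E0_Int:
  assumes A: "A \<in> sets borel" and B: "B \<in> sets borel" and u: "u \<in> ell2"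
  shows "E0 (A \<inter> B) u = E0 A (E0 B u)"
proof
  fix n
  have "E0 B (row A n) = row (A \<inter> B) n"
    using A B by (auto simp: E0_def inner_row row_def Int_commute M_sym[of _ n])
  moreover have "E0 A (E0 B u) n = ell2_inner (E0 B (row A n)) u"
    unfolding E0_def[of A] by (rule E0_sym[OF B u row_ell2[OF A]])
  ultimately show "E0 (A \<inter> B) u n = E0 A (E0 B u) n" by (simp add: E0_def)
qed

text \<open>The matrices of the tail unions tend to 0 entrywise, hence in norm on truncated vectors;
  since the projections are contractions, the truncation error stays small uniformly in
  \<open>N\<close>.\<close>

lemma E0_UN:
  assumes F: "range F \<subseteq> sets borel" "disjoint_family F" and u: "u \<in> ell2"
  shows "(\<lambda>N. ell2_norm (\<lambda>n. E0 (\<Union>i. F i) u n - (\<Sum>i<N. E0 (F i) u n))) \<longlonglongrightarrow> 0"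
proof -
  have Fi: "F i \<in> sets borel" for i using F by auto
  \<comment> \<open>The union from index \<open>N\<close> on: its projection is exactly the
    remainder after \<open>N\<close> terms.\<close>
  define C where "C N = (\<Union>i. F (i + N))" for N
  have C: "C N \<in> sets borel" for N unfolding C_def using Fi by auto
  have U: "(\<Union>i. F i) \<in> sets borel" using Fi by auto
  have MC: "M (C N) n m = M (\<Union>i. F i) n m - (\<Sum>i<N. M (F i) n m)" for N n m
  proof -
    have "disjoint_family (\<lambda>i. F (i + N))" using F(2) by (auto simp: disjoint_family_on_def)
    hence "(\<lambda>i. M (F (i + N)) n m) sums M (C N) n m" unfolding C_def by (intro M_UN) (use Fi in auto)
    moreover have "(\<lambda>i. M (F (i + N)) n m) sums (M (\<Union>i. F i) n m - (\<Sum>i<N. M (F i) n m))"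
      by (rule sums_split_initial_segment[OF M_UN[OF F]])
    ultimately show ?thesis by (rule sums_unique2)
  qed
  have E0C: "E0 (C N) u n = E0 (\<Union>i. F i) u n - (\<Sum>i<N. E0 (F i) u n)" for N n
  proof -
    have s: "(\<lambda>k. \<Sum>i<N. 1 * row (F i) n k) \<in> ell2" by (intro ell2_sum ell2_scale row_ell2 Fi)
    have "row (C N) n = (\<lambda>k. 1 * row (\<Union>i. F i) n k + (- 1) * (\<Sum>i<N. 1 * row (F i) n k))"
      by (auto simp: row_def MC)
    hence "E0 (C N) u n = ell2_inner (row (\<Union>i. F i) n) u - ell2_inner (\<lambda>k. \<Sum>i<N. 1 * row (F i) n k) u"
      unfolding E0_def by (simp only: inner_lincomb_left[OF u row_ell2[OF U] s]) simp
    also have "ell2_inner (\<lambda>k. \<Sum>i<N. 1 * row (F i) n k) u = (\<Sum>i<N. cnj 1 * ell2_inner (row (F i) n) u)"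
      by (rule inner_sum_left[OF u row_ell2[OF Fi]])
    finally show ?thesis by (simp add: E0_def)
  qed
  have MC0: "(\<lambda>N. M (C N) n m) \<longlonglongrightarrow> 0" for n m
    unfolding MC using tendsto_diff[OF tendsto_const[of "M (\<Union>i. F i) n m"] M_UN[OF F, of n m, unfolded sums_def]] by simp
  have tr: "(\<lambda>N. nsq (E0 (C N) (trunc K u))) \<longlonglongrightarrow> 0" for K
  proof -
    have "(\<lambda>N. complex_of_real (nsq (E0 (C N) (trunc K u)))) \<longlonglongrightarrow> (\<Sum>n<K. cnj (u n) * (\<Sum>m<K. u m * of_real 0))"
      unfolding nsq_E0_trunc_eq[OF C] by (intro tendsto_intros MC0)
    thus ?thesis using tendsto_of_real_iff[of "\<lambda>N. nsq (E0 (C N) (trunc K u))" 0 sequentially, where 'a=complex] by simp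
  qed
  have "(\<lambda>N. nsq (E0 (C N) u)) \<longlonglongrightarrow> 0"
  proof (rule LIMSEQ_I)
    fix \<epsilon> :: real assume "\<epsilon> > 0"
    hence "eventually (\<lambda>K. nsq (\<lambda>n. u n - trunc K u n) < \<epsilon> / 4) sequentially"
      by (intro order_tendstoD[OF trunc_tendsto[OF u]]) simp
    then obtain K where K: "nsq (\<lambda>n. u n - trunc K u n) < \<epsilon> / 4" by (auto simp: eventually_sequentially)
    have "eventually (\<lambda>N. nsq (E0 (C N) (trunc K u)) < \<epsilon> / 4) sequentially"
      using \<open>\<epsilon> > 0\<close> by (intro order_tendstoD[OF tr]) simp
    then obtain N0 where N0: "\<And>N. N \<ge> N0 \<Longrightarrow> nsq (E0 (C N) (trunc K u)) < \<epsilon> / 4" by (auto simp: eventually_sequentially)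
    show "\<exists>N0. \<forall>N\<ge>N0. norm (nsq (E0 (C N) u) - 0) < \<epsilon>"
    proof (intro exI allI impI)
      fix N assume "N0 \<le> N"
      let ?d = "\<lambda>n. u n - trunc K u n"
      have d: "?d \<in> ell2" by (intro ell2_diff u trunc_ell2)
      have "E0 (C N) u = (\<lambda>n. E0 (C N) (trunc K u) n + E0 (C N) ?d n)"
        by (simp add: E0_diff[OF C u trunc_ell2])
      hence "nsq (E0 (C N) u) \<le> 2 * nsq (E0 (C N) (trunc K u)) + 2 * nsq (E0 (C N) ?d)"
        using ell2_add(2)[OF E0_trunc_ell2[OF C] E0_ell2[OF C d]] by metis
      also have "nsq (E0 (C N) ?d) \<le> nsq ?d" by (rule nsq_E0_le[OF C d])
      finally have "nsq (E0 (C N) u) < \<epsilon>" using K N0[OF \<open>N0 \<le> N\<close>] by simp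
      thus "norm (nsq (E0 (C N) u) - 0) < \<epsilon>" using nsq_nonneg[OF E0_ell2[OF C u]] by simp
    qed
  qed
  hence "(\<lambda>N. ell2_norm (E0 (C N) u)) \<longlonglongrightarrow> 0" by (rule ell2_norm_tendsto_zeroI)
  moreover have "E0 (C N) u = (\<lambda>n. E0 (\<Union>i. F i) u n - (\<Sum>i<N. E0 (F i) u n))" for N using E0C by auto
  ultimately show ?thesis by simp
qed

lemma E0_UNIV: "E0 UNIV u = u"
proof
  fix n
  have "row UNIV n = delta n" by (auto simp: row_def M_UNIV delta_def)
  thus "E0 UNIV u n = u n" by (simp add: E0_def inner_delta_left)
qed

lemma pvm_E0: "projection_valued_measure E0"
  unfolding projection_valued_measure_def ell2_projection_def
proof (intro conjI ballI allI impI)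
  show "E0 {} u = (\<lambda>n. 0)" for u by (auto simp: E0_def row_def M_empty ell2_inner_def)
  show "E0 A (E0 A u) = E0 A u" if "A \<in> sets borel" "u \<in> ell2" for A u
    using E0_Int[OF that(1,1,2)] by simp
qed (auto intro: E0_ell2 E0_lincomb E0_sym E0_UNIV E0_Int E0_UN)

end

section \<open>Existence of the spectral resolution\<close>

context laguerre_weight
begin

abbreviation "H \<equiv> laguerre_op \<alpha>"
abbreviation "D \<equiv> laguerre_dom \<alpha>"

definition spec_matrix :: "real set \<Rightarrow> nat \<Rightarrow> nat \<Rightarrow> real" where
  "spec_matrix A n m = ip (\<lambda>x. indicator A x * P n x) (P m)"

lemma L2_indicator_P: "A \<in> sets borel \<Longrightarrow> L2 (\<lambda>x. indicator A x * P n x)"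
proof -
  assume A: "A \<in> sets borel"
  have P: "P n \<in> borel_measurable borel" "integrable \<rho> (\<lambda>x. (P n x)\<^sup>2)" using L2_P[of n] by (auto simp: L2_def)
  have "integrable \<rho> (\<lambda>x. (indicator A x * P n x)\<^sup>2)"
    by (rule Bochner_Integration.integrable_bound[OF P(2)]) (use A P(1) in \<open>auto simp: indicator_def\<close>)
  thus ?thesis using A P(1) by (auto simp: L2_def)
qed

text \<open>The product rule is Parseval's equality for indicator A times P_n and indicator B times
  P_m, which is where completeness enters. Additivity is dominated convergence with majorant |P_n
  P_m|.\<close>

lemma spec_matrix_projection: "projection_matrices spec_matrix"
proof
  fix A B :: "real set" and n m and F :: "nat \<Rightarrow> real set"
  show "spec_matrix A n m = spec_matrix A m n"
    by (simp add: spec_matrix_def ip_def mult_ac)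
  show "spec_matrix UNIV n m = (if n = m then 1 else 0)"
    by (simp add: spec_matrix_def ip_P)
  {
    assume AB: "A \<in> sets borel" "B \<in> sets borel"
    have "(\<lambda>k. ip (\<lambda>x. indicator A x * P n x) (P k) * ip (\<lambda>x. indicator B x * P m x) (P k))
        sums ip (\<lambda>x. indicator A x * P n x) (\<lambda>x. indicator B x * P m x)"
      by (intro parseval L2_indicator_P AB)
    moreover have "ip (\<lambda>x. indicator A x * P n x) (\<lambda>x. indicator B x * P m x) = spec_matrix (A \<inter> B) n m"
      by (simp add: spec_matrix_def ip_def indicator_inter_arith mult_ac)
    moreover have "ip (\<lambda>x. indicator B x * P m x) (P k) = spec_matrix B k m" for k
      by (simp add: spec_matrix_def ip_def mult_ac)
    ultimately show "(\<lambda>k. spec_matrix A n k * spec_matrix B k m) sums spec_matrix (A \<inter> B) n m"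
      by (simp add: spec_matrix_def)
  }
  {
    assume F: "range F \<subseteq> sets borel" "disjoint_family F"
    have Fi: "F i \<in> sets borel" for i using F by auto
    have Pm: "P k \<in> borel_measurable borel" for k using L2_P[of k] by (auto simp: L2_def)
    have PP: "integrable \<rho> (\<lambda>x. P n x * P m x)" by (intro L2_mult_integrable L2_P)
    have eq: "(\<Sum>i<N. indicator (F i) x :: real) = indicator (\<Union>i<N. F i) x" for N x
      using F(2) by (simp add: indicator_UN_disjoint disjoint_family_on_def)
    have "(\<Sum>i<N. spec_matrix (F i) n m) = (LINT x|\<rho>. indicator (\<Union>i<N. F i) x * P n x * P m x)" for N
    proof -
      have "(\<Sum>i<N. spec_matrix (F i) n m) = (LINT x|\<rho>. (\<Sum>i<N. indicator (F i) x * P n x * P m x))"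
        unfolding spec_matrix_def ip_def
        by (intro Bochner_Integration.integral_sum[symmetric] L2_mult_integrable L2_indicator_P L2_P Fi)
      also have "(\<lambda>x. \<Sum>i<N. indicator (F i) x * P n x * P m x) = (\<lambda>x. indicator (\<Union>i<N. F i) x * P n x * P m x)"
        by (simp add: eq flip: sum_distrib_right)
      finally show ?thesis .
    qed
    moreover have "(\<lambda>N. LINT x|\<rho>. indicator (\<Union>i<N. F i) x * P n x * P m x) \<longlonglongrightarrow>
        (LINT x|\<rho>. indicator (\<Union>i. F i) x * P n x * P m x)"
    proof (rule integral_dominated_convergence[where w="\<lambda>x. \<bar>P n x * P m x\<bar>"])
      show "integrable \<rho> (\<lambda>x. \<bar>P n x * P m x\<bar>)" using PP by (rule integrable_abs)
      show "AE x in \<rho>. (\<lambda>N. indicator (\<Union>i<N. F i) x * P n x * P m x) \<longlonglongrightarrow> indicator (\<Union>i. F i) x * P n x * P m x"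
        by (intro AE_I2 tendsto_intros LIMSEQ_indicator_UN)
      show "AE x in \<rho>. norm (indicator (\<Union>i<N. F i) x * P n x * P m x) \<le> \<bar>P n x * P m x\<bar>" for N
        by (intro AE_I2) (simp add: indicator_def)
    qed (use Fi Pm in \<open>auto intro!: borel_measurable_times borel_measurable_indicator\<close>)
    ultimately show "(\<lambda>i. spec_matrix (F i) n m) sums spec_matrix (\<Union>i. F i) n m"
      by (simp add: sums_def spec_matrix_def ip_def)
  }
qed

sublocale projection_matrices spec_matrix
  by (rule spec_matrix_projection)

sublocale pvm E0
  by standard (rule pvm_E0)

text \<open>Links the abstract form to integrals against the weight, so that the recurrence of the
  polynomials becomes available.\<close>

lemma S_delta_delta:
  assumes f: "f \<in> dominated (\<lambda>x. 1)"
  shows "S f (delta n) (delta m) = (LINT x|\<rho>. of_real (P n x * P m x) * f x)"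
proof -
  have PP: "integrable \<rho> (\<lambda>x. \<bar>P n x * P m x\<bar>)" by (intro integrable_abs L2_mult_integrable L2_P)
  have Pm: "P k \<in> borel_measurable borel" for k using L2_P[of k] by (auto simp: L2_def)
  have e: "(\<lambda>x. complex_of_real (P n x * P m x)) \<in> borel_measurable borel"
    by (rule measurable_compose[OF borel_measurable_times[OF Pm Pm]]) auto
  show ?thesis
  proof (rule dct_eqI[OF dct_S dct_functional_mult[OF dct_integral[OF _ PP] e, where D=1] _ _ f])
    fix A :: "real set" assume A: "A \<in> sets borel"
    have "S (indicator A) (delta n) (delta m) = row A n m"
    proof -
      have "ell2_inner (row A n) (delta m) = cnj (row A n m)"
        using inner_cnj[OF delta_ell2 row_ell2[OF A], of m n] by (simp add: inner_delta_left)
      thus ?thesis using A by (simp add: S_indicator delta_ell2 inner_delta_left E0_def row_def)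
    qed
    also have "\<dots> = (LINT x|\<rho>. complex_of_real (indicator A x * P n x * P m x))"
      by (simp only: row_def spec_matrix_def ip_def integral_complex_of_real)
    also have "\<dots> = (LINT x|\<rho>. of_real (P n x * P m x) * indicator A x)"
      by (intro Bochner_Integration.integral_cong) (auto simp: indicator_def)
    finally show "S (indicator A) (delta n) (delta m) = (LINT x|\<rho>. of_real (P n x * P m x) * indicator A x)" .
  qed (auto simp: delta_ell2 norm_mult abs_mult)
qed

lemma S_op_delta_left:
  assumes "u \<in> ell2" "f \<in> dominated (\<lambda>x. 1)"
  shows "S f (H (delta n)) u = H (\<Phi> f u) n"
  unfolding laguerre_op_delta
  using S_lincomb_left[where a=1 and b="of_real (jac_a \<alpha> (Suc n))" and f=f and w=u and v="delta (Suc n)"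
      and u="\<lambda>k. of_real (jac_a \<alpha> n) * delta (n - 1) k + of_real (jac_b \<alpha> n) * delta n k"] assms
  by (simp add: S_lincomb_left delta_ell2 ell2_lincomb laguerre_op_eq \<Phi>_def)

lemma op_delta_ell2: "H (delta n) \<in> ell2"
  using delta_dom by (simp add: laguerre_dom_def)

lemma S_delta_op_delta:
  assumes f: "f \<in> dominated (\<lambda>x. 1)" and xf: "(\<lambda>x. of_real x * f x) \<in> dominated (\<lambda>x. 1)"
  shows "S f (delta m) (H (delta n)) = S (\<lambda>x. of_real x * f x) (delta m) (delta n)"
proof -
  have i: "integrable \<rho> (\<lambda>x. of_real (P m x * P k x) * f x)" for k
  proof -
    have PP: "integrable \<rho> (\<lambda>x. \<bar>P m x * P k x\<bar>)" by (intro integrable_abs L2_mult_integrable L2_P)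
    have Pm: "P k \<in> borel_measurable borel" for k using L2_P[of k] by (auto simp: L2_def)
    obtain C where C: "\<And>x. cmod (f x) \<le> C" and fm: "f \<in> borel_measurable borel"
      using f by (auto simp: dominated_def)
    have "(\<lambda>x. of_real (P m x * P k x) * f x) \<in> dominated (\<lambda>x. \<bar>P m x * P k x\<bar>)"
    proof (rule dominatedI[of _ C])
      show "(\<lambda>x. of_real (P m x * P k x) * f x) \<in> borel_measurable borel"
        by (intro borel_measurable_times measurable_compose[OF borel_measurable_times[OF Pm Pm]] fm) auto
      show "cmod (of_real (P m x * P k x) * f x) \<le> C * \<bar>P m x * P k x\<bar>" for x
        unfolding norm_mult norm_of_real by (subst mult.commute) (intro mult_right_mono C abs_ge_zero)
    qed
    thus ?thesis by (intro dominated_integrable[OF _ PP]) auto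
  qed
  have "S f (delta m) (H (delta n)) =
      of_real (jac_a \<alpha> n) * S f (delta m) (delta (n - 1)) + of_real (jac_b \<alpha> n) * S f (delta m) (delta n)
      + of_real (jac_a \<alpha> (Suc n)) * S f (delta m) (delta (Suc n))"
    unfolding laguerre_op_delta
    using S_lincomb_right[where a=1 and b="of_real (jac_a \<alpha> (Suc n))" and f=f and w="delta m" and v="delta (Suc n)"
        and u="\<lambda>k. of_real (jac_a \<alpha> n) * delta (n - 1) k + of_real (jac_b \<alpha> n) * delta n k"] f
    by (simp add: S_lincomb_right delta_ell2 ell2_lincomb)
  also have "\<dots> = (LINT x|\<rho>. of_real (jac_a \<alpha> n) * (of_real (P m x * P (n - 1) x) * f x)
      + of_real (jac_b \<alpha> n) * (of_real (P m x * P n x) * f x)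
      + of_real (jac_a \<alpha> (Suc n)) * (of_real (P m x * P (Suc n) x) * f x))"
    using i[of n] i[of "n - 1"] i[of "Suc n"] by (simp add: S_delta_delta[OF f] del: of_real_mult)
  also have "\<dots> = (LINT x|\<rho>. of_real (P m x * (jac_a \<alpha> n * P (n - 1) x + jac_b \<alpha> n * P n x + jac_a \<alpha> (Suc n) * P (Suc n) x)) * f x)"
    by (intro Bochner_Integration.integral_cong) (auto simp: algebra_simps)
  also have "\<dots> = S (\<lambda>x. of_real x * f x) (delta m) (delta n)"
    unfolding lag_poly_recurrence[OF \<alpha>] S_delta_delta[OF xf]
    by (intro Bochner_Integration.integral_cong) (auto simp: mult_ac)
  finally show ?thesis .
qed

text \<open>For unit vectors the recurrence yields this through \<open>S_delta_op_delta\<close>. For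
  general \<open>u\<close> the function is moved by conjugation to the side of
  \<open>delta n\<close>. The matrix acts coordinatewise here, so \<open>u\<close> need not lie in
  the domain.\<close>

lemma op_\<Phi>:
  assumes f: "f \<in> dominated (\<lambda>x. 1)" and xf: "(\<lambda>x. of_real x * f x) \<in> dominated (\<lambda>x. 1)" and u: "u \<in> ell2"
  shows "H (\<Phi> f u) = \<Phi> (\<lambda>x. of_real x * f x) u"
proof
  fix n
  let ?g = "\<lambda>x. cnj (f x)"
  have g: "?g \<in> dominated (\<lambda>x. 1)" by (rule dominated_cnj[OF f])
  have xg: "(\<lambda>x. of_real x * ?g x) \<in> dominated (\<lambda>x. 1)" using dominated_cnj[OF xf] by simp
  have "\<Phi> ?g (H (delta n)) = \<Phi> (\<lambda>x. of_real x * ?g x) (delta n)"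
    by (auto simp: \<Phi>_def S_delta_op_delta[OF g xg])
  hence eq: "S ?g u (H (delta n)) = S (\<lambda>x. of_real x * ?g x) u (delta n)"
    by (simp flip: inner_\<Phi> add: u delta_ell2 op_delta_ell2 g xg)
  have "H (\<Phi> f u) n = S f (H (delta n)) u"
    by (rule S_op_delta_left[OF u f, symmetric])
  also have "\<dots> = cnj (S (\<lambda>x. of_real x * ?g x) u (delta n))"
    using S_cnj[OF u op_delta_ell2 f] eq by simp
  also have "\<dots> = \<Phi> (\<lambda>x. of_real x * f x) u n"
    using S_cnj[OF u delta_ell2 xf, of n] by (simp add: \<Phi>_def)
  finally show "H (\<Phi> f u) n = \<Phi> (\<lambda>x. of_real x * f x) u n" .
qed

text \<open>Spectral cutoffs: x times \<open>window R\<close> is bounded, so the bounded calculus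
  applies, and letting \<open>R\<close> grow recovers the unbounded operator.\<close>

definition window :: "nat \<Rightarrow> real \<Rightarrow> complex" where
  "window R = indicator {- real R..real R}"

lemma window_dominated: "window R \<in> dominated (\<lambda>x. 1)"
  unfolding window_def by (intro dominated_indicator) auto

lemma window_norm_le: "cmod (window R x) \<le> 1" "cmod (of_real x * window R x) \<le> \<bar>x\<bar>"
  by (auto simp: window_def indicator_def)

lemma window_measurable: "window R \<in> borel_measurable borel"
  unfolding window_def by (intro borel_measurable_indicator) auto

lemma x_window_measurable: "(\<lambda>x. of_real x * window R x) \<in> borel_measurable borel"
  using window_measurable by (intro borel_measurable_times) auto

lemma x_window_dominated: "(\<lambda>x. of_real x * window R x) \<in> dominated (\<lambda>x. 1)"
  by (rule dominated_bounded[OF x_window_measurable, of _ "real R"]) (auto simp: window_def indicator_def)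

lemma window_tendsto: "(\<lambda>R. window R x) \<longlonglongrightarrow> 1"
proof -
  obtain N :: nat where N: "\<bar>x\<bar> \<le> real N" using real_arch_simple by blast
  have "eventually (\<lambda>R. window R x = 1) sequentially"
    using eventually_ge_at_top[of N] by eventually_elim (use N in \<open>auto simp: window_def indicator_def\<close>)
  thus ?thesis by (rule tendsto_eventually)
qed

lemma \<Phi>_window: "u \<in> ell2 \<Longrightarrow> \<Phi> (window R) u = E0 {- real R..real R} u"
  unfolding window_def by (rule \<Phi>_indicator) auto

lemma S_window_tendsto:
  assumes "u \<in> ell2" "v \<in> ell2"
  shows "(\<lambda>R. S (window R) v u) \<longlonglongrightarrow> ell2_inner v u"
proof -
  have "(\<lambda>R. S (window R) v u) \<longlonglongrightarrow> S (indicator UNIV) v u"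
    by (rule dct_limit[OF dct_S[OF assms], where C=1])
       (use window_measurable window_norm_le window_tendsto in auto)
  thus ?thesis using assms by (simp add: S_indicator E_UNIV del: indicator_UNIV)
qed

lemma \<Phi>_window_dom: "u \<in> ell2 \<Longrightarrow> \<Phi> (window R) u \<in> D"
  unfolding laguerre_dom_def
  by (auto simp: op_\<Phi>[OF window_dominated x_window_dominated] intro: \<Phi>_ell2 window_dominated x_window_dominated)

text \<open>The left side pairs \<open>u\<close> with \<open>H\<close> applied to a cutoff unit
  vector, which lies in the domain. Moving \<open>H\<close> onto \<open>u\<close> is legitimate by
  \<open>laguerre_op_symmetric\<close> and fails in general without it.\<close>

lemma \<Phi>_x_window:
  assumes u: "u \<in> D"
  shows "\<Phi> (\<lambda>x. of_real x * window R x) u = E0 {- real R..real R} (H u)"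
proof
  fix n
  let ?f = "\<lambda>x. of_real x * window R x"
  have u2: "u \<in> ell2" "H u \<in> ell2" using u by (auto simp: laguerre_dom_def)
  have cnj: "(\<lambda>x. cnj (?f x)) = ?f" by (auto simp: window_def indicator_def)
  have "\<Phi> ?f u n = cnj (S ?f u (delta n))"
    using S_cnj[OF u2(1) delta_ell2 x_window_dominated, of R n] by (simp only: cnj \<Phi>_def)
  also have "\<dots> = cnj (ell2_inner u (\<Phi> ?f (delta n)))"
    by (simp add: inner_\<Phi> u2 delta_ell2 x_window_dominated)
  also have "\<dots> = ell2_inner (\<Phi> ?f (delta n)) u"
    by (intro inner_cnj u2 \<Phi>_ell2 delta_ell2 x_window_dominated)
  also have "\<Phi> ?f (delta n) = H (\<Phi> (window R) (delta n))"
    by (rule op_\<Phi>[OF window_dominated x_window_dominated delta_ell2, symmetric])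
  also have "ell2_inner \<dots> u = ell2_inner (\<Phi> (window R) (delta n)) (H u)"
    by (intro laguerre_op_symmetric \<alpha> u \<Phi>_window_dom delta_ell2)
  also have "\<dots> = ell2_inner (delta n) (E0 {- real R..real R} (H u))"
    unfolding \<Phi>_window[OF delta_ell2] by (rule E_sym[symmetric]) (auto simp: u2 delta_ell2)
  finally show "\<Phi> ?f u n = E0 {- real R..real R} (H u) n"
    by (simp add: inner_delta_left)
qed

lemma nsq_\<Phi>_x_window:
  assumes "u \<in> ell2"
  shows "ennreal (nsq (\<Phi> (\<lambda>x. of_real x * window R x) u)) = (\<integral>\<^sup>+x. ennreal (x\<^sup>2 * indicator {- real R..real R} x) \<partial>\<mu> u)"
proof -
  have eq: "(cmod (of_real x * window R x))\<^sup>2 = x\<^sup>2 * indicator {- real R..real R} x" for x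
    by (auto simp: window_def indicator_def)
  interpret finite_measure "\<mu> u" by (rule finite_measure_\<mu>[OF assms])
  have "integrable (\<mu> u) (\<lambda>x. x\<^sup>2 * indicator {- real R..real R} x)"
  proof (rule integrable_const_bound[of _ "(real R)\<^sup>2"])
    have "\<bar>x\<^sup>2 * indicator {- real R..real R} x\<bar> \<le> (real R)\<^sup>2" for x :: real
      by (auto simp: indicator_def abs_le_square_iff[symmetric])
    thus "AE x in \<mu> u. norm (x\<^sup>2 * indicator {- real R..real R} x) \<le> (real R)\<^sup>2" by simp
  qed simp
  thus ?thesis unfolding nsq_\<Phi>[OF assms x_window_dominated] eq
    by (subst nn_integral_eq_integral) auto
qed

text \<open>For \<open>u\<close> in the domain, the second moment cut off at \<open>R\<close> is the
  squared norm of a projection of \<open>H u\<close>, so monotone convergence bounds the whole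
  moment. Conversely a finite moment bounds \<open>H (\<Phi> (window R) u)\<close> in norm, and
  these vectors tend to \<open>H u\<close> in each coordinate, which involves at most three
  entries.\<close>

lemma laguerre_dom_eq: "D = {u \<in> ell2. (\<integral>\<^sup>+x. ennreal (x\<^sup>2) \<partial>\<mu> u) < \<infinity>}"
proof (intro equalityI subsetI)
  fix u assume u: "u \<in> D"
  hence u2: "u \<in> ell2" "H u \<in> ell2" by (auto simp: laguerre_dom_def)
  let ?f = "\<lambda>R x. ennreal (x\<^sup>2 * indicator {- real R..real R} x)"
  have "(SUP R. ?f R x) = ennreal (x\<^sup>2)" for x
  proof (rule antisym)
    show "(SUP R. ?f R x) \<le> ennreal (x\<^sup>2)" by (intro SUP_least) (auto simp: indicator_def)
    obtain N :: nat where N: "\<bar>x\<bar> \<le> real N" using real_arch_simple by blast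
    have "ennreal (x\<^sup>2) = ?f N x" using N by (auto simp: indicator_def)
    also have "\<dots> \<le> (SUP R. ?f R x)" by (intro SUP_upper) auto
    finally show "ennreal (x\<^sup>2) \<le> (SUP R. ?f R x)" .
  qed
  hence "(\<integral>\<^sup>+x. ennreal (x\<^sup>2) \<partial>\<mu> u) = (\<integral>\<^sup>+x. (SUP R. ?f R x) \<partial>\<mu> u)" by simp
  also have "\<dots> = (SUP R. \<integral>\<^sup>+x. ?f R x \<partial>\<mu> u)"
    by (intro nn_integral_monotone_convergence_SUP) (auto simp: incseq_def le_fun_def indicator_def)
  also have "\<dots> \<le> ennreal (nsq (H u))"
    by (intro SUP_least)
       (auto simp: nsq_\<Phi>_x_window[OF u2(1), symmetric] \<Phi>_x_window[OF u] intro!: ennreal_leI nsq_E_le u2)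
  also have "\<dots> < \<infinity>" by simp
  finally show "u \<in> {u \<in> ell2. (\<integral>\<^sup>+x. ennreal (x\<^sup>2) \<partial>\<mu> u) < \<infinity>}" using u2 by simp
next
  fix u assume "u \<in> {u \<in> ell2. (\<integral>\<^sup>+x. ennreal (x\<^sup>2) \<partial>\<mu> u) < \<infinity>}"
  hence u: "u \<in> ell2" and fin: "(\<integral>\<^sup>+x. ennreal (x\<^sup>2) \<partial>\<mu> u) < \<infinity>" by auto
  define C where "C = enn2real (\<integral>\<^sup>+x. ennreal (x\<^sup>2) \<partial>\<mu> u)"
  have C: "ennreal C = (\<integral>\<^sup>+x. ennreal (x\<^sup>2) \<partial>\<mu> u)" unfolding C_def using fin by simp
  have bd: "nsq (\<Phi> (\<lambda>x. of_real x * window R x) u) \<le> C" for R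
  proof -
    have "ennreal (nsq (\<Phi> (\<lambda>x. of_real x * window R x) u)) \<le> ennreal C"
      unfolding nsq_\<Phi>_x_window[OF u] C by (intro nn_integral_mono) (auto simp: indicator_def)
    moreover have "0 \<le> C" by (simp add: C_def)
    ultimately show ?thesis by (simp add: ennreal_le_iff)
  qed
  have lim: "(\<lambda>R. H (\<Phi> (window R) u) n) \<longlonglongrightarrow> H u n" for n
  proof -
    have "(\<lambda>R. \<Phi> (window R) u k) \<longlonglongrightarrow> u k" for k
      unfolding \<Phi>_def using S_window_tendsto[OF u delta_ell2, of k] by (simp add: inner_delta_left)
    thus ?thesis unfolding laguerre_op_eq by (intro tendsto_intros)
  qed
  have "(\<Sum>n<K. (cmod (H u n))\<^sup>2) \<le> C" for K
  proof (rule LIMSEQ_le_const2)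
    show "(\<lambda>R. \<Sum>n<K. (cmod (H (\<Phi> (window R) u) n))\<^sup>2) \<longlonglongrightarrow> (\<Sum>n<K. (cmod (H u n))\<^sup>2)"
      by (intro tendsto_intros lim)
    have "(\<Sum>n<K. (cmod (H (\<Phi> (window R) u) n))\<^sup>2) \<le> C" for R
      unfolding op_\<Phi>[OF window_dominated x_window_dominated u]
      using sum_le_nsq[OF \<Phi>_ell2[OF u x_window_dominated]] bd order_trans by blast
    thus "\<exists>N. \<forall>R\<ge>N. (\<Sum>n<K. (cmod (H (\<Phi> (window R) u) n))\<^sup>2) \<le> C" by blast
  qed
  from ell2I_bounded(1)[OF this] show "u \<in> D" using u by (simp add: laguerre_dom_def)
qed

text \<open>With a cutoff the identity follows from \<open>\<Phi>_x_window\<close>; the cutoff is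
  removed on one side by strong convergence of the projections in the weak sense of
  \<open>S_window_tendsto\<close>, on the other by domination with 1 + |x|.\<close>

lemma resolution_form:
  assumes u: "u \<in> D" and v: "v \<in> D"
  shows "ell2_inner v (H u) = S complex_of_real v u"
proof -
  have u2: "u \<in> ell2" "H u \<in> ell2" and v2: "v \<in> ell2" using u v by (auto simp: laguerre_dom_def)
  have dct: "dct_functional (\<lambda>x. 1 + \<bar>x\<bar>) (\<lambda>f. S f v u)"
    using laguerre_dom_lincomb[OF v u, of 1] laguerre_dom_eq
    by (intro dct_S_general integrable_first_moment) auto
  have "S (\<lambda>x. of_real x * window R x) v u = S (window R) v (H u)" for R
  proof -
    have "S (\<lambda>x. of_real x * window R x) v u = ell2_inner v (\<Phi> (window R) (H u))"
      by (simp add: inner_\<Phi>[symmetric] u2 v2 x_window_dominated \<Phi>_x_window[OF u] \<Phi>_window)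
    thus ?thesis by (simp add: inner_\<Phi> u2 v2 window_dominated)
  qed
  hence "(\<lambda>R. S (\<lambda>x. of_real x * window R x) v u) \<longlonglongrightarrow> ell2_inner v (H u)"
    using S_window_tendsto[OF u2(2) v2] by simp
  moreover have "(\<lambda>R. S (\<lambda>x. of_real x * window R x) v u) \<longlonglongrightarrow> S complex_of_real v u"
  proof (rule dct_limit[OF dct, where C=1])
    show "(\<lambda>x. of_real x * window R x) \<in> borel_measurable borel" for R by (rule x_window_measurable)
    show "cmod (of_real x * window R x) \<le> 1 * (1 + \<bar>x\<bar>)" for R x using window_norm_le(2)[of x R] by simp
    show "(\<lambda>R. of_real x * window R x) \<longlonglongrightarrow> complex_of_real x" for x
      using tendsto_mult[OF tendsto_const[of "complex_of_real x"] window_tendsto[of x]] by simp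
  qed
  ultimately show ?thesis by (rule LIMSEQ_unique)
qed

lemma spectral_resolution_E0: "spectral_resolution (D) (H) E0"
  unfolding spectral_resolution_def
  using pvm_E0 laguerre_dom_eq resolution_form by (auto simp: laguerre_dom_def)

end

section \<open>The weights and their modes\<close>

lemma laguerre_p_eq:
  assumes "0 \<le> \<alpha>" "0 \<le> s"
  shows "laguerre_p \<alpha> k s = (lag_c \<alpha> k)\<^sup>2 * (s / (1 + s)) ^ k * (1 + s) powr (- (\<alpha> + 1))"
proof -
  have "\<alpha> + 1 \<notin> \<int>\<^sub>\<le>\<^sub>0" using assms by (auto elim!: nonpos_Ints_cases)
  hence 1: "pochhammer (\<alpha> + 1) k = Gamma (real k + \<alpha> + 1) / Gamma (\<alpha> + 1)"
    by (simp add: pochhammer_Gamma add_ac)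
  have 2: "Gamma (real k + 1) = fact k" by (simp add: Gamma_fact add.commute)
  have 3: "(1 + s) powr (real k + \<alpha> + 1) = (1 + s) ^ k * (1 + s) powr (\<alpha> + 1)"
    using assms by (simp add: powr_add powr_realpow)
  show ?thesis
    unfolding laguerre_p_def lag_c_power2[OF assms(1)] 1 2 3 power_divide powr_minus_divide[of _ "\<alpha> + 1"] by simp
qed

lemma laguerre_p_nonneg: "0 \<le> \<alpha> \<Longrightarrow> 0 \<le> s \<Longrightarrow> 0 \<le> laguerre_p \<alpha> k s"
  by (simp add: laguerre_p_eq)

text \<open>The comparison of this ratio with 1 decides the modes: (\<alpha> + 1 + k) s - (k + 1) (1
  + s) equals \<alpha> s - (k + 1).\<close>

lemma laguerre_p_Suc:
  assumes "0 \<le> \<alpha>" "0 \<le> s"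
  shows "laguerre_p \<alpha> (Suc k) s = laguerre_p \<alpha> k s * ((\<alpha> + 1 + real k) * s / ((real k + 1) * (1 + s)))"
  using assms by (simp add: laguerre_p_eq lag_c_power2 pochhammer_Suc add_ac mult_ac)

lemma laguerre_p_le_Suc:
  assumes "0 \<le> \<alpha>" "0 \<le> s" "real k + 1 \<le> \<alpha> * s"
  shows "laguerre_p \<alpha> k s \<le> laguerre_p \<alpha> (Suc k) s"
proof -
  have "1 \<le> (\<alpha> + 1 + real k) * s / ((real k + 1) * (1 + s))"
    using assms by (simp add: divide_simps) (simp add: algebra_simps)
  from mult_left_mono[OF this laguerre_p_nonneg[OF assms(1,2)]] show ?thesis
    by (simp add: laguerre_p_Suc[OF assms(1,2)])
qed

lemma laguerre_p_Suc_le: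
  assumes "0 \<le> \<alpha>" "0 \<le> s" "\<alpha> * s \<le> real k + 1"
  shows "laguerre_p \<alpha> (Suc k) s \<le> laguerre_p \<alpha> k s"
proof -
  have "(\<alpha> + 1 + real k) * s / ((real k + 1) * (1 + s)) \<le> 1"
    using assms by (simp add: divide_simps) (simp add: algebra_simps)
  from mult_left_mono[OF this laguerre_p_nonneg[OF assms(1,2)]] show ?thesis
    by (simp add: laguerre_p_Suc[OF assms(1,2)])
qed

text \<open>The weights increase up to \<open>K\<close> and decrease afterwards. Both bounds on
  \<alpha> s are non-strict, so an integer value m of \<alpha> s admits \<open>K = m\<close> as well
  as \<open>K = m - 1\<close>.\<close>

lemma laguerre_p_mode:
  assumes "0 \<le> \<alpha>" "0 \<le> s" and lower: "real K \<le> \<alpha> * s" and upper: "\<alpha> * s \<le> real K + 1"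
  shows "is_mode (\<lambda>k. laguerre_p \<alpha> k s) K"
  unfolding is_mode_def
proof
  fix j
  show "laguerre_p \<alpha> j s \<le> laguerre_p \<alpha> K s"
  proof (cases "j \<le> K")
    case True
    thus ?thesis
    proof (induction j rule: inc_induct)
      case (step n)
      have "laguerre_p \<alpha> n s \<le> laguerre_p \<alpha> (Suc n) s"
        by (rule laguerre_p_le_Suc) (use assms step in auto)
      thus ?case using step by simp
    qed simp
  next
    case False
    hence "K \<le> j" by simp
    thus ?thesis
    proof (induction j rule: dec_induct)
      case (step n)
      have "laguerre_p \<alpha> (Suc n) s \<le> laguerre_p \<alpha> n s"
        by (rule laguerre_p_Suc_le) (use assms step in auto)
      thus ?case using step by simp
    qed simp
  qed
qed

lemma laguerre_p_mode_floor:
  assumes "0 \<le> \<alpha>" "0 \<le> s"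
  shows "is_mode (\<lambda>k. laguerre_p \<alpha> k s) (nat \<lfloor>\<alpha> * s\<rfloor>)"
proof -
  have "0 \<le> \<alpha> * s" using assms by simp
  thus ?thesis by (intro laguerre_p_mode assms) linarith+
qed

section \<open>Asymptotics of the maximal weight\<close>

text \<open>Gauss' limit for 1 / Gamma. \<open>rGamma_series\<close> carries one more Pochhammer
  factor and one more power of n; the quotient n / (\<alpha> + 1 + n), which tends to 1, removes
  both.\<close>

lemma pochhammer_asymptotics:
  assumes "0 \<le> \<alpha>"
  shows "(\<lambda>n. pochhammer (\<alpha> + 1) n / (fact n * real n powr \<alpha>)) \<longlonglongrightarrow> 1 / Gamma (\<alpha> + 1)"
proof -
  have "(\<lambda>n. rGamma_series (\<alpha> + 1) n * (real n / (\<alpha> + 1 + real n))) \<longlonglongrightarrow> rGamma (\<alpha> + 1) * 1"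
  proof (intro tendsto_mult rGamma_series_LIMSEQ)
    show "(\<lambda>n. real n / (\<alpha> + 1 + real n)) \<longlonglongrightarrow> 1" by real_asymp
  qed
  moreover have "eventually (\<lambda>n. rGamma_series (\<alpha> + 1) n * (real n / (\<alpha> + 1 + real n)) =
      pochhammer (\<alpha> + 1) n / (fact n * real n powr \<alpha>)) sequentially"
    using eventually_gt_at_top[of 0]
  proof eventually_elim
    case (elim n)
    have "exp ((\<alpha> + 1) * ln (real n)) = real n powr \<alpha> * real n"
      using elim by (simp add: powr_def exp_add algebra_simps)
    moreover have "\<alpha> + 1 + real n \<noteq> 0" using assms by simp
    ultimately show ?case using elim
      by (simp add: rGamma_series_def pochhammer_Suc)
  qed
  ultimately have "(\<lambda>n. pochhammer (\<alpha> + 1) n / (fact n * real n powr \<alpha>)) \<longlonglongrightarrow> rGamma (\<alpha> + 1) * 1"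
    by (rule Lim_transform_eventually)
  thus ?thesis by (simp add: rGamma_inverse_Gamma divide_inverse)
qed

text \<open>With K the mode, s p_K is split into four factors with separate limits. Multiplying and
  dividing by K^\<alpha> brings in the Pochhammer limit, and s^(\<alpha>+1) turns (1 +
  s)^(-\<alpha>-1) into a factor tending to 1.\<close>

lemma max_weight_asymptotics:
  assumes \<alpha>: "0 < \<alpha>"
  shows "((\<lambda>s. s * laguerre_p \<alpha> (nat \<lfloor>\<alpha> * s\<rfloor>) s) \<longlongrightarrow> \<alpha> powr \<alpha> * exp (- \<alpha>) / Gamma (\<alpha> + 1)) at_top"
proof -
  define K where "K s = nat \<lfloor>\<alpha> * s\<rfloor>" for s
  have Klim: "filterlim K at_top at_top"
    unfolding filterlim_at_top
  proof
    fix Z :: nat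
    show "eventually (\<lambda>s. Z \<le> K s) at_top"
      using eventually_ge_at_top[of "real Z / \<alpha>"]
      by eventually_elim (use \<alpha> in \<open>auto simp: K_def le_nat_floor field_simps\<close>)
  qed
  have Kpos: "eventually (\<lambda>s. K s > 0) at_top"
    using Klim[unfolded filterlim_at_top, rule_format, of 1] by eventually_elim simp
  have ratio: "((\<lambda>s. real (K s) / s) \<longlongrightarrow> \<alpha>) at_top"
  proof (rule tendsto_sandwich)
    show "eventually (\<lambda>s. \<alpha> - 1 / s \<le> real (K s) / s) at_top"
      using eventually_gt_at_top[of 0]
    proof eventually_elim
      case (elim s)
      have "\<alpha> * s - 1 \<le> real (K s)" unfolding K_def by linarith
      from divide_right_mono[OF this, of s] show ?case using elim by (simp add: diff_divide_distrib)
    qed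
    show "eventually (\<lambda>s. real (K s) / s \<le> \<alpha>) at_top"
      using eventually_gt_at_top[of 0]
    proof eventually_elim
      case (elim s)
      have "0 \<le> \<alpha> * s" using elim \<alpha> by simp
      hence "real (K s) \<le> \<alpha> * s" unfolding K_def by linarith
      thus ?case using elim by (simp add: field_simps)
    qed
    show "((\<lambda>s. \<alpha> - 1 / s) \<longlongrightarrow> \<alpha>) at_top" by real_asymp
  qed simp
  have l1: "((\<lambda>s. pochhammer (\<alpha> + 1) (K s) / (fact (K s) * real (K s) powr \<alpha>)) \<longlongrightarrow> 1 / Gamma (\<alpha> + 1)) at_top"
    using pochhammer_asymptotics[of \<alpha>] \<alpha> by (intro filterlim_compose[OF _ Klim]) auto
  have l2: "((\<lambda>s. (real (K s) / s) powr \<alpha>) \<longlongrightarrow> \<alpha> powr \<alpha>) at_top"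
    by (intro tendsto_powr ratio tendsto_const) (use \<alpha> in auto)
  \<comment> \<open>The exponent of the growing power (s / (1 + s))^K is K / s times s ln (s / (1 +
    s)); these tend to \<alpha> and -1.\<close>
  have "((\<lambda>s :: real. s * ln (s / (1 + s))) \<longlongrightarrow> - 1) at_top" by real_asymp
  hence l3: "((\<lambda>s. exp (real (K s) / s * (s * ln (s / (1 + s))))) \<longlongrightarrow> exp (\<alpha> * (- 1))) at_top"
    by (intro tendsto_exp tendsto_mult ratio)
  have l4: "((\<lambda>s. (s / (1 + s)) powr (\<alpha> + 1)) \<longlongrightarrow> 1) at_top"
  proof -
    have "((\<lambda>s::real. s / (1 + s)) \<longlongrightarrow> 1) at_top" by real_asymp
    from tendsto_powr[OF this tendsto_const[of "\<alpha> + 1"]] show ?thesis by simp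
  qed
  have "((\<lambda>s. pochhammer (\<alpha> + 1) (K s) / (fact (K s) * real (K s) powr \<alpha>) * (real (K s) / s) powr \<alpha> *
      exp (real (K s) / s * (s * ln (s / (1 + s)))) * (s / (1 + s)) powr (\<alpha> + 1)) \<longlongrightarrow>
      1 / Gamma (\<alpha> + 1) * \<alpha> powr \<alpha> * exp (\<alpha> * (- 1)) * 1) at_top"
    by (intro tendsto_mult l1 l2 l3 l4)
  moreover have "eventually (\<lambda>s. pochhammer (\<alpha> + 1) (K s) / (fact (K s) * real (K s) powr \<alpha>) * (real (K s) / s) powr \<alpha> *
      exp (real (K s) / s * (s * ln (s / (1 + s)))) * (s / (1 + s)) powr (\<alpha> + 1) = s * laguerre_p \<alpha> (K s) s) at_top"
    using Kpos eventually_gt_at_top[of 0]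
  proof eventually_elim
    case (elim s)
    have "exp (real (K s) / s * (s * ln (s / (1 + s)))) = (s / (1 + s)) ^ K s"
      using elim by (simp add: exp_of_nat_mult)
    moreover have "(real (K s) / s) powr \<alpha> = real (K s) powr \<alpha> / s powr \<alpha>"
      using elim by (simp add: powr_divide)
    moreover have "(s / (1 + s)) powr (\<alpha> + 1) = s powr \<alpha> * s * (1 + s) powr (- (\<alpha> + 1))"
    proof -
      have "(s / (1 + s)) powr (\<alpha> + 1) = s powr (\<alpha> + 1) / (1 + s) powr (\<alpha> + 1)"
        by (rule powr_divide)
      thus ?thesis unfolding powr_minus_divide using elim by (simp add: powr_add)
    qed
    ultimately show ?case using elim \<alpha>
      by (simp add: laguerre_p_eq lag_c_power2)
  qed
  ultimately have "((\<lambda>s. s * laguerre_p \<alpha> (K s) s) \<longlongrightarrow> 1 / Gamma (\<alpha> + 1) * \<alpha> powr \<alpha> * exp (\<alpha> * (- 1)) * 1) at_top"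
    by (rule Lim_transform_eventually)
  thus ?thesis by (simp add: K_def)
qed

lemma max_weight_asymptotics_0: "((\<lambda>s. s * laguerre_p 0 0 s) \<longlongrightarrow> 1) at_top"
proof -
  have "((\<lambda>s::real. s / (1 + s)) \<longlongrightarrow> 1) at_top" by real_asymp
  moreover have "eventually (\<lambda>s. s / (1 + s) = s * laguerre_p 0 0 s) at_top"
    using eventually_gt_at_top[of 0]
    by eventually_elim (simp add: laguerre_p_eq powr_minus divide_inverse)
  ultimately show ?thesis by (rule Lim_transform_eventually)
qed

section \<open>The evolution operator\<close>

context
  fixes \<alpha> :: real
  assumes \<alpha>: "0 \<le> \<alpha>"
begin

definition "spectral_E = (SOME E. spectral_resolution (laguerre_dom \<alpha>) (laguerre_op \<alpha>) E)"

lemma resolution: "spectral_resolution (laguerre_dom \<alpha>) (laguerre_op \<alpha>) spectral_E"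
proof -
  interpret laguerre_weight \<alpha> by standard (rule \<alpha>)
  show ?thesis unfolding spectral_E_def using spectral_resolution_E0 by (rule someI[of "spectral_resolution (laguerre_dom \<alpha>) (laguerre_op \<alpha>)"])
qed

lemma laguerre_resolution_E: "laguerre_resolution spectral_E \<alpha>"
  by standard (use resolution \<alpha> in \<open>auto simp: spectral_resolution_def\<close>)

lemma laguerre_evolution_eq: "laguerre_evolution \<alpha> t u n = spectral_form spectral_E (osc t) (delta n) u"
proof -
  have "osc t = (\<lambda>x. exp (- \<i> * complex_of_real t * complex_of_real x))"
    by (auto simp: osc_def)
  thus ?thesis by (simp only: laguerre_evolution_def functional_calculus_def spectral_E_def)
qed

text \<open>\<open>S_bound\<close> on two vectors of squared norm at most 1 gives 2 + 2. Any uniform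
  constant would do: it ensures that the suprema in \<open>linf_norm\<close> and
  \<open>ell1_linf_opnorm\<close> are taken over bounded sets.\<close>

lemma evolution_bound:
  assumes "u \<in> ell1" "ell1_norm u \<le> 1"
  shows "cmod (laguerre_evolution \<alpha> t u n) \<le> 4"
proof -
  interpret laguerre_resolution spectral_E \<alpha> by (rule laguerre_resolution_E)
  have u: "u \<in> ell2" "nsq u \<le> 1" by (fact ell1_subset_ell2[OF assms])+
  have "cmod (S (osc t) (delta n) u) \<le> 1 * (2 * nsq (delta n) + 2 * nsq u)"
    by (rule S_bound) (auto simp: u delta_ell2)
  thus ?thesis using u by (simp add: laguerre_evolution_eq nsq_delta)
qed

lemma laguerre_kernel_eq: "laguerre_kernel \<alpha> t 0 k = cmod (lag_psi \<alpha> k t)"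
proof -
  interpret laguerre_resolution spectral_E \<alpha> by (rule laguerre_resolution_E)
  show ?thesis by (simp add: laguerre_kernel_def inner_delta_left laguerre_evolution_eq S_osc_eq_psi)
qed

lemma laguerre_kernel_power2: "(laguerre_kernel \<alpha> t 0 k)\<^sup>2 = laguerre_p \<alpha> k (t\<^sup>2)"
  by (simp add: laguerre_kernel_eq lag_psi_norm[OF \<alpha>] laguerre_p_eq[OF \<alpha>])

lemma laguerre_kernel_sqrt: "laguerre_kernel \<alpha> t 0 k = sqrt (laguerre_p \<alpha> k (t\<^sup>2))"
  by (simp add: laguerre_kernel_power2[symmetric] laguerre_kernel_eq)

text \<open>\<open>delta k\<close> is a unit vector of \<open>ell1\<close>, and the kernel is one
  coordinate of its image.\<close>

lemma kernel_le_opnorm: "laguerre_kernel \<alpha> t 0 k \<le> ell1_linf_opnorm (laguerre_evolution \<alpha> t)"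
proof -
  have linf: "linf_norm (laguerre_evolution \<alpha> t u) \<le> 4" if "u \<in> ell1" "ell1_norm u \<le> 1" for u
    unfolding linf_norm_def by (intro cSUP_least evolution_bound that) auto
  have d: "delta k \<in> ell1" "ell1_norm (delta k) \<le> 1"
  proof -
    have "(\<lambda>n. cmod (delta k n)) sums (\<Sum>n\<in>{k}. cmod (delta k n))"
      by (rule sums_finite) (auto simp: delta_def)
    thus "delta k \<in> ell1" "ell1_norm (delta k) \<le> 1"
      by (auto simp: ell1_def ell1_norm_def sums_iff delta_def)
  qed
  have "laguerre_kernel \<alpha> t 0 k = cmod (laguerre_evolution \<alpha> t (delta k) 0)"
    by (simp add: laguerre_kernel_def inner_delta_left)
  also have "\<dots> \<le> linf_norm (laguerre_evolution \<alpha> t (delta k))"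
    unfolding linf_norm_def
    by (rule cSUP_upper) (use evolution_bound[OF d] in \<open>auto intro!: bdd_aboveI2[where M=4]\<close>)
  also have "\<dots> \<le> ell1_linf_opnorm (laguerre_evolution \<alpha> t)"
    unfolding ell1_linf_opnorm_def
    by (rule cSUP_upper) (use d linf in \<open>auto intro!: bdd_aboveI2[where M=4]\<close>)
  finally show ?thesis .
qed

lemma kernel_mode: "is_mode (\<lambda>k. laguerre_kernel \<alpha> t 0 k) (nat \<lfloor>\<alpha> * t\<^sup>2\<rfloor>)"
  using laguerre_p_mode_floor[OF \<alpha>, of "t\<^sup>2"] by (simp add: is_mode_def laguerre_kernel_sqrt)

lemma SUP_kernel: "(SUP k. laguerre_kernel \<alpha> t 0 k) = sqrt (laguerre_p \<alpha> (nat \<lfloor>\<alpha> * t\<^sup>2\<rfloor>) (t\<^sup>2))"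
proof -
  have "(SUP k. laguerre_kernel \<alpha> t 0 k) = laguerre_kernel \<alpha> t 0 (nat \<lfloor>\<alpha> * t\<^sup>2\<rfloor>)"
    using kernel_mode[of t] by (intro cSup_eq_maximum) (auto simp: is_mode_def)
  thus ?thesis by (simp add: laguerre_kernel_sqrt)
qed

text \<open>Substituting s = t^2, which tends to infinity for both signs of t, and taking roots
  turns s into |t|. The supremum is the value at the mode by \<open>SUP_kernel\<close>.\<close>

lemma kernel_limit:
  assumes "((\<lambda>s. s * laguerre_p \<alpha> (nat \<lfloor>\<alpha> * s\<rfloor>) s) \<longlongrightarrow> L) at_top"
  shows "((\<lambda>t. \<bar>t\<bar> * (SUP k. laguerre_kernel \<alpha> t 0 k)) \<longlongrightarrow> sqrt L) at_infinity"
proof -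
  have "filterlim (\<lambda>t::real. \<bar>t\<bar>) at_top at_infinity"
    unfolding real_norm_def[symmetric] by (rule filterlim_norm_at_top)
  hence "filterlim (\<lambda>t::real. \<bar>t\<bar> ^ 2) at_top at_infinity"
    by (rule filterlim_pow_at_top[rotated]) simp
  hence "filterlim (\<lambda>t::real. t\<^sup>2) at_top at_infinity" by simp
  from tendsto_real_sqrt[OF filterlim_compose[OF assms this]]
  show ?thesis by (simp add: SUP_kernel real_sqrt_mult)
qed

end

theorem proposition11p5:
  fixes \<alpha> :: real
  assumes "0 \<le> \<alpha>"
  shows "(\<forall>t::real.
            (\<forall>k. (laguerre_kernel \<alpha> t 0 k)\<^sup>2 = laguerre_p \<alpha> k (t\<^sup>2)) \<and>
            (\<exists>k. is_mode (\<lambda>k. laguerre_p \<alpha> k (t\<^sup>2)) k) \<and>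
            (ell1_linf_opnorm (laguerre_evolution \<alpha> t))\<^sup>2 \<ge> (SUP k. laguerre_p \<alpha> k (t\<^sup>2)) \<and>
            (0 < \<alpha> \<longrightarrow>
               is_mode (\<lambda>k. laguerre_p \<alpha> k (t\<^sup>2)) (nat \<lfloor>\<alpha> * t\<^sup>2\<rfloor>) \<and>
               (\<forall>m::nat. 1 \<le> m \<and> real m = \<alpha> * t\<^sup>2 \<longrightarrow>
                  laguerre_p \<alpha> (m - 1) (t\<^sup>2) = laguerre_p \<alpha> m (t\<^sup>2) \<and>
                  is_mode (\<lambda>k. laguerre_p \<alpha> k (t\<^sup>2)) (m - 1) \<and>
                  is_mode (\<lambda>k. laguerre_p \<alpha> k (t\<^sup>2)) m)) \<and>
            (\<exists>k. is_mode (\<lambda>k. laguerre_kernel \<alpha> t 0 k) k)) \<and>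
         (0 < \<alpha> \<longrightarrow>
            ((\<lambda>t::real. \<bar>t\<bar> * (SUP k. laguerre_kernel \<alpha> t 0 k)) \<longlongrightarrow>
               (\<alpha> powr \<alpha> * exp (- \<alpha>) / Gamma (\<alpha> + 1)) powr (1 / 2)) at_infinity) \<and>
         (\<alpha> = 0 \<longrightarrow>
            ((\<lambda>t::real. \<bar>t\<bar> * (SUP k. laguerre_kernel \<alpha> t 0 k)) \<longlongrightarrow> 1) at_infinity)"
proof (intro conjI allI impI)
  fix t :: real and k :: nat
  show "(laguerre_kernel \<alpha> t 0 k)\<^sup>2 = laguerre_p \<alpha> k (t\<^sup>2)"
    by (rule laguerre_kernel_power2[OF assms])
  show "\<exists>k. is_mode (\<lambda>k. laguerre_p \<alpha> k (t\<^sup>2)) k"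
    using laguerre_p_mode_floor[OF assms, of "t\<^sup>2"] by auto
  show "\<exists>k. is_mode (\<lambda>k. laguerre_kernel \<alpha> t 0 k) k"
    using kernel_mode[OF assms] by blast
  show "(SUP k. laguerre_p \<alpha> k (t\<^sup>2)) \<le> (ell1_linf_opnorm (laguerre_evolution \<alpha> t))\<^sup>2"
  proof (rule cSUP_least)
    fix k
    have "0 \<le> laguerre_kernel \<alpha> t 0 k" by (simp add: laguerre_kernel_def)
    thus "laguerre_p \<alpha> k (t\<^sup>2) \<le> (ell1_linf_opnorm (laguerre_evolution \<alpha> t))\<^sup>2"
      unfolding laguerre_kernel_power2[OF assms, symmetric]
      by (intro power_mono kernel_le_opnorm[OF assms])
  qed simp
  show "is_mode (\<lambda>k. laguerre_p \<alpha> k (t\<^sup>2)) (nat \<lfloor>\<alpha> * t\<^sup>2\<rfloor>)"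
    by (rule laguerre_p_mode_floor[OF assms]) simp
next
  fix t :: real and m :: nat assume m: "1 \<le> m \<and> real m = \<alpha> * t\<^sup>2"
  show m1: "is_mode (\<lambda>k. laguerre_p \<alpha> k (t\<^sup>2)) (m - 1)"
    by (rule laguerre_p_mode) (use assms m in auto)
  show m2: "is_mode (\<lambda>k. laguerre_p \<alpha> k (t\<^sup>2)) m"
    by (rule laguerre_p_mode) (use assms m in auto)
  \<comment> \<open>Both indices are maximizers, so the two values bound each other.\<close>
  show "laguerre_p \<alpha> (m - 1) (t\<^sup>2) = laguerre_p \<alpha> m (t\<^sup>2)"
    using m1 m2 by (auto simp: is_mode_def intro: antisym)
next
  assume "0 < \<alpha>"
  moreover have "Gamma (\<alpha> + 1) > 0" using assms by (intro Gamma_real_pos) simp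
  ultimately show "((\<lambda>t::real. \<bar>t\<bar> * (SUP k. laguerre_kernel \<alpha> t 0 k)) \<longlongrightarrow>
      (\<alpha> powr \<alpha> * exp (- \<alpha>) / Gamma (\<alpha> + 1)) powr (1 / 2)) at_infinity"
    using kernel_limit[OF assms max_weight_asymptotics] by (simp add: powr_half_sqrt)
next
  assume "\<alpha> = 0"
  thus "((\<lambda>t::real. \<bar>t\<bar> * (SUP k. laguerre_kernel \<alpha> t 0 k)) \<longlongrightarrow> 1) at_infinity"
    \<comment> \<open>For \<alpha> = 0 the floor is 0 for every s, so the mode is k = 0.\<close>
    using kernel_limit[of 0 1] max_weight_asymptotics_0 by simp
qed

end
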